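(* Let $\mathcal{D}$ be a distribution on $Q$, and let $g$ and $\hat g$ be two Riemannian metrics on $Q$ which are a $\mathcal{D}$-preserving modification of each other. Put $L(v)=\frac12g(v,v)$ and $\hat L(v)=\frac12\hat g(v,v)$. The following statements are equivalent: (i) The condition $(A)$ is satisfied for $\hat g$: $\hat g_{bk}R^k_{ac}v^av^b=0$ for all $c$ and all $v^a$. (ii) The vector field $\Gamma^1_{\hat g}=\hat p(\Gamma_{\hat g})$ is a SODE extension of $\Gamma_{(L,\mathcal{D})}$. (iii) The vector field $\Gamma^2_{\hat g}=\Gamma_{\hat g}-(\hat\nabla(\hat Q(\mathbf{T})))^V$ is a SODE extension of $\Gamma_{(L,\mathcal{D})}$. (iv) The nonholonomic vector field $\Gamma_{(L,\mathcal{D})}$ satisfies on $\mathcal{C}$ $$\Gamma_{(L,\mathcal{D})}(X^V(\hat L))-X^C(\hat L)=0,\qquad\forall X\in\mathrm{Sec}(\mathcal{D}).$$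
   Context: All objects are smooth and repeated indices are summed. $Q$ is an $n$-dimensional manifold, $\tau:TQ\to Q$ its tangent bundle, $\mathcal{D}$ has rank $m$, and $\mathcal{D}^g$ is the $g$-orthogonal complement of $\mathcal{D}$. A globally defined frame $\{X_\alpha\}=\{X_a,X_i\}$ on $Q$ is fixed, with $\{X_a\}$ ($a,b,c\in\{1,\dots,m\}$) spanning $\mathcal{D}$ and $\{X_i\}$ ($i,k\in\{1,\dots,n-m\}$) spanning $\mathcal{D}^g$; $[X_\alpha,X_\beta]=R^\gamma_{\alpha\beta}X_\gamma$; $\hat g_{\alpha\beta}=\hat g(X_\alpha,X_\beta)$, $g_{\alpha\beta}=g(X_\alpha,X_\beta)$, $(g^{ab})=(g_{ab})^{-1}$. Quasi-velocities $v^\alpha=(v^a,v^i)$ are the functions on $TQ$ with $v_q=v^\alpha X_\alpha(q)$; $\mathcal{C}=\{v^i=0\}$ is $\mathcal{D}$ viewed as a submanifold of $TQ$. $X^C$, $X^V$ are the complete and vertical lifts to $TQ$ of a vector field $X$ on $Q$. $\mathcal{X}(\tau)$ is the set of vector fields along $\tau$ (sections of $\tau^*TQ\to TQ$); $X=\xi^\alpha X_\alpha\in\mathcal{X}(\tau)$, $\xi^\alpha\in C^\infty(TQ)$, has vertical lift $X^V=\xi^\alpha X_\alpha^V$. $\mathbf{T}=v^\alpha X_\alpha$ is the canonical vector field along $\tau$. $\hat g$ is a $\mathcal{D}$-preserving modification of $g$ if $\hat g|_{\mathcal{D}\times\mathcal{D}}=g|_{\mathcal{D}\times\mathcal{D}}$.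 A SODE is a vector field on $TQ$ of the form $\Gamma=v^\alpha X_\alpha^C+F^\alpha X_\alpha^V$. The nonholonomic vector field $\Gamma_{(L,\mathcal{D})}$ is the unique vector field on $\mathcal{C}$ of the form $v^aX_a^C+f^aX_a^V$ satisfying $\Gamma_{(L,\mathcal{D})}(X^V(L))-X^C(L)=0$ on $\mathcal{C}$ for all $X\in\mathrm{Sec}(\mathcal{D})$. A SODE $\Gamma$ is a SODE extension of $\Gamma_{(L,\mathcal{D})}$ if $\Gamma|_{\mathcal{C}}=\Gamma_{(L,\mathcal{D})}$ (equivalently, all base integral curves of $\Gamma_{(L,\mathcal{D})}$ are base integral curves of $\Gamma$). $\Gamma_{\hat g}=\Gamma_{\hat L}$ is the geodesic spray of $\hat g$. The $\hat g$-orthogonal complement $\mathcal{D}^{\hat g}$ of $\mathcal{D}$ is spanned by $\hat X_i=X_i-g^{ab}\hat g_{bi}X_a$. $\mathcal{X}^{\hat g}(\tau,\mathcal{D})$ is the $C^\infty(TQ)$-span of $\{\hat X_i\}$ in $\mathcal{X}(\tau)$, $(\mathcal{X}^{\hat g}(\tau,\mathcal{D}))^V$ the $C^\infty(TQ)$-span of $\{\hat X_i^V\}$, and $\mathcal{X}^T(TQ)=\{Z\in\mathcal{X}(TQ)\mid Z(v^i)=0\text{ for all }i\}$. One has $\mathcal{X}(TQ)=\mathcal{X}^T(TQ)\oplus(\mathcal{X}^{\hat g}(\tau,\mathcal{D}))^V$, and $\hat p$ is the corresponding projection onto $\mathcal{X}^T(TQ)$. $\hat Q:\mathcal{X}(\tau)\to\mathcal{X}^{\hat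 g}(\tau,\mathcal{D})$ is the $\hat g$-orthogonal projection (so $\hat Q(\mathbf{T})=v^i\hat X_i$). $\hat\nabla:\mathcal{X}(\tau)\to\mathcal{X}(\tau)$ is the dynamical covariant derivative of $\Gamma_{\hat g}=v^\alpha X_\alpha^C+\hat F^\alpha X_\alpha^V$: the additive operator with $\hat\nabla(fX)=f\hat\nabla X+\Gamma_{\hat g}(f)X$ for $f\in C^\infty(TQ)$ and $\hat\nabla X_\alpha=-\frac12\big(X_\alpha^V(\hat F^\beta)+v^\gamma R^\beta_{\alpha\gamma}\big)X_\beta$. *)

theory Defs
  imports "HOL-Analysis.Analysis"
begin

text \<open>\<open>Ck_on k U f\<close> and \<open>smooth_on U f\<close> are meant for open \<open>U\<close>.\<close>

primrec Ck_on :: "nat \<Rightarrow> 'a::euclidean_space set \<Rightarrow> ('a \<Rightarrow> 'b::real_normed_vector) \<Rightarrow> bool" where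
  "Ck_on 0 U f \<longleftrightarrow> continuous_on U f"
| "Ck_on (Suc k) U f \<longleftrightarrow>
     f differentiable_on U \<and> (\<forall>b\<in>Basis. Ck_on k U (\<lambda>x. frechet_derivative f (at x) b))"

definition smooth_on :: "'a::euclidean_space set \<Rightarrow> ('a \<Rightarrow> 'b::real_normed_vector) \<Rightarrow> bool" where
  "smooth_on U f \<longleftrightarrow> (\<forall>k. Ck_on k U f)"

type_synonym ('p, 'e) atlas = "('p set \<times> ('p \<Rightarrow> 'e)) set"

definition carrier_of :: "('p, 'e) atlas \<Rightarrow> 'p set" where
  "carrier_of \<A> = (\<Union>(U, \<phi>)\<in>\<A>. U)"

text \<open>The base manifold is a whole Hausdorff, second countable type, of dimension \<open>CARD('n)\<close>.\<close>

definition smooth_manifold ::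
  "('q::{t2_space, second_countable_topology}, real ^ 'n) atlas \<Rightarrow> bool" where
  "smooth_manifold \<A> \<longleftrightarrow>
     carrier_of \<A> = UNIV \<and>
     (\<forall>(U, \<phi>)\<in>\<A>. open U \<and> open (\<phi> ` U) \<and> homeomorphism U (\<phi> ` U) \<phi> (inv_into U \<phi>)) \<and>
     (\<forall>(U, \<phi>)\<in>\<A>. \<forall>(V, \<psi>)\<in>\<A>. smooth_on (\<phi> ` (U \<inter> V)) (\<psi> \<circ> inv_into U \<phi>))"

text \<open>Real functions on a manifold are total functions; only their values on the carrier
  of the atlas matter.\<close>

definition smooth_near :: "('p, 'e::euclidean_space) atlas \<Rightarrow> 'p \<Rightarrow> ('p \<Rightarrow> real) \<Rightarrow> bool" where
  "smooth_near \<A> p f \<longleftrightarrow>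
     (\<exists>(U, \<phi>)\<in>\<A>. p \<in> U \<and>
        (\<exists>V. open V \<and> \<phi> p \<in> V \<and> V \<subseteq> \<phi> ` U \<and> smooth_on V (f \<circ> inv_into U \<phi>)))"

definition smooth_fun :: "('p, 'e::euclidean_space) atlas \<Rightarrow> ('p \<Rightarrow> real) \<Rightarrow> bool" where
  "smooth_fun \<A> f \<longleftrightarrow> (\<forall>p\<in>carrier_of \<A>. smooth_near \<A> p f)"

text \<open>Smooth functions on an embedded submanifold \<open>C\<close>: locally restrictions of smooth functions
  of the ambient manifold.\<close>

definition smooth_fun_on :: "('p, 'e::euclidean_space) atlas \<Rightarrow> 'p set \<Rightarrow> ('p \<Rightarrow> real) \<Rightarrow> bool" where
  "smooth_fun_on \<A> C f \<longleftrightarrow>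
     (\<forall>u\<in>C. \<exists>F. smooth_near \<A> u F \<and>
        (\<exists>(U, \<phi>)\<in>\<A>. u \<in> U \<and>
           (\<exists>V. open V \<and> \<phi> u \<in> V \<and> (\<forall>w\<in>C \<inter> U. \<phi> w \<in> V \<longrightarrow> f w = F w))))"

text \<open>A tangent vector at \<open>p\<close> is a directional derivative, acting on the functions that are
  smooth near \<open>p\<close>; it is extended by 0 to all other functions, so that equality of tangent
  vectors is equality of functionals. The vector space operations are pointwise.\<close>

type_synonym 'p tvec = "('p \<Rightarrow> real) \<Rightarrow> real"

definition tangent_space :: "('p, 'e::euclidean_space) atlas \<Rightarrow> 'p \<Rightarrow> 'p tvec set" where
  "tangent_space \<A> p =
     {v. \<exists>(U, \<phi>)\<in>\<A>. p \<in> U \<and>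
        (\<exists>w. v = (\<lambda>f. if smooth_near \<A> p f
                       then frechet_derivative (f \<circ> inv_into U \<phi>) (at (\<phi> p)) w else 0))}"

text \<open>Vector fields vanish off the carrier, so that they are determined by their values on the
  manifold.\<close>

definition vector_field :: "('p, 'e::euclidean_space) atlas \<Rightarrow> ('p \<Rightarrow> 'p tvec) \<Rightarrow> bool" where
  "vector_field \<A> Z \<longleftrightarrow>
     (\<forall>p\<in>carrier_of \<A>. Z p \<in> tangent_space \<A> p \<and>
        (\<forall>f. smooth_near \<A> p f \<longrightarrow> smooth_near \<A> p (\<lambda>q. Z q f))) \<and>
     (\<forall>p. p \<notin> carrier_of \<A> \<longrightarrow> Z p = (\<lambda>f. 0))"

definition lie_bracket ::
  "('p, 'e::euclidean_space) atlas \<Rightarrow> ('p \<Rightarrow> 'p tvec) \<Rightarrow> ('p \<Rightarrow> 'p tvec) \<Rightarrow> 'p \<Rightarrow> 'p tvec" where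
  "lie_bracket \<A> Y Z p =
     (\<lambda>f. if smooth_near \<A> p f then Y p (\<lambda>q. Z q f) - Z p (\<lambda>q. Y q f) else 0)"

definition riemannian_metric ::
  "('p, 'e::euclidean_space) atlas \<Rightarrow> ('p \<Rightarrow> 'p tvec \<Rightarrow> 'p tvec \<Rightarrow> real) \<Rightarrow> bool" where
  "riemannian_metric \<A> g \<longleftrightarrow>
     (\<forall>p\<in>carrier_of \<A>.
        (\<forall>u\<in>tangent_space \<A> p. \<forall>v\<in>tangent_space \<A> p. g p u v = g p v u) \<and>
        (\<forall>u\<in>tangent_space \<A> p. \<forall>v\<in>tangent_space \<A> p. \<forall>w\<in>tangent_space \<A> p. \<forall>c d.
           g p (\<lambda>f. c * u f + d * v f) w = c * g p u w + d * g p v w) \<and>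
        (\<forall>u\<in>tangent_space \<A> p. u \<noteq> (\<lambda>f. 0) \<longrightarrow> g p u u > 0)) \<and>
     (\<forall>Y Z. vector_field \<A> Y \<longrightarrow> vector_field \<A> Z \<longrightarrow> smooth_fun \<A> (\<lambda>p. g p (Y p) (Z p)))"

definition orth_compl ::
  "('p, 'e::euclidean_space) atlas \<Rightarrow> ('p \<Rightarrow> 'p tvec \<Rightarrow> 'p tvec \<Rightarrow> real) \<Rightarrow> ('p \<Rightarrow> 'p tvec set)
    \<Rightarrow> 'p \<Rightarrow> 'p tvec set" where
  "orth_compl \<A> g D p = {v \<in> tangent_space \<A> p. \<forall>w\<in>D p. g p v w = 0}"

definition metric_modification ::
  "('p \<Rightarrow> 'p tvec set) \<Rightarrow> ('p \<Rightarrow> 'p tvec \<Rightarrow> 'p tvec \<Rightarrow> real)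
    \<Rightarrow> ('p \<Rightarrow> 'p tvec \<Rightarrow> 'p tvec \<Rightarrow> real) \<Rightarrow> bool" where
  "metric_modification D g gh \<longleftrightarrow> (\<forall>p. \<forall>u\<in>D p. \<forall>v\<in>D p. gh p u v = g p u v)"

text \<open>The frame is indexed by the type \<open>'n\<close>; the set \<open>S\<close> consists of the indices \<open>a, b, c\<close> of the
  fields spanning the distribution, its complement \<open>- S\<close> of the remaining indices \<open>i, k\<close>.
  The rank of the distribution is \<open>card S\<close>; its smoothness follows from that of the frame.\<close>

definition adapted_frame ::
  "('q, real ^ 'n) atlas \<Rightarrow> ('q \<Rightarrow> 'q tvec \<Rightarrow> 'q tvec \<Rightarrow> real) \<Rightarrow> ('q \<Rightarrow> 'q tvec set)
    \<Rightarrow> ('n::finite \<Rightarrow> 'q \<Rightarrow> 'q tvec) \<Rightarrow> 'n set \<Rightarrow> bool" where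
  "adapted_frame \<A> g D X S \<longleftrightarrow>
     (\<forall>\<alpha>. vector_field \<A> (X \<alpha>)) \<and>
     (\<forall>q\<in>carrier_of \<A>.
        (\<forall>v\<in>tangent_space \<A> q. \<exists>!c. v = (\<lambda>f. \<Sum>\<alpha>\<in>UNIV. c \<alpha> * X \<alpha> q f)) \<and>
        D q = {v. \<exists>c. v = (\<lambda>f. \<Sum>a\<in>S. c a * X a q f)} \<and>
        orth_compl \<A> g D q = {v. \<exists>c. v = (\<lambda>f. \<Sum>i\<in>-S. c i * X i q f)})"

definition frame_coeff :: "('n::finite \<Rightarrow> 'q \<Rightarrow> 'q tvec) \<Rightarrow> 'q \<Rightarrow> 'q tvec \<Rightarrow> 'n \<Rightarrow> real" where
  "frame_coeff X q v = (THE c. v = (\<lambda>f. \<Sum>\<alpha>\<in>UNIV. c \<alpha> * X \<alpha> q f))"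

text \<open>\<open>struct_fun \<A> X \<gamma> \<alpha> \<beta> q\<close> is \<open>R\<^sup>\<gamma>\<^bsub>\<alpha>\<beta>\<^esub>(q)\<close>, where \<open>[X\<^bsub>\<alpha>\<^esub>, X\<^bsub>\<beta>\<^esub>] = R\<^sup>\<gamma>\<^bsub>\<alpha>\<beta>\<^esub> X\<^bsub>\<gamma>\<^esub>\<close>.\<close>

definition struct_fun ::
  "('q, real ^ 'n) atlas \<Rightarrow> ('n::finite \<Rightarrow> 'q \<Rightarrow> 'q tvec) \<Rightarrow> 'n \<Rightarrow> 'n \<Rightarrow> 'n \<Rightarrow> 'q \<Rightarrow> real" where
  "struct_fun \<A> X \<gamma> \<alpha> \<beta> q = frame_coeff X q (lie_bracket \<A> (X \<alpha>) (X \<beta>) q) \<gamma>"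

text \<open>The inverse \<open>(g\<^sup>a\<^sup>b)\<close> of the matrix \<open>(g\<^bsub>ab\<^esub>)\<close>, \<open>a, b \<in> S\<close>, padded by 0.\<close>

definition gram_inv ::
  "('q \<Rightarrow> 'q tvec \<Rightarrow> 'q tvec \<Rightarrow> real) \<Rightarrow> ('n::finite \<Rightarrow> 'q \<Rightarrow> 'q tvec) \<Rightarrow> 'n set \<Rightarrow> 'q
    \<Rightarrow> 'n \<Rightarrow> 'n \<Rightarrow> real" where
  "gram_inv g X S q =
     (THE h. (\<forall>a b. a \<notin> S \<or> b \<notin> S \<longrightarrow> h a b = 0) \<and>
        (\<forall>a\<in>S. \<forall>c\<in>S. (\<Sum>b\<in>S. h a b * g q (X b q) (X c q)) = (if a = c then 1 else 0)))"

definition Xhat ::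
  "('q \<Rightarrow> 'q tvec \<Rightarrow> 'q tvec \<Rightarrow> real) \<Rightarrow> ('q \<Rightarrow> 'q tvec \<Rightarrow> 'q tvec \<Rightarrow> real)
    \<Rightarrow> ('n::finite \<Rightarrow> 'q \<Rightarrow> 'q tvec) \<Rightarrow> 'n set \<Rightarrow> 'n \<Rightarrow> 'q \<Rightarrow> 'q tvec" where
  "Xhat g gh X S i q =
     (\<lambda>f. X i q f - (\<Sum>a\<in>S. \<Sum>b\<in>S. gram_inv g X S q a b * gh q (X b q) (X i q) * X a q f))"

type_synonym 'q tbundle = "'q \<times> 'q tvec"

text \<open>A chart \<open>\<phi>\<close> of the base induces the chart \<open>(q, v) \<mapsto> (\<phi> q, (v \<phi>\<^bsub>j\<^esub>)\<^bsub>j\<^esub>)\<close>; the second component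
  is the coordinate vector of \<open>v\<close>.\<close>

definition TQ :: "('q, real ^ 'n) atlas \<Rightarrow> ('q tbundle, (real ^ 'n) \<times> (real ^ 'n::finite)) atlas" where
  "TQ \<A> = (\<lambda>(U, \<phi>). ({(q, v). q \<in> U \<and> v \<in> tangent_space \<A> q},
                        \<lambda>(q, v). (\<phi> q, \<chi> j. v (\<lambda>p. \<phi> p $ j)))) ` \<A>"

definition vlift :: "('q, real ^ 'n::finite) atlas \<Rightarrow> ('q \<Rightarrow> 'q tvec) \<Rightarrow> 'q tbundle \<Rightarrow> 'q tbundle tvec" where
  "vlift \<A> Y u =
     (\<lambda>F. if u \<in> carrier_of (TQ \<A>) \<and> smooth_near (TQ \<A>) u F
          then deriv (\<lambda>t. F (fst u, \<lambda>f. snd u f + t * Y (fst u) f)) 0 else 0)"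

text \<open>The complete lift is the vector field on the tangent bundle determined by
  \<open>Y\<^sup>C(f \<circ> \<tau>) = Y(f) \<circ> \<tau>\<close> and \<open>Y\<^sup>C(f') = (Y(f))'\<close>, where \<open>f'\<close> denotes the fibrewise linear function
  \<open>(q, v) \<mapsto> v(f)\<close>; in coordinates it is
  \<open>Y\<^sup>j \<partial>/\<partial>x\<^sup>j + v\<^sup>k (\<partial>Y\<^sup>j/\<partial>x\<^sup>k) \<partial>/\<partial>v\<^sup>j\<close>.\<close>

definition clift :: "('q, real ^ 'n::finite) atlas \<Rightarrow> ('q \<Rightarrow> 'q tvec) \<Rightarrow> 'q tbundle \<Rightarrow> 'q tbundle tvec" where
  "clift \<A> Y u =
     (if u \<in> carrier_of (TQ \<A>) then
        THE Z. Z \<in> tangent_space (TQ \<A>) u \<and>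
          (\<forall>f. smooth_near \<A> (fst u) f \<longrightarrow>
             Z (\<lambda>w. f (fst w)) = Y (fst u) f \<and>
             Z (\<lambda>w. snd w f) = snd u (\<lambda>q. Y q f))
      else (\<lambda>F. 0))"

definition qvel :: "('n::finite \<Rightarrow> 'q \<Rightarrow> 'q tvec) \<Rightarrow> 'n \<Rightarrow> 'q tbundle \<Rightarrow> real" where
  "qvel X \<alpha> u = frame_coeff X (fst u) (snd u) \<alpha>"

definition constraint_set ::
  "('q, real ^ 'n::finite) atlas \<Rightarrow> ('n \<Rightarrow> 'q \<Rightarrow> 'q tvec) \<Rightarrow> 'n set \<Rightarrow> 'q tbundle set" where
  "constraint_set \<A> X S = {u \<in> carrier_of (TQ \<A>). \<forall>i\<in>-S. qvel X i u = 0}"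

text \<open>Vertical lift \<open>\<xi>\<^sup>\<alpha> X\<^bsub>\<alpha>\<^esub>\<^sup>V\<close> of a vector field \<open>Y = \<xi>\<^sup>\<alpha> X\<^bsub>\<alpha>\<^esub>\<close> along the projection.\<close>

definition vlift_along ::
  "('q, real ^ 'n::finite) atlas \<Rightarrow> ('n \<Rightarrow> 'q \<Rightarrow> 'q tvec) \<Rightarrow> ('q tbundle \<Rightarrow> 'q tvec)
    \<Rightarrow> 'q tbundle \<Rightarrow> 'q tbundle tvec" where
  "vlift_along \<A> X Y u = (\<lambda>F. \<Sum>\<alpha>\<in>UNIV. frame_coeff X (fst u) (Y u) \<alpha> * vlift \<A> (X \<alpha>) u F)"

definition canonical_along ::
  "('n::finite \<Rightarrow> 'q \<Rightarrow> 'q tvec) \<Rightarrow> 'q tbundle \<Rightarrow> 'q tvec" where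
  "canonical_along X u = (\<lambda>f. \<Sum>\<alpha>\<in>UNIV. qvel X \<alpha> u * X \<alpha> (fst u) f)"

definition kinetic :: "('q \<Rightarrow> 'q tvec \<Rightarrow> 'q tvec \<Rightarrow> real) \<Rightarrow> 'q tbundle \<Rightarrow> real" where
  "kinetic g u = (1 / 2) * g (fst u) (snd u) (snd u)"

definition sode ::
  "('q, real ^ 'n::finite) atlas \<Rightarrow> ('n \<Rightarrow> 'q \<Rightarrow> 'q tvec) \<Rightarrow> ('q tbundle \<Rightarrow> 'q tbundle tvec) \<Rightarrow> bool" where
  "sode \<A> X \<Gamma> \<longleftrightarrow>
     vector_field (TQ \<A>) \<Gamma> \<and>
     (\<exists>F. (\<forall>\<alpha>. smooth_fun (TQ \<A>) (F \<alpha>)) \<and>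
        \<Gamma> = (\<lambda>u h. \<Sum>\<alpha>\<in>UNIV. qvel X \<alpha> u * clift \<A> (X \<alpha>) u h + F \<alpha> u * vlift \<A> (X \<alpha>) u h))"

text \<open>The Lagrangian vector field: the second order field given by the Euler-Lagrange equations,
  written as \<open>\<Gamma>(Y\<^sup>V(L)) - Y\<^sup>C(L) = 0\<close> for all vector fields \<open>Y\<close> on the base.\<close>

definition lagrangian_field ::
  "('q, real ^ 'n::finite) atlas \<Rightarrow> ('n \<Rightarrow> 'q \<Rightarrow> 'q tvec) \<Rightarrow> ('q tbundle \<Rightarrow> real)
    \<Rightarrow> 'q tbundle \<Rightarrow> 'q tbundle tvec" where
  "lagrangian_field \<A> X L =
     (THE \<Gamma>. sode \<A> X \<Gamma> \<and>
        (\<forall>Y. vector_field \<A> Y \<longrightarrow>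
           (\<forall>u\<in>carrier_of (TQ \<A>). \<Gamma> u (\<lambda>w. vlift \<A> Y w L) - clift \<A> Y u L = 0)))"

text \<open>The Lagrangian vector field of the kinetic energy of a metric is its geodesic spray.\<close>

abbreviation geodesic_spray ::
  "('q, real ^ 'n::finite) atlas \<Rightarrow> ('n \<Rightarrow> 'q \<Rightarrow> 'q tvec) \<Rightarrow> ('q \<Rightarrow> 'q tvec \<Rightarrow> 'q tvec \<Rightarrow> real)
    \<Rightarrow> 'q tbundle \<Rightarrow> 'q tbundle tvec" where
  "geodesic_spray \<A> X gh \<equiv> lagrangian_field \<A> X (kinetic gh)"

definition sections_of ::
  "('q, real ^ 'n::finite) atlas \<Rightarrow> ('q \<Rightarrow> 'q tvec set) \<Rightarrow> ('q \<Rightarrow> 'q tvec) set" where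
  "sections_of \<A> D = {Y. vector_field \<A> Y \<and> (\<forall>q\<in>carrier_of \<A>. Y q \<in> D q)}"

text \<open>Vector fields on the submanifold \<open>C = {v\<^sup>i = 0}\<close> are sections over \<open>C\<close> annihilating the
  functions \<open>v\<^sup>i\<close>; they are extended by 0 outside \<open>C\<close>.\<close>

definition nonholonomic_form ::
  "('q, real ^ 'n::finite) atlas \<Rightarrow> ('n \<Rightarrow> 'q \<Rightarrow> 'q tvec) \<Rightarrow> 'n set
    \<Rightarrow> ('q tbundle \<Rightarrow> 'q tbundle tvec) \<Rightarrow> bool" where
  "nonholonomic_form \<A> X S \<Gamma> \<longleftrightarrow>
     (\<forall>u\<in>constraint_set \<A> X S.
        \<Gamma> u \<in> tangent_space (TQ \<A>) u \<and> (\<forall>i\<in>-S. \<Gamma> u (qvel X i) = 0)) \<and>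
     (\<exists>f. (\<forall>a\<in>S. smooth_fun_on (TQ \<A>) (constraint_set \<A> X S) (f a)) \<and>
        \<Gamma> = (\<lambda>u h. if u \<in> constraint_set \<A> X S
               then \<Sum>a\<in>S. qvel X a u * clift \<A> (X a) u h + f a u * vlift \<A> (X a) u h
               else 0))"

definition nonholonomic_field ::
  "('q, real ^ 'n::finite) atlas \<Rightarrow> ('n \<Rightarrow> 'q \<Rightarrow> 'q tvec) \<Rightarrow> 'n set \<Rightarrow> ('q \<Rightarrow> 'q tvec set)
    \<Rightarrow> ('q tbundle \<Rightarrow> real) \<Rightarrow> 'q tbundle \<Rightarrow> 'q tbundle tvec" where
  "nonholonomic_field \<A> X S D L =
     (THE \<Gamma>. nonholonomic_form \<A> X S \<Gamma> \<and>
        (\<forall>Y\<in>sections_of \<A> D. \<forall>u\<in>constraint_set \<A> X S.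
           \<Gamma> u (\<lambda>w. vlift \<A> Y w L) - clift \<A> Y u L = 0))"

definition sode_extension ::
  "('q, real ^ 'n::finite) atlas \<Rightarrow> ('n \<Rightarrow> 'q \<Rightarrow> 'q tvec) \<Rightarrow> 'n set
    \<Rightarrow> ('q tbundle \<Rightarrow> 'q tbundle tvec) \<Rightarrow> ('q tbundle \<Rightarrow> 'q tbundle tvec) \<Rightarrow> bool" where
  "sode_extension \<A> X S \<Gamma>nh \<Gamma> \<longleftrightarrow> sode \<A> X \<Gamma> \<and> (\<forall>u\<in>constraint_set \<A> X S. \<Gamma> u = \<Gamma>nh u)"

definition condition_A ::
  "('q, real ^ 'n::finite) atlas \<Rightarrow> ('n \<Rightarrow> 'q \<Rightarrow> 'q tvec) \<Rightarrow> 'n set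
    \<Rightarrow> ('q \<Rightarrow> 'q tvec \<Rightarrow> 'q tvec \<Rightarrow> real) \<Rightarrow> bool" where
  "condition_A \<A> X S gh \<longleftrightarrow>
     (\<forall>q\<in>carrier_of \<A>. \<forall>c\<in>S. \<forall>v :: 'n \<Rightarrow> real.
        (\<Sum>a\<in>S. \<Sum>b\<in>S. \<Sum>k\<in>-S. gh q (X b q) (X k q) * struct_fun \<A> X k a c q * v a * v b) = 0)"

definition XT ::
  "('q, real ^ 'n::finite) atlas \<Rightarrow> ('n \<Rightarrow> 'q \<Rightarrow> 'q tvec) \<Rightarrow> 'n set
    \<Rightarrow> ('q tbundle \<Rightarrow> 'q tbundle tvec) set" where
  "XT \<A> X S =
     {Z. vector_field (TQ \<A>) Z \<and> (\<forall>i\<in>-S. \<forall>u\<in>carrier_of (TQ \<A>). Z u (qvel X i) = 0)}"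

definition XhatV ::
  "('q, real ^ 'n::finite) atlas \<Rightarrow> ('q \<Rightarrow> 'q tvec \<Rightarrow> 'q tvec \<Rightarrow> real)
    \<Rightarrow> ('q \<Rightarrow> 'q tvec \<Rightarrow> 'q tvec \<Rightarrow> real) \<Rightarrow> ('n \<Rightarrow> 'q \<Rightarrow> 'q tvec) \<Rightarrow> 'n set
    \<Rightarrow> ('q tbundle \<Rightarrow> 'q tbundle tvec) set" where
  "XhatV \<A> g gh X S =
     {Z. \<exists>\<xi>. (\<forall>i\<in>-S. smooth_fun (TQ \<A>) (\<xi> i)) \<and>
           Z = (\<lambda>u h. \<Sum>i\<in>-S. \<xi> i u * vlift \<A> (Xhat g gh X S i) u h)}"

text \<open>The projection onto the first summand of the decomposition of the vector fields on the
  tangent bundle as the direct sum of \<open>XT\<close> and \<open>XhatV\<close>.\<close>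

definition phat ::
  "('q, real ^ 'n::finite) atlas \<Rightarrow> ('q \<Rightarrow> 'q tvec \<Rightarrow> 'q tvec \<Rightarrow> real)
    \<Rightarrow> ('q \<Rightarrow> 'q tvec \<Rightarrow> 'q tvec \<Rightarrow> real) \<Rightarrow> ('n \<Rightarrow> 'q \<Rightarrow> 'q tvec) \<Rightarrow> 'n set
    \<Rightarrow> ('q tbundle \<Rightarrow> 'q tbundle tvec) \<Rightarrow> 'q tbundle \<Rightarrow> 'q tbundle tvec" where
  "phat \<A> g gh X S Z =
     (THE W. W \<in> XT \<A> X S \<and> (\<exists>V\<in>XhatV \<A> g gh X S. Z = (\<lambda>u h. W u h + V u h)))"

definition Qhat ::
  "('q, real ^ 'n::finite) atlas \<Rightarrow> ('q \<Rightarrow> 'q tvec \<Rightarrow> 'q tvec \<Rightarrow> real) \<Rightarrow> ('q \<Rightarrow> 'q tvec set)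
    \<Rightarrow> ('q tbundle \<Rightarrow> 'q tvec) \<Rightarrow> 'q tbundle \<Rightarrow> 'q tvec" where
  "Qhat \<A> gh D Y u =
     (THE w. w \<in> orth_compl \<A> gh D (fst u) \<and>
        (\<forall>z\<in>orth_compl \<A> gh D (fst u). gh (fst u) (\<lambda>f. Y u f - w f) z = 0))"

text \<open>The coefficients \<open>F\<^sup>\<alpha>\<close> of a second order field \<open>v\<^sup>\<alpha> X\<^bsub>\<alpha>\<^esub>\<^sup>C + F\<^sup>\<alpha> X\<^bsub>\<alpha>\<^esub>\<^sup>V\<close>.\<close>

definition sode_coeff ::
  "('q, real ^ 'n::finite) atlas \<Rightarrow> ('n \<Rightarrow> 'q \<Rightarrow> 'q tvec) \<Rightarrow> ('q tbundle \<Rightarrow> 'q tbundle tvec)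
    \<Rightarrow> 'n \<Rightarrow> 'q tbundle \<Rightarrow> real" where
  "sode_coeff \<A> X \<Gamma> \<alpha> u =
     (THE c. \<Gamma> u = (\<lambda>h. \<Sum>\<beta>\<in>UNIV. qvel X \<beta> u * clift \<A> (X \<beta>) u h
                                   + c \<beta> * vlift \<A> (X \<beta>) u h)) \<alpha>"

text \<open>\<open>dyn_cov_frame \<A> X \<Gamma> \<alpha> \<beta> u\<close> is the coefficient at \<open>X\<^bsub>\<beta>\<^esub>\<close> of
  \<open>\<nabla>X\<^bsub>\<alpha>\<^esub> = - 1/2 (X\<^bsub>\<alpha>\<^esub>\<^sup>V(F\<^sup>\<beta>) + v\<^sup>\<gamma> R\<^sup>\<beta>\<^bsub>\<alpha>\<gamma>\<^esub>) X\<^bsub>\<beta>\<^esub>\<close>.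
  By additivity and the Leibniz rule, \<open>\<nabla>(\<xi>\<^sup>\<alpha> X\<^bsub>\<alpha>\<^esub>) = \<Gamma>(\<xi>\<^sup>\<alpha>) X\<^bsub>\<alpha>\<^esub> + \<xi>\<^sup>\<alpha> \<nabla>X\<^bsub>\<alpha>\<^esub>\<close>.\<close>

definition dyn_cov_frame ::
  "('q, real ^ 'n::finite) atlas \<Rightarrow> ('n \<Rightarrow> 'q \<Rightarrow> 'q tvec) \<Rightarrow> ('q tbundle \<Rightarrow> 'q tbundle tvec)
    \<Rightarrow> 'n \<Rightarrow> 'n \<Rightarrow> 'q tbundle \<Rightarrow> real" where
  "dyn_cov_frame \<A> X \<Gamma> \<alpha> \<beta> u =
     - (1 / 2) * (vlift \<A> (X \<alpha>) u (sode_coeff \<A> X \<Gamma> \<beta>)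
                  + (\<Sum>\<gamma>\<in>UNIV. qvel X \<gamma> u * struct_fun \<A> X \<beta> \<alpha> \<gamma> (fst u)))"

definition dyn_cov ::
  "('q, real ^ 'n::finite) atlas \<Rightarrow> ('n \<Rightarrow> 'q \<Rightarrow> 'q tvec) \<Rightarrow> ('q tbundle \<Rightarrow> 'q tbundle tvec)
    \<Rightarrow> ('q tbundle \<Rightarrow> 'q tvec) \<Rightarrow> 'q tbundle \<Rightarrow> 'q tvec" where
  "dyn_cov \<A> X \<Gamma> Y u =
     (\<lambda>f. \<Sum>\<alpha>\<in>UNIV. \<Gamma> u (\<lambda>w. frame_coeff X (fst w) (Y w) \<alpha>) * X \<alpha> (fst u) f
            + frame_coeff X (fst u) (Y u) \<alpha> * (\<Sum>\<beta>\<in>UNIV. dyn_cov_frame \<A> X \<Gamma> \<alpha> \<beta> u * X \<beta> (fst u) f))"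

end

theory Submission
  imports Defs
begin

text \<open>
  A second order field is determined by the numbers \<open>F\<^sup>\<beta> = \<Gamma>(v\<^sup>\<beta>)\<close>, because \<open>v\<^sup>\<alpha> X\<^bsub>\<alpha>\<^esub>\<^sup>C\<close> annihilates
  the quasi-velocities (\<open>second_order_field_qvel\<close>). For the kinetic energy of a metric \<open>g\<close> the
  Euler-Lagrange expression in the direction \<open>X\<^bsub>\<alpha>\<^esub>\<close> is \<open>g\<^bsub>\<alpha>\<beta>\<^esub> F\<^sup>\<beta> - M\<^bsub>\<alpha>\<^esub>(g)\<close> with a force \<open>M\<close> that depends
  only on the metric and the velocity (\<open>euler_lagrange_frame\<close>). So the geodesic spray of \<open>gh\<close>
  solves the linear system \<open>gh\<^bsub>\<alpha>\<beta>\<^esub> F\<^sup>\<beta> = M\<^bsub>\<alpha>\<^esub>(gh)\<close>, and the nonholonomic field has the coefficients \<open>f\<^sup>a\<close> with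
  \<open>g\<^bsub>ca\<^esub> f\<^sup>a = M\<^bsub>c\<^esub>(g)\<close> for the indices \<open>c\<close> of the distribution (\<open>nonholonomic_field_eq\<close>).

  All statements of the theorem compare the forces \<open>M\<^bsub>c\<^esub>(gh)\<close> and \<open>M\<^bsub>c\<^esub>(g)\<close> on the constraint manifold. There
  the two metrics enter through the same functions \<open>g\<^bsub>ab\<^esub> = gh\<^bsub>ab\<^esub>\<close>, except for the mixed components: these vanish
  for \<open>g\<close>, and for \<open>gh\<close> they contribute \<open>gh\<^bsub>bk\<^esub> R\<^sup>k\<^bsub>ac\<^esub> v\<^sup>a v\<^sup>b\<close> (\<open>spray_force_difference\<close>). Hence the condition
  on the structure functions says that the forces agree (\<open>condition_A_iff\<close>). The Euler-Lagrange
  expression of \<open>gh\<close> along the nonholonomic field is \<open>M\<^bsub>c\<^esub>(g) - M\<^bsub>c\<^esub>(gh)\<close>, which gives the last equivalence.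

  The fields \<open>Xhat\<^sub>i\<close> are \<open>gh\<close>-orthogonal to the distribution, so subtracting a combination of the
  \<open>Xhat\<^sub>i\<^sup>V\<close> from the spray does not change the equations in the directions of the distribution. The projected
  spray arises in this way with the combination \<open>F\<^sup>i Xhat\<^sub>i\<^sup>V\<close>; its coefficients in the directions \<open>X\<^bsub>i\<^esub>\<close> vanish
  and the others satisfy \<open>g\<^bsub>ca\<^esub> F\<^sup>a = M\<^bsub>c\<^esub>(gh)\<close> (\<open>tangential_coeff_equation\<close>). It therefore extends the nonholonomic
  field if and only if the forces agree. The spray corrected by the dynamical covariant derivative of \<open>v\<^sup>i Xhat\<^sub>i\<close>
  coincides with it on the constraint manifold: where \<open>v\<^sup>i = 0\<close>, the Leibniz rule leaves only
  \<open>\<Gamma>(v\<^sup>i) Xhat\<^sub>i = F\<^sup>i Xhat\<^sub>i\<close>.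

  Two facts make these computations legitimate. Complete lifts exist because second partial derivatives commute
  (\<open>clift_exists\<close>), and everything defined by solving a linear system is smooth by Cramer's rule
  (\<open>smooth_near_linear_system\<close>).
\<close>

section \<open>Calculus of smooth maps on open sets\<close>

lemma Ck_on_SucD:
  assumes "Ck_on (Suc k) U f" "open U" "x \<in> U"
  shows "(f has_derivative frechet_derivative f (at x)) (at x)"
proof -
  have "f differentiable_on U"
    using assms(1) by simp
  then have "f differentiable (at x)"
    using assms(2,3) by (simp add: differentiable_on_eq_differentiable_at)
  then show ?thesis
    using frechet_derivative_works by blast
qed

lemma Ck_on_cong:
  assumes "open U" "Ck_on k U f" "\<And>x. x \<in> U \<Longrightarrow> f x = g x"
  shows "Ck_on k U g"
  using assms(2,3)
proof (induction k arbitrary: f g)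
  case 0
  then show ?case by (simp cong: continuous_on_cong)
next
  case (Suc k)
  have f: "f differentiable (at x)" if "x \<in> U" for x
    using Ck_on_SucD[OF Suc.prems(1) assms(1) that] by (auto simp: differentiable_def)
  have eq: "frechet_derivative f (at x) = frechet_derivative g (at x)" if "x \<in> U" for x
    using frechet_derivative_transform_within_open[OF f[OF that] assms(1) that] Suc.prems(2) by blast
  have "g differentiable_on U"
    unfolding differentiable_on_def
  proof
    fix x assume x: "x \<in> U"
    show "g differentiable (at x within U)"
      using has_derivative_transform_within_open[OF Ck_on_SucD[OF Suc.prems(1) assms(1) x] assms(1) x]
        Suc.prems(2) differentiableI differentiable_at_withinI by blast
  qed
  moreover have "Ck_on k U (\<lambda>x. frechet_derivative g (at x) b)" if "b \<in> Basis" for b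
    by (rule Suc.IH[of "\<lambda>x. frechet_derivative f (at x) b"]) (use Suc.prems(1) that eq in auto)
  ultimately show ?case by simp
qed

lemma Ck_on_SucI:
  assumes "open U"
    and "\<And>x. x \<in> U \<Longrightarrow> (f has_derivative f' x) (at x)"
    and "\<And>b. b \<in> Basis \<Longrightarrow> Ck_on k U (\<lambda>x. f' x b)"
  shows "Ck_on (Suc k) U f"
proof -
  have "f differentiable_on U"
    unfolding differentiable_on_def
    using assms(2) differentiable_at_withinI differentiableI by blast
  moreover have eq: "frechet_derivative f (at x) = f' x" if "x \<in> U" for x
    using frechet_derivative_at[OF assms(2)[OF that]] by simp
  have "Ck_on k U (\<lambda>x. frechet_derivative f (at x) b)" if "b \<in> Basis" for b
    by (rule Ck_on_cong[OF assms(1) assms(3)[OF that]]) (simp add: eq)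
  ultimately show ?thesis by simp
qed

lemma Ck_on_Suc_imp: "open U \<Longrightarrow> Ck_on (Suc k) U f \<Longrightarrow> Ck_on k U f"
proof (induction k arbitrary: f)
  case 0
  then show ?case by (simp add: differentiable_imp_continuous_on)
qed auto

lemma Ck_on_imp_continuous_on: "open U \<Longrightarrow> Ck_on k U f \<Longrightarrow> continuous_on U f"
  by (induction k) (auto dest: differentiable_imp_continuous_on)

lemma Ck_on_subset:
  assumes "open U" "open V" "V \<subseteq> U" "Ck_on k U f"
  shows "Ck_on k V f"
  using assms by (induction k arbitrary: f)
    (auto intro: continuous_on_subset differentiable_on_subset)

lemma Ck_on_const: "Ck_on k U (\<lambda>x. c)"
  by (induction k arbitrary: c) auto

lemma Ck_on_bounded_linear:
  assumes "open U" "bounded_linear h" "Ck_on k U f"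
  shows "Ck_on k U (\<lambda>x. h (f x))"
  using assms(3)
proof (induction k arbitrary: f)
  case 0
  then show ?case
    using bounded_linear.continuous_on[OF assms(2)] by simp
next
  case (Suc k)
  show ?case
  proof (rule Ck_on_SucI[OF assms(1)])
    show "((\<lambda>x. h (f x)) has_derivative (\<lambda>y. h (frechet_derivative f (at x) y))) (at x)" if "x \<in> U" for x
      by (intro bounded_linear.has_derivative[OF assms(2)] Ck_on_SucD[OF Suc.prems assms(1) that])
    show "Ck_on k U (\<lambda>x. h (frechet_derivative f (at x) b))" if "b \<in> Basis" for b
      using Suc that by auto
  qed
qed

lemma Ck_on_add:
  assumes "open U" "Ck_on k U f" "Ck_on k U g"
  shows "Ck_on k U (\<lambda>x. f x + g x)"
  using assms(2,3)
proof (induction k arbitrary: f g)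
  case 0
  then show ?case by (auto intro: continuous_intros)
next
  case (Suc k)
  show ?case
  proof (rule Ck_on_SucI[OF assms(1)])
    show "((\<lambda>x. f x + g x) has_derivative
        (\<lambda>y. frechet_derivative f (at x) y + frechet_derivative g (at x) y)) (at x)" if "x \<in> U" for x
      using Suc.prems that assms(1) by (intro has_derivative_add) (auto intro: Ck_on_SucD)
    show "Ck_on k U (\<lambda>x. frechet_derivative f (at x) b + frechet_derivative g (at x) b)"
      if "b \<in> Basis" for b
      using Suc that by auto
  qed
qed

lemma Ck_on_sum:
  assumes "open U" "finite I" "\<And>i. i \<in> I \<Longrightarrow> Ck_on k U (f i)"
  shows "Ck_on k U (\<lambda>x. \<Sum>i\<in>I. f i x)"
  using assms(2,3) by (induction I) (auto intro: Ck_on_const Ck_on_add[OF assms(1)])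

lemma Ck_on_bilinear:
  assumes "open U" "bounded_bilinear prd" "Ck_on k U f" "Ck_on k U g"
  shows "Ck_on k U (\<lambda>x. prd (f x) (g x))"
  using assms(3,4)
proof (induction k arbitrary: f g)
  case 0
  then show ?case using bounded_bilinear.continuous_on[OF assms(2)] by auto
next
  case (Suc k)
  show ?case
  proof (rule Ck_on_SucI[OF assms(1)])
    show "((\<lambda>x. prd (f x) (g x)) has_derivative
        (\<lambda>y. prd (f x) (frechet_derivative g (at x) y) + prd (frechet_derivative f (at x) y) (g x))) (at x)"
      if "x \<in> U" for x
      using Suc.prems that assms(1)
      by (intro bounded_bilinear.FDERIV[OF assms(2)]) (auto intro: Ck_on_SucD)
    show "Ck_on k U (\<lambda>x. prd (f x) (frechet_derivative g (at x) b) + prd (frechet_derivative f (at x) b) (g x))"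
      if "b \<in> Basis" for b
      using Suc that assms(1) by (intro Ck_on_add Suc.IH) (auto intro: Ck_on_Suc_imp)
  qed
qed

text \<open>By the chain rule a partial derivative of the composition is a combination of
  the partial derivatives of \<open>g\<close>, composed with \<open>f\<close>; so the induction on the order runs over \<open>g\<close>
  while \<open>f\<close> stays fixed.\<close>

lemma Ck_on_compose:
  fixes f :: "'a::euclidean_space \<Rightarrow> 'b::euclidean_space"
    and g :: "'b \<Rightarrow> 'c::real_normed_vector"
  assumes "open U" "open V" "f ` U \<subseteq> V" "Ck_on k U f" "Ck_on k V g"
  shows "Ck_on k U (\<lambda>x. g (f x))"
  using assms(4,5)
proof (induction k arbitrary: g)
  case 0
  then show ?case
    using assms(3) continuous_on_compose2 by (metis Ck_on.simps(1))
next
  case (Suc k)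
  let ?D = "frechet_derivative"
  show ?case
  proof (rule Ck_on_SucI[OF assms(1)])
    fix x assume x: "x \<in> U"
    have g: "(g has_derivative ?D g (at (f x))) (at (f x))"
      using Ck_on_SucD[OF Suc.prems(2) assms(2)] assms(3) x by blast
    have expand: "?D g (at (f x)) z = (\<Sum>e\<in>Basis. (z \<bullet> e) *\<^sub>R ?D g (at (f x)) e)" for z
    proof -
      have lin: "linear (?D g (at (f x)))"
        using g has_derivative_linear by blast
      have "?D g (at (f x)) z = ?D g (at (f x)) (\<Sum>e\<in>Basis. (z \<bullet> e) *\<^sub>R e)"
        by (simp add: euclidean_representation)
      then show ?thesis
        by (simp add: linear_sum[OF lin] linear_scale[OF lin])
    qed
    show "((\<lambda>x. g (f x)) has_derivative
        (\<lambda>y. \<Sum>e\<in>Basis. (?D f (at x) y \<bullet> e) *\<^sub>R ?D g (at (f x)) e)) (at x)"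
      using has_derivative_compose[OF Ck_on_SucD[OF Suc.prems(1) assms(1) x] g]
      by (subst expand[symmetric])
  next
    fix b :: 'a assume b: "b \<in> Basis"
    have "Ck_on k U (\<lambda>x. ?D g (at (f x)) e)" if "e \<in> Basis" for e
      using Suc.prems that Ck_on_Suc_imp[OF assms(1)] by (intro Suc.IH[where g="\<lambda>z. frechet_derivative g (at z) e"]) auto
    moreover have "Ck_on k U (\<lambda>x. ?D f (at x) b \<bullet> e)" for e
      using Suc.prems b by (intro Ck_on_bounded_linear[OF assms(1) bounded_linear_inner_left]) auto
    ultimately show "Ck_on k U (\<lambda>x. \<Sum>e\<in>Basis. (?D f (at x) b \<bullet> e) *\<^sub>R ?D g (at (f x)) e)"
      using assms(1) by (intro Ck_on_sum Ck_on_bilinear[OF _ bounded_bilinear_scaleR]) auto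
  qed
qed

lemma Ck_on_inverse:
  fixes f :: "'a::euclidean_space \<Rightarrow> real"
  assumes "open U" "Ck_on k U f" "\<And>x. x \<in> U \<Longrightarrow> f x \<noteq> 0"
  shows "Ck_on k U (\<lambda>x. inverse (f x))"
  using assms(2)
proof (induction k)
  case 0
  then show ?case using assms(3) by (auto intro: continuous_intros)
next
  case (Suc k)
  show ?case
  proof (rule Ck_on_SucI[OF assms(1)])
    show "((\<lambda>x. inverse (f x)) has_derivative
        (\<lambda>y. - (inverse (f x) * frechet_derivative f (at x) y * inverse (f x)))) (at x)" if "x \<in> U" for x
      by (intro Deriv.has_derivative_inverse assms(3) that Ck_on_SucD[OF Suc.prems assms(1) that])
    have i: "Ck_on k U (\<lambda>x. inverse (f x))"
      using Suc Ck_on_Suc_imp[OF assms(1)] by blast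
    show "Ck_on k U (\<lambda>x. - (inverse (f x) * frechet_derivative f (at x) b * inverse (f x)))"
      if "b \<in> Basis" for b
      using Suc.prems that i assms(1)
      by (intro Ck_on_bounded_linear[OF _ bounded_linear_minus[OF bounded_linear_ident]]
          Ck_on_bilinear[OF _ bounded_bilinear_mult]) auto
  qed
qed

lemma smooth_onD: "smooth_on U f \<Longrightarrow> Ck_on k U f"
  by (simp add: smooth_on_def)

lemma smooth_on_cong:
  "open U \<Longrightarrow> smooth_on U f \<Longrightarrow> (\<And>x. x \<in> U \<Longrightarrow> f x = g x) \<Longrightarrow> smooth_on U g"
  unfolding smooth_on_def using Ck_on_cong by blast

lemma smooth_on_subset:
  "open U \<Longrightarrow> open V \<Longrightarrow> V \<subseteq> U \<Longrightarrow> smooth_on U f \<Longrightarrow> smooth_on V f"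
  unfolding smooth_on_def using Ck_on_subset by blast

lemma smooth_on_const: "smooth_on U (\<lambda>x. c)"
  by (simp add: smooth_on_def Ck_on_const)

lemma smooth_on_bounded_linear:
  "open U \<Longrightarrow> bounded_linear h \<Longrightarrow> smooth_on U f \<Longrightarrow> smooth_on U (\<lambda>x. h (f x))"
  unfolding smooth_on_def using Ck_on_bounded_linear by blast

lemma smooth_on_add:
  "open U \<Longrightarrow> smooth_on U f \<Longrightarrow> smooth_on U g \<Longrightarrow> smooth_on U (\<lambda>x. f x + g x)"
  unfolding smooth_on_def using Ck_on_add by blast

lemma smooth_on_sum:
  "open U \<Longrightarrow> finite I \<Longrightarrow> (\<And>i. i \<in> I \<Longrightarrow> smooth_on U (f i)) \<Longrightarrow> smooth_on U (\<lambda>x. \<Sum>i\<in>I. f i x)"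
  unfolding smooth_on_def using Ck_on_sum by blast

lemma smooth_on_bilinear:
  "open U \<Longrightarrow> bounded_bilinear prd \<Longrightarrow> smooth_on U f \<Longrightarrow> smooth_on U g
    \<Longrightarrow> smooth_on U (\<lambda>x. prd (f x) (g x))"
  unfolding smooth_on_def using Ck_on_bilinear by blast

lemmas smooth_on_scaleR = smooth_on_bilinear[OF _ bounded_bilinear_scaleR]

lemma smooth_on_mult:
  fixes f g :: "'a::euclidean_space \<Rightarrow> real"
  shows "open U \<Longrightarrow> smooth_on U f \<Longrightarrow> smooth_on U g \<Longrightarrow> smooth_on U (\<lambda>x. f x * g x)"
  by (rule smooth_on_bilinear[OF _ bounded_bilinear_mult])

lemma smooth_on_compose:
  fixes f :: "'a::euclidean_space \<Rightarrow> 'b::euclidean_space"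
    and g :: "'b \<Rightarrow> 'c::real_normed_vector"
  shows "open U \<Longrightarrow> open V \<Longrightarrow> f ` U \<subseteq> V \<Longrightarrow> smooth_on U f \<Longrightarrow> smooth_on V g
    \<Longrightarrow> smooth_on U (\<lambda>x. g (f x))"
  unfolding smooth_on_def using Ck_on_compose by blast

lemma smooth_on_inverse:
  fixes f :: "'a::euclidean_space \<Rightarrow> real"
  shows "open U \<Longrightarrow> smooth_on U f \<Longrightarrow> (\<And>x. x \<in> U \<Longrightarrow> f x \<noteq> 0) \<Longrightarrow> smooth_on U (\<lambda>x. inverse (f x))"
  unfolding smooth_on_def using Ck_on_inverse by blast

lemma smooth_on_imp_continuous_on: "open U \<Longrightarrow> smooth_on U f \<Longrightarrow> continuous_on U f"
  unfolding smooth_on_def using Ck_on_imp_continuous_on by blast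

lemma smooth_on_ident: "open U \<Longrightarrow> smooth_on U (\<lambda>x. x)"
proof -
  assume U: "open U"
  have "Ck_on k U (\<lambda>x. x)" for k
  proof (cases k)
    case (Suc j)
    show ?thesis
      unfolding Suc by (rule Ck_on_SucI[OF U, where f'="\<lambda>x y. y"]) (auto intro: Ck_on_const U)
  qed simp
  then show ?thesis by (simp add: smooth_on_def)
qed

lemma smooth_on_linear: "open U \<Longrightarrow> bounded_linear h \<Longrightarrow> smooth_on U h"
  by (rule smooth_on_bounded_linear[OF _ _ smooth_on_ident])

lemma smooth_on_Pair:
  assumes "open U" "smooth_on U f" "smooth_on U g"
  shows "smooth_on U (\<lambda>x. (f x, g x))"
proof -
  have "smooth_on U (\<lambda>x. (f x, 0) + (0, g x))"
    by (intro smooth_on_add assms(1)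
        smooth_on_bounded_linear[OF assms(1) bounded_linear_Pair[OF bounded_linear_ident bounded_linear_zero] assms(2)]
        smooth_on_bounded_linear[OF assms(1) bounded_linear_Pair[OF bounded_linear_zero bounded_linear_ident] assms(3)])
  then show ?thesis by simp
qed

lemma smooth_on_has_derivative:
  "smooth_on U f \<Longrightarrow> open U \<Longrightarrow> x \<in> U \<Longrightarrow> (f has_derivative frechet_derivative f (at x)) (at x)"
  by (meson Ck_on_SucD smooth_on_def)

lemma smooth_on_derivative_linear:
  "smooth_on U f \<Longrightarrow> open U \<Longrightarrow> x \<in> U \<Longrightarrow> linear (frechet_derivative f (at x))"
  using smooth_on_has_derivative has_derivative_linear by blast

lemma smooth_on_derivative_expand:
  assumes "smooth_on U f" "open U" "x \<in> U"
  shows "frechet_derivative f (at x) y = (\<Sum>b\<in>Basis. (y \<bullet> b) *\<^sub>R frechet_derivative f (at x) b)"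
proof -
  note lin = smooth_on_derivative_linear[OF assms]
  have "frechet_derivative f (at x) y = frechet_derivative f (at x) (\<Sum>b\<in>Basis. (y \<bullet> b) *\<^sub>R b)"
    by (simp add: euclidean_representation)
  then show ?thesis
    by (simp add: linear_sum[OF lin] linear_scale[OF lin])
qed

lemma smooth_on_partial:
  assumes "smooth_on U f" "open U"
  shows "smooth_on U (\<lambda>x. frechet_derivative f (at x) y)"
proof (rule smooth_on_cong[OF assms(2)])
  show "smooth_on U (\<lambda>x. \<Sum>b\<in>Basis. (y \<bullet> b) *\<^sub>R frechet_derivative f (at x) b)"
  proof (intro smooth_on_sum assms smooth_on_bounded_linear[OF _ bounded_linear_scaleR_right])
    show "smooth_on U (\<lambda>x. frechet_derivative f (at x) b)" if "b \<in> Basis" for b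
      unfolding smooth_on_def using smooth_onD[OF assms(1), of "Suc k" for k] that by auto
  qed auto
qed (simp add: smooth_on_derivative_expand[OF assms, symmetric])

text \<open>The tangent map \<open>(x, y) \<mapsto> Df(x) y\<close> is the shape of the fibre part of the transition maps
  of the tangent bundle.\<close>

lemma smooth_on_tangent_map:
  assumes "smooth_on U f" "open U"
  shows "smooth_on (U \<times> UNIV) (\<lambda>z. frechet_derivative f (at (fst z)) (snd z))"
proof -
  have o: "open (U \<times> UNIV)"
    using assms(2) by (simp add: open_Times)
  have "smooth_on (U \<times> UNIV) (\<lambda>z. \<Sum>b\<in>Basis. (snd z \<bullet> b) *\<^sub>R frechet_derivative f (at (fst z)) b)"
  proof (intro smooth_on_sum o smooth_on_scaleR)
    fix b :: 'a
    show "smooth_on (U \<times> UNIV) (\<lambda>z :: 'a \<times> 'a. snd z \<bullet> b)"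
      by (intro smooth_on_linear o bounded_linear_intros)
    show "smooth_on (U \<times> UNIV) (\<lambda>z. frechet_derivative f (at (fst z)) b)"
      by (rule smooth_on_compose[OF o assms(2) _ smooth_on_linear[OF o bounded_linear_fst]])
        (auto intro: smooth_on_partial assms o)
  qed auto
  then show ?thesis
    by (rule smooth_on_cong[OF o])
      (auto simp: smooth_on_derivative_expand[OF assms(1,2), symmetric])
qed

lemma smooth_on_DERIV_line:
  fixes f :: "'a::euclidean_space \<Rightarrow> real"
  assumes "smooth_on U f" "open U" "p + t *\<^sub>R a \<in> U"
  shows "((\<lambda>t. f (p + t *\<^sub>R a)) has_real_derivative frechet_derivative f (at (p + t *\<^sub>R a)) a) (at t)"
proof -
  let ?D = "frechet_derivative f (at (p + t *\<^sub>R a))"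
  have "((\<lambda>t. p + t *\<^sub>R a) has_derivative (\<lambda>s. s *\<^sub>R a)) (at t)"
    by (auto intro!: derivative_eq_intros)
  then have "((\<lambda>t. f (p + t *\<^sub>R a)) has_derivative (\<lambda>s. ?D (s *\<^sub>R a))) (at t)"
    using has_derivative_compose smooth_on_has_derivative[OF assms] by blast
  moreover have "?D (s *\<^sub>R a) = ?D a * s" for s
    by (simp add: linear_scale[OF smooth_on_derivative_linear[OF assms]])
  ultimately show ?thesis
    by (simp add: has_field_derivative_def)
qed

text \<open>The mean value theorem, applied in the direction \<open>a\<close> and then in the direction \<open>b\<close>, to the
  second difference of \<open>f\<close>. The second difference does not change if \<open>a\<close> and \<open>b\<close> are exchanged,
  and this is what makes second partial derivatives commute.\<close>

lemma second_difference_mean_value: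
  fixes f :: "'a::euclidean_space \<Rightarrow> real"
  assumes f: "smooth_on U f" and U: "open U" and s: "0 < s"
    and box: "\<And>\<tau> \<sigma>. 0 \<le> \<tau> \<Longrightarrow> \<tau> \<le> s \<Longrightarrow> 0 \<le> \<sigma> \<Longrightarrow> \<sigma> \<le> s \<Longrightarrow> x + \<tau> *\<^sub>R a + \<sigma> *\<^sub>R b \<in> U"
  shows "\<exists>\<tau> \<sigma>. 0 < \<tau> \<and> \<tau> < s \<and> 0 < \<sigma> \<and> \<sigma> < s \<and>
    f (x + s *\<^sub>R a + s *\<^sub>R b) - f (x + s *\<^sub>R a) - f (x + s *\<^sub>R b) + f x =
      s * s * frechet_derivative (\<lambda>z. frechet_derivative f (at z) a) (at (x + \<tau> *\<^sub>R a + \<sigma> *\<^sub>R b)) b"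
proof -
  let ?F = "\<lambda>z. frechet_derivative f (at z) a"
  let ?\<phi> = "\<lambda>t. f ((x + s *\<^sub>R b) + t *\<^sub>R a) - f (x + t *\<^sub>R a)"
  have in1: "x + t *\<^sub>R a \<in> U" and in2: "(x + s *\<^sub>R b) + t *\<^sub>R a \<in> U" if "0 \<le> t" "t \<le> s" for t
    using box[OF that, of 0] box[OF that, of s] s by (simp_all add: algebra_simps)
  have "\<exists>\<tau>. 0 < \<tau> \<and> \<tau> < s \<and>
      ?\<phi> s - ?\<phi> 0 = (s - 0) * (?F ((x + s *\<^sub>R b) + \<tau> *\<^sub>R a) - ?F (x + \<tau> *\<^sub>R a))"
    by (rule MVT2[OF s]) (intro DERIV_diff smooth_on_DERIV_line[OF f U] in1 in2)
  then obtain \<tau> where \<tau>: "0 < \<tau>" "\<tau> < s"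
    and 1: "?\<phi> s - ?\<phi> 0 = s * (?F ((x + s *\<^sub>R b) + \<tau> *\<^sub>R a) - ?F (x + \<tau> *\<^sub>R a))"
    by auto
  have "\<exists>\<sigma>. 0 < \<sigma> \<and> \<sigma> < s \<and> ?F ((x + \<tau> *\<^sub>R a) + s *\<^sub>R b) - ?F ((x + \<tau> *\<^sub>R a) + 0 *\<^sub>R b) =
      (s - 0) * frechet_derivative ?F (at ((x + \<tau> *\<^sub>R a) + \<sigma> *\<^sub>R b)) b"
    using box \<tau> by (intro MVT2[OF s] smooth_on_DERIV_line[OF smooth_on_partial[OF f U] U]) auto
  then obtain \<sigma> where \<sigma>: "0 < \<sigma>" "\<sigma> < s"
    and 2: "?F ((x + s *\<^sub>R b) + \<tau> *\<^sub>R a) - ?F (x + \<tau> *\<^sub>R a) =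
      s * frechet_derivative ?F (at (x + \<tau> *\<^sub>R a + \<sigma> *\<^sub>R b)) b"
    by (auto simp: algebra_simps)
  from \<tau> \<sigma> 1 2 show ?thesis
    by (intro exI[of _ \<tau>] exI[of _ \<sigma>]) (simp add: algebra_simps)
qed

lemma second_derivative_symmetric:
  fixes f :: "'a::euclidean_space \<Rightarrow> real"
  assumes f: "smooth_on U f" and U: "open U" and x: "x \<in> U"
  shows "frechet_derivative (\<lambda>z. frechet_derivative f (at z) a) (at x) b =
         frechet_derivative (\<lambda>z. frechet_derivative f (at z) b) (at x) a"
proof -
  define G where "G a b z = frechet_derivative (\<lambda>z. frechet_derivative f (at z) a) (at z) b" for a b z
  have cont: "isCont (G a b) x" for a b
    unfolding G_def using smooth_on_imp_continuous_on[OF U smooth_on_partial[OF smooth_on_partial[OF f U] U]]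
      continuous_on_eq_continuous_at[OF U] x by blast
  have "\<bar>G a b x - G b a x\<bar> \<le> e" if e: "0 < e" for e
  proof -
    have "\<exists>d>0. \<forall>z. dist z x < d \<longrightarrow> dist (G a b z) (G a b x) < e / 2" for a b
      using cont[of a b] e unfolding continuous_at_eps_delta by (meson half_gt_zero)
    then obtain d1 d2 where d12: "d1 > 0" "d2 > 0"
      and c1: "\<And>z. dist z x < d1 \<Longrightarrow> dist (G a b z) (G a b x) < e / 2"
      and c2: "\<And>z. dist z x < d2 \<Longrightarrow> dist (G b a z) (G b a x) < e / 2"
      by metis
    obtain d3 where d3: "d3 > 0" "ball x d3 \<subseteq> U"
      using U x open_contains_ball by blast
    define d where "d = min d1 (min d2 d3)"
    have d: "0 < d" using d12 d3 by (simp add: d_def)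
    \<comment> \<open>The side \<open>s\<close> keeps the parallelogram inside the ball of radius \<open>d\<close>; adding \<open>1\<close> avoids a division by \<open>0\<close>.\<close>
    define s where "s = d / (2 * (norm a + norm b + 1))"
    have pos: "0 < norm a + norm b + 1"
      by (simp add: add_nonneg_pos)
    have s: "0 < s" "s * (norm a + norm b + 1) = d / 2"
      using pos d unfolding s_def by (simp, subst times_divide_eq_left, subst nonzero_divide_eq_eq) (auto simp: algebra_simps)
    have near: "dist (x + \<tau> *\<^sub>R a' + \<sigma> *\<^sub>R b') x < d"
      if "0 \<le> \<tau>" "\<tau> \<le> s" "0 \<le> \<sigma>" "\<sigma> \<le> s" "norm a' + norm b' = norm a + norm b" for \<tau> \<sigma> a' b'
    proof -
      have "norm (\<tau> *\<^sub>R a' + \<sigma> *\<^sub>R b') \<le> \<tau> * norm a' + \<sigma> * norm b'"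
        using norm_triangle_ineq[of "\<tau> *\<^sub>R a'" "\<sigma> *\<^sub>R b'"] that by simp
      also have "\<dots> \<le> s * norm a' + s * norm b'"
        using that by (intro add_mono mult_right_mono) auto
      also have "\<dots> \<le> s * (norm a + norm b + 1)"
        using that s by (simp flip: distrib_left)
      finally have "norm (\<tau> *\<^sub>R a' + \<sigma> *\<^sub>R b') < d"
        using s d by linarith
      moreover have "x + \<tau> *\<^sub>R a' + \<sigma> *\<^sub>R b' - x = \<tau> *\<^sub>R a' + \<sigma> *\<^sub>R b'"
        by simp
      ultimately show ?thesis
        by (simp add: dist_norm)
    qed
    have "x + \<tau> *\<^sub>R a + \<sigma> *\<^sub>R b \<in> U" "x + \<tau> *\<^sub>R b + \<sigma> *\<^sub>R a \<in> U"
      if "0 \<le> \<tau>" "\<tau> \<le> s" "0 \<le> \<sigma>" "\<sigma> \<le> s" for \<tau> \<sigma>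
      using near[OF that, of a b] near[OF that, of b a] d3(2)
      by (auto simp: d_def dist_commute subset_eq)
    note box = this
    obtain \<tau> \<sigma> where t: "0 < \<tau>" "\<tau> < s" "0 < \<sigma>" "\<sigma> < s"
      and 1: "f (x + s *\<^sub>R a + s *\<^sub>R b) - f (x + s *\<^sub>R a) - f (x + s *\<^sub>R b) + f x =
        s * s * G a b (x + \<tau> *\<^sub>R a + \<sigma> *\<^sub>R b)"
      using second_difference_mean_value[OF f U s(1) box(1)] unfolding G_def by blast
    obtain \<tau>' \<sigma>' where t': "0 < \<tau>'" "\<tau>' < s" "0 < \<sigma>'" "\<sigma>' < s"
      and 2: "f (x + s *\<^sub>R b + s *\<^sub>R a) - f (x + s *\<^sub>R b) - f (x + s *\<^sub>R a) + f x =
        s * s * G b a (x + \<tau>' *\<^sub>R b + \<sigma>' *\<^sub>R a)"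
      using second_difference_mean_value[OF f U s(1) box(2)] unfolding G_def by blast
    have exchange: "x + s *\<^sub>R b + s *\<^sub>R a = x + s *\<^sub>R a + s *\<^sub>R b"
      by simp
    from 1 2 have "s * s * G a b (x + \<tau> *\<^sub>R a + \<sigma> *\<^sub>R b) = s * s * G b a (x + \<tau>' *\<^sub>R b + \<sigma>' *\<^sub>R a)"
      unfolding exchange by linarith
    then have "G a b (x + \<tau> *\<^sub>R a + \<sigma> *\<^sub>R b) = G b a (x + \<tau>' *\<^sub>R b + \<sigma>' *\<^sub>R a)"
      using s(1) by simp
    moreover have "dist (G a b (x + \<tau> *\<^sub>R a + \<sigma> *\<^sub>R b)) (G a b x) < e / 2"
      using near[of \<tau> \<sigma> a b] t by (intro c1) (auto simp: d_def)
    moreover have "dist (G b a (x + \<tau>' *\<^sub>R b + \<sigma>' *\<^sub>R a)) (G b a x) < e / 2"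
      using near[of \<tau>' \<sigma>' b a] t' by (intro c2) (auto simp: d_def)
    ultimately show ?thesis
      unfolding dist_real_def by linarith
  qed
  then have "\<bar>G a b x - G b a x\<bar> \<le> 0"
    by (rule field_le_epsilon) simp
  then show ?thesis by (simp add: G_def)
qed

section \<open>Smooth functions and tangent vectors on a manifold given by an atlas\<close>

text \<open>The locale keeps what calculus in charts needs. It demands no topology on the points, so that
  the tangent bundle, which is given by its charts alone, is an instance.\<close>

locale smooth_atlas =
  fixes B :: "('p, 'e::euclidean_space) atlas"
  assumes inj_chart: "(U, \<phi>) \<in> B \<Longrightarrow> inj_on \<phi> U"
    and open_chart_image: "(U, \<phi>) \<in> B \<Longrightarrow> open (\<phi> ` U)"
    and open_overlap: "(U, \<phi>) \<in> B \<Longrightarrow> (V, \<psi>) \<in> B \<Longrightarrow> open (\<phi> ` (U \<inter> V))"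
    and smooth_transition:
      "(U, \<phi>) \<in> B \<Longrightarrow> (V, \<psi>) \<in> B \<Longrightarrow> smooth_on (\<phi> ` (U \<inter> V)) (\<psi> \<circ> inv_into U \<phi>)"

text \<open>For \<open>b\<close> in the basis of the model space, \<open>q \<mapsto> chart_tvec B U \<phi> q b f\<close> is the partial derivative of
  \<open>f\<close> in the chart. It is again a function on the manifold, so it can be differentiated further.\<close>

definition chart_tvec ::
  "('p, 'e::euclidean_space) atlas \<Rightarrow> 'p set \<Rightarrow> ('p \<Rightarrow> 'e) \<Rightarrow> 'p \<Rightarrow> 'e \<Rightarrow> 'p tvec" where
  "chart_tvec B U \<phi> p w =
     (\<lambda>f. if smooth_near B p f then frechet_derivative (f \<circ> inv_into U \<phi>) (at (\<phi> p)) w else 0)"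

lemma in_carrier_of: "p \<in> carrier_of B \<longleftrightarrow> (\<exists>(U, \<phi>)\<in>B. p \<in> U)"
  by (auto simp: carrier_of_def)

lemma smooth_nearI:
  assumes "(U, \<phi>) \<in> B" "p \<in> U" "open V" "\<phi> p \<in> V" "V \<subseteq> \<phi> ` U" "smooth_on V (f \<circ> inv_into U \<phi>)"
  shows "smooth_near B p f"
  using assms unfolding smooth_near_def by blast

lemma smooth_near_imp_carrier: "smooth_near B p f \<Longrightarrow> p \<in> carrier_of B"
  unfolding smooth_near_def carrier_of_def by blast

context smooth_atlas
begin

lemma chart_inv: "(U, \<phi>) \<in> B \<Longrightarrow> q \<in> U \<Longrightarrow> inv_into U \<phi> (\<phi> q) = q"
  using inj_chart by (simp add: inv_into_f_f)

lemma chart_inv_image: "(U, \<phi>) \<in> B \<Longrightarrow> x \<in> \<phi> ` U \<Longrightarrow> inv_into U \<phi> x \<in> U \<and> \<phi> (inv_into U \<phi> x) = x"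
  by (simp add: inv_into_into f_inv_into_f)

text \<open>Since the transition maps are smooth, any chart around a point can be used to test smoothness near it.\<close>

lemma smooth_near_chart:
  assumes "smooth_near B p f" and chart: "(U, \<phi>) \<in> B" "p \<in> U"
  obtains V where "open V" "\<phi> p \<in> V" "V \<subseteq> \<phi> ` U" "smooth_on V (f \<circ> inv_into U \<phi>)"
proof -
  obtain U' \<psi> V' where c': "(U', \<psi>) \<in> B" "p \<in> U'" and V': "open V'" "\<psi> p \<in> V'" "V' \<subseteq> \<psi> ` U'"
    and s: "smooth_on V' (f \<circ> inv_into U' \<psi>)"
    using assms(1) unfolding smooth_near_def by blast
  let ?h = "\<psi> \<circ> inv_into U \<phi>" and ?W = "\<phi> ` (U \<inter> U')"
  have W: "open ?W" and h: "smooth_on ?W ?h"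
    using open_overlap smooth_transition chart c' by blast+
  define V where "V = ?h -` V' \<inter> ?W"
  have V: "open V"
    unfolding V_def using smooth_on_imp_continuous_on[OF W h] continuous_on_open_vimage[OF W] V'(1)
    by blast
  have inv: "inv_into U \<phi> (\<phi> q) = q" if "q \<in> U" for q
    using chart_inv chart that by blast
  have "smooth_on V (\<lambda>x. (f \<circ> inv_into U' \<psi>) (?h x))"
    by (rule smooth_on_compose[OF V V'(1) _ smooth_on_subset[OF W V _ h] s]) (auto simp: V_def)
  then have "smooth_on V (f \<circ> inv_into U \<phi>)"
    by (rule smooth_on_cong[OF V]) (auto simp: V_def inv chart_inv[OF c'(1)])
  moreover have "\<phi> p \<in> V" "V \<subseteq> \<phi> ` U"
    using chart c' V' by (auto simp: V_def inv)
  ultimately show thesis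
    using that V by blast
qed

lemma smooth_near_eventually:
  assumes "smooth_near B p f" and chart: "(U, \<phi>) \<in> B" "p \<in> U"
  obtains V where "open V" "\<phi> p \<in> V" "V \<subseteq> \<phi> ` U" "smooth_on V (f \<circ> inv_into U \<phi>)"
    "\<And>q. q \<in> U \<Longrightarrow> \<phi> q \<in> V \<Longrightarrow> smooth_near B q f"
proof -
  obtain V where "open V" "\<phi> p \<in> V" "V \<subseteq> \<phi> ` U" "smooth_on V (f \<circ> inv_into U \<phi>)"
    by (rule smooth_near_chart[OF assms])
  then show thesis
    using that smooth_nearI[OF chart(1)] by blast
qed

lemma smooth_near_cong:
  assumes "smooth_near B p f" and chart: "(U, \<phi>) \<in> B" "p \<in> U"
    and W: "open W" "\<phi> p \<in> W" and eq: "\<And>q. q \<in> U \<Longrightarrow> \<phi> q \<in> W \<Longrightarrow> f q = g q"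
  shows "smooth_near B p g"
proof -
  obtain V where V: "open V" "\<phi> p \<in> V" "V \<subseteq> \<phi> ` U" "smooth_on V (f \<circ> inv_into U \<phi>)"
    by (rule smooth_near_chart[OF assms(1) chart])
  have VW: "open (V \<inter> W)"
    using V W by blast
  have "smooth_on (V \<inter> W) (g \<circ> inv_into U \<phi>)"
  proof (rule smooth_on_cong[OF VW smooth_on_subset[OF V(1) VW _ V(4)]])
    show "(f \<circ> inv_into U \<phi>) x = (g \<circ> inv_into U \<phi>) x" if "x \<in> V \<inter> W" for x
      using that V(3) eq chart_inv_image[OF chart(1), of x] by auto
  qed auto
  then show ?thesis
    using V W chart by (intro smooth_nearI[OF chart VW]) auto
qed

lemma smooth_near_cong_chart:
  assumes "smooth_near B p f" "(U, \<phi>) \<in> B" "p \<in> U" "\<And>q. q \<in> U \<Longrightarrow> f q = g q"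
  shows "smooth_near B p g"
  using smooth_near_cong[OF assms(1-3) open_UNIV] assms(4) by blast

lemma smooth_near_cong_carrier:
  assumes "smooth_near B p f" "\<And>q. q \<in> carrier_of B \<Longrightarrow> f q = g q"
  shows "smooth_near B p g"
proof -
  obtain U \<phi> where c: "(U, \<phi>) \<in> B" "p \<in> U"
    using smooth_near_imp_carrier[OF assms(1)] by (auto simp: in_carrier_of)
  show ?thesis
    by (rule smooth_near_cong_chart[OF assms(1) c]) (use assms(2) c in \<open>auto simp: in_carrier_of\<close>)
qed

lemma smooth_near_const: "p \<in> carrier_of B \<Longrightarrow> smooth_near B p (\<lambda>_. c)"
proof -
  assume "p \<in> carrier_of B"
  then obtain U \<phi> where "(U, \<phi>) \<in> B" "p \<in> U"
    by (auto simp: in_carrier_of)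
  then show ?thesis
    using open_chart_image by (intro smooth_nearI[of U \<phi> _ _ "\<phi> ` U"]) (auto simp: o_def smooth_on_const)
qed

text \<open>In a common chart, closure properties of smoothness near a point reduce to those of smoothness on open sets
  of the model space.\<close>

lemma smooth_near_lift2:
  assumes f: "smooth_near B p f" and g: "smooth_near B p g"
    and op: "\<And>V (f' :: 'e \<Rightarrow> real) g'. open V \<Longrightarrow> smooth_on V f' \<Longrightarrow> smooth_on V g'
      \<Longrightarrow> smooth_on V (\<lambda>x. F (f' x) (g' x))"
  shows "smooth_near B p (\<lambda>q. F (f q) (g q))"
proof -
  obtain U \<phi> where c: "(U, \<phi>) \<in> B" "p \<in> U"
    using smooth_near_imp_carrier[OF f] by (auto simp: in_carrier_of)
  obtain V where V: "open V" "\<phi> p \<in> V" "V \<subseteq> \<phi> ` U" "smooth_on V (f \<circ> inv_into U \<phi>)"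
    by (rule smooth_near_chart[OF f c])
  obtain W where W: "open W" "\<phi> p \<in> W" "W \<subseteq> \<phi> ` U" "smooth_on W (g \<circ> inv_into U \<phi>)"
    by (rule smooth_near_chart[OF g c])
  have VW: "open (V \<inter> W)"
    using V W by blast
  show ?thesis
  proof (rule smooth_nearI[OF c VW])
    show "smooth_on (V \<inter> W) ((\<lambda>q. F (f q) (g q)) \<circ> inv_into U \<phi>)"
      unfolding comp_def
      using op[OF VW smooth_on_subset[OF V(1) VW _ V(4)] smooth_on_subset[OF W(1) VW _ W(4)]]
      by (simp add: comp_def)
  qed (use V W in auto)
qed

lemma smooth_near_add: "smooth_near B p f \<Longrightarrow> smooth_near B p g \<Longrightarrow> smooth_near B p (\<lambda>q. f q + g q)"
  by (rule smooth_near_lift2) (auto intro: smooth_on_add)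

lemma smooth_near_mult: "smooth_near B p f \<Longrightarrow> smooth_near B p g \<Longrightarrow> smooth_near B p (\<lambda>q. f q * g q)"
  by (rule smooth_near_lift2) (auto intro: smooth_on_mult)

lemma smooth_near_cmult: "smooth_near B p f \<Longrightarrow> smooth_near B p (\<lambda>q. c * f q)"
  by (intro smooth_near_mult smooth_near_const smooth_near_imp_carrier)

lemma smooth_near_minus: "smooth_near B p f \<Longrightarrow> smooth_near B p (\<lambda>q. - f q)"
  using smooth_near_cmult[of p f "-1"] by simp

lemma smooth_near_diff: "smooth_near B p f \<Longrightarrow> smooth_near B p g \<Longrightarrow> smooth_near B p (\<lambda>q. f q - g q)"
  using smooth_near_add[OF _ smooth_near_minus] by fastforce

lemma smooth_near_sum:
  "p \<in> carrier_of B \<Longrightarrow> (\<And>i. i \<in> I \<Longrightarrow> smooth_near B p (f i)) \<Longrightarrow> smooth_near B p (\<lambda>q. \<Sum>i\<in>I. f i q)"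
  by (induction I rule: infinite_finite_induct) (auto intro: smooth_near_const smooth_near_add)

lemma smooth_near_prod:
  "p \<in> carrier_of B \<Longrightarrow> (\<And>i. i \<in> I \<Longrightarrow> smooth_near B p (f i)) \<Longrightarrow> smooth_near B p (\<lambda>q. \<Prod>i\<in>I. f i q)"
  by (induction I rule: infinite_finite_induct) (auto intro: smooth_near_const smooth_near_mult)

lemma smooth_near_inverse:
  assumes f: "smooth_near B p f" and "f p \<noteq> 0"
  shows "smooth_near B p (\<lambda>q. inverse (f q))"
proof -
  obtain U \<phi> where c: "(U, \<phi>) \<in> B" "p \<in> U"
    using smooth_near_imp_carrier[OF f] by (auto simp: in_carrier_of)
  obtain V where V: "open V" "\<phi> p \<in> V" "V \<subseteq> \<phi> ` U" "smooth_on V (f \<circ> inv_into U \<phi>)"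
    by (rule smooth_near_chart[OF f c])
  let ?W = "(f \<circ> inv_into U \<phi>) -` (- {0}) \<inter> V"
  have W: "open ?W"
    using smooth_on_imp_continuous_on[OF V(1,4)] continuous_on_open_vimage[OF V(1)] by blast
  show ?thesis
  proof (rule smooth_nearI[OF c W])
    show "smooth_on ?W ((\<lambda>q. inverse (f q)) \<circ> inv_into U \<phi>)"
      using smooth_on_inverse[OF W smooth_on_subset[OF V(1) W _ V(4)]] by (simp add: comp_def)
  qed (use V assms(2) chart_inv[OF c] in auto)
qed

lemma smooth_near_divide:
  "smooth_near B p f \<Longrightarrow> smooth_near B p g \<Longrightarrow> g p \<noteq> 0 \<Longrightarrow> smooth_near B p (\<lambda>q. f q / g q)"
  unfolding divide_inverse by (intro smooth_near_mult smooth_near_inverse)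

lemma smooth_near_det:
  fixes M :: "'n::finite \<Rightarrow> 'n \<Rightarrow> 'p \<Rightarrow> real"
  assumes "p \<in> carrier_of B" "\<And>i j. smooth_near B p (M i j)"
  shows "smooth_near B p (\<lambda>q. det (\<chi> i j. M i j q))"
  unfolding det_def using assms
  by (auto intro!: smooth_near_sum smooth_near_cmult smooth_near_prod)

text \<open>By Cramer's rule the components of the solution are quotients of determinants.\<close>

lemma smooth_near_linear_system:
  fixes M :: "'n::finite \<Rightarrow> 'n \<Rightarrow> 'p \<Rightarrow> real"
  assumes chart: "(U, \<phi>) \<in> B" "p \<in> U"
    and M: "\<And>i j. smooth_near B p (M i j)" and y: "\<And>i. smooth_near B p (y i)"
    and inj: "\<And>q z. q \<in> U \<Longrightarrow> (\<And>i. (\<Sum>j\<in>UNIV. M i j q * z j) = 0) \<Longrightarrow> z = (\<lambda>_. 0)"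
    and sol: "\<And>q i. q \<in> U \<Longrightarrow> (\<Sum>j\<in>UNIV. M i j q * c j q) = y i q"
  shows "smooth_near B p (c k)"
proof -
  have p: "p \<in> carrier_of B"
    using chart by (auto simp: in_carrier_of)
  let ?A = "\<lambda>q. (\<chi> i j. M i j q) :: real ^ 'n ^ 'n"
  have det: "det (?A q) \<noteq> 0" if "q \<in> U" for q
  proof -
    have "z = 0" if "?A q *v z = 0" for z :: "real ^ 'n"
    proof -
      have "(\<lambda>j. z $ j) = (\<lambda>_. 0)"
        using inj[OF \<open>q \<in> U\<close>, of "\<lambda>j. z $ j"] that
        by (simp add: matrix_vector_mult_def vec_eq_iff)
      then show ?thesis
        by (simp add: vec_eq_iff fun_eq_iff)
    qed
    then have "invertible (?A q)"
      using matrix_left_invertible_ker[of "?A q"] invertible_left_inverse by blast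
    then show ?thesis
      by (simp add: invertible_det_nz)
  qed
  have "smooth_near B p (\<lambda>q. det (\<chi> i j. if j = k then y i q else M i j q) / det (?A q))"
  proof (intro smooth_near_divide smooth_near_det p M det chart)
    show "smooth_near B p (\<lambda>q. if j = k then y i q else M i j q)" for i j
      using M y by (cases "j = k") auto
  qed
  moreover have "det (\<chi> i j. if j = k then y i q else M i j q) / det (?A q) = c k q" if "q \<in> U" for q
  proof -
    have "?A q *v (\<chi> j. c j q) = (\<chi> i. y i q)"
      using sol[OF that] by (simp add: matrix_vector_mult_def vec_eq_iff)
    then have "(\<chi> j. c j q) = (\<chi> k. det (\<chi> i j. if j = k then (\<chi> i. y i q) $ i else ?A q $ i $ j) / det (?A q))"
      using cramer[OF det[OF that]] by blast
    then have "(\<chi> j. c j q) $ k = (\<chi> k. det (\<chi> i j. if j = k then (\<chi> i. y i q) $ i else ?A q $ i $ j) / det (?A q)) $ k"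
      by (rule arg_cong)
    then show ?thesis
      by (simp cong: if_cong)
  qed
  ultimately show ?thesis
    by (rule smooth_near_cong_chart[OF _ chart])
qed

lemma smooth_near_has_derivative:
  assumes "smooth_near B p f" "(U, \<phi>) \<in> B" "p \<in> U"
  shows "((f \<circ> inv_into U \<phi>) has_derivative frechet_derivative (f \<circ> inv_into U \<phi>) (at (\<phi> p))) (at (\<phi> p))"
  using smooth_near_chart[OF assms] smooth_on_has_derivative by blast

lemma chart_tvec_in_tangent_space:
  "(U, \<phi>) \<in> B \<Longrightarrow> p \<in> U \<Longrightarrow> chart_tvec B U \<phi> p w \<in> tangent_space B p"
  unfolding tangent_space_def chart_tvec_def by blast

text \<open>The chain rule for the transition map: every chart around \<open>p\<close> yields all tangent vectors at \<open>p\<close>.\<close>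

lemma tangent_space_chart:
  assumes v: "v \<in> tangent_space B p" and chart: "(U, \<phi>) \<in> B" "p \<in> U"
  obtains w where "v = chart_tvec B U \<phi> p w"
proof -
  obtain U' \<psi> w where c': "(U', \<psi>) \<in> B" "p \<in> U'"
    and v': "v = (\<lambda>f. if smooth_near B p f
                       then frechet_derivative (f \<circ> inv_into U' \<psi>) (at (\<psi> p)) w else 0)"
    using v unfolding tangent_space_def by blast
  let ?h = "\<phi> \<circ> inv_into U' \<psi>" and ?W = "\<psi> ` (U' \<inter> U)"
  have W: "open ?W" "\<psi> p \<in> ?W" and h: "smooth_on ?W ?h"
    using open_overlap smooth_transition chart c' by blast+
  have hp: "?h (\<psi> p) = \<phi> p"
    using chart_inv[OF c'] by simp
  have "frechet_derivative (f \<circ> inv_into U' \<psi>) (at (\<psi> p)) w =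
      frechet_derivative (f \<circ> inv_into U \<phi>) (at (\<phi> p)) (frechet_derivative ?h (at (\<psi> p)) w)"
    if f: "smooth_near B p f" for f
  proof -
    have "((\<lambda>x. (f \<circ> inv_into U \<phi>) (?h x)) has_derivative (\<lambda>y. frechet_derivative (f \<circ> inv_into U \<phi>)
        (at (\<phi> p)) (frechet_derivative ?h (at (\<psi> p)) y))) (at (\<psi> p))"
      by (rule has_derivative_compose[OF smooth_on_has_derivative[OF h W]])
        (simp only: hp smooth_near_has_derivative[OF f chart])
    then have "((f \<circ> inv_into U' \<psi>) has_derivative (\<lambda>y. frechet_derivative (f \<circ> inv_into U \<phi>)
        (at (\<phi> p)) (frechet_derivative ?h (at (\<psi> p)) y))) (at (\<psi> p))"
      by (rule has_derivative_transform_within_open[OF _ W])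
        (auto simp: chart_inv[OF c'(1)] chart_inv[OF chart(1)])
    then show ?thesis
      by (simp add: frechet_derivative_at[symmetric])
  qed
  then have "v = chart_tvec B U \<phi> p (frechet_derivative ?h (at (\<psi> p)) w)"
    by (auto simp: v' chart_tvec_def)
  then show thesis
    using that by blast
qed

lemma tangent_space_carrier: "v \<in> tangent_space B p \<Longrightarrow> p \<in> carrier_of B"
  unfolding tangent_space_def by (auto simp: in_carrier_of)

lemma chart_tvec_linear:
  assumes "(U, \<phi>) \<in> B" "p \<in> U"
  shows "linear (\<lambda>w. chart_tvec B U \<phi> p w f)"
proof (cases "smooth_near B p f")
  case True
  then show ?thesis
    using has_derivative_linear[OF smooth_near_has_derivative[OF True assms]]
    by (simp add: chart_tvec_def)
next
  case False
  then show ?thesis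
    by (simp add: chart_tvec_def linear_iff)
qed

lemma chart_tvec_expand:
  assumes "(U, \<phi>) \<in> B" "p \<in> U"
  shows "chart_tvec B U \<phi> p w f = (\<Sum>b\<in>Basis. (w \<bullet> b) * chart_tvec B U \<phi> p b f)"
proof -
  have "chart_tvec B U \<phi> p w f = chart_tvec B U \<phi> p (\<Sum>b\<in>Basis. (w \<bullet> b) *\<^sub>R b) f"
    by (simp add: euclidean_representation)
  then show ?thesis
    by (simp add: linear_sum[OF chart_tvec_linear[OF assms]] linear_scale[OF chart_tvec_linear[OF assms]])
qed

lemma tangent_vector_nonsmooth: "v \<in> tangent_space B p \<Longrightarrow> \<not> smooth_near B p f \<Longrightarrow> v f = 0"
  unfolding tangent_space_def by auto

text \<open>Tangent vectors are local. For functions that are not smooth this holds because smoothness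
  near \<open>p\<close> is local and both sides are \<open>0\<close>.\<close>

lemma tangent_vector_cong:
  assumes v: "v \<in> tangent_space B p" and chart: "(U, \<phi>) \<in> B" "p \<in> U"
    and W: "open W" "\<phi> p \<in> W" and eq: "\<And>q. q \<in> U \<Longrightarrow> \<phi> q \<in> W \<Longrightarrow> f q = g q"
  shows "v f = v g"
proof -
  obtain w where w: "v = chart_tvec B U \<phi> p w"
    by (rule tangent_space_chart[OF v chart])
  show ?thesis
  proof (cases "smooth_near B p f")
    case True
    then have g: "smooth_near B p g"
      using smooth_near_cong[OF _ chart W] eq by blast
    obtain V where V: "open V" "\<phi> p \<in> V" "V \<subseteq> \<phi> ` U" "smooth_on V (f \<circ> inv_into U \<phi>)"
      by (rule smooth_near_chart[OF True chart])
    have "((g \<circ> inv_into U \<phi>) has_derivative frechet_derivative (f \<circ> inv_into U \<phi>) (at (\<phi> p))) (at (\<phi> p))"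
    proof (rule has_derivative_transform_within_open[OF smooth_near_has_derivative[OF True chart]])
      show "open (V \<inter> W)" "\<phi> p \<in> V \<inter> W"
        using V W by auto
      show "(f \<circ> inv_into U \<phi>) x = (g \<circ> inv_into U \<phi>) x" if "x \<in> V \<inter> W" for x
        using that V(3) eq chart_inv_image[OF chart(1), of x] by auto
    qed
    then show ?thesis
      using True g by (simp add: w chart_tvec_def frechet_derivative_at[symmetric])
  next
    case False
    then have "\<not> smooth_near B p g"
      using smooth_near_cong[OF _ chart W, of g f] eq by fastforce
    with False show ?thesis
      using v tangent_vector_nonsmooth by metis
  qed
qed

lemma tangent_vector_cong_carrier:
  assumes v: "v \<in> tangent_space B p" and eq: "\<And>q. q \<in> carrier_of B \<Longrightarrow> f q = g q"
  shows "v f = v g"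
proof -
  obtain U \<phi> where c: "(U, \<phi>) \<in> B" "p \<in> U"
    using tangent_space_carrier[OF v] by (auto simp: in_carrier_of)
  show ?thesis
    by (rule tangent_vector_cong[OF v c open_UNIV]) (use eq c in \<open>auto simp: in_carrier_of\<close>)
qed

text \<open>Tangent vectors inherit the rules of the Frechet derivative in a chart.\<close>

lemma tangent_vector_via_derivative:
  assumes v: "v \<in> tangent_space B p"
  obtains U \<phi> w where "(U, \<phi>) \<in> B" "p \<in> U"
    "\<And>f f'. smooth_near B p f \<Longrightarrow> ((f \<circ> inv_into U \<phi>) has_derivative f') (at (\<phi> p)) \<Longrightarrow> v f = f' w"
proof -
  obtain U \<phi> where c: "(U, \<phi>) \<in> B" "p \<in> U"
    using tangent_space_carrier[OF v] by (auto simp: in_carrier_of)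
  obtain w where w: "v = chart_tvec B U \<phi> p w"
    by (rule tangent_space_chart[OF v c])
  show thesis
    by (rule that[OF c, of w]) (auto simp: w chart_tvec_def frechet_derivative_at[symmetric])
qed

lemma tangent_vector_const:
  assumes "v \<in> tangent_space B p"
  shows "v (\<lambda>_. c) = 0"
proof -
  from assms obtain U \<phi> w where c: "(U, \<phi>) \<in> B" "p \<in> U"
    and v: "\<And>f f'. smooth_near B p f \<Longrightarrow> ((f \<circ> inv_into U \<phi>) has_derivative f') (at (\<phi> p)) \<Longrightarrow> v f = f' w"
    by (rule tangent_vector_via_derivative) blast
  show ?thesis
    using v[OF smooth_near_const[OF tangent_space_carrier[OF assms]], of c "\<lambda>_. 0"]
    by (simp add: comp_def)
qed

lemma tangent_vector_add:
  assumes "v \<in> tangent_space B p" "smooth_near B p f" "smooth_near B p g"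
  shows "v (\<lambda>q. f q + g q) = v f + v g"
proof -
  from assms(1) obtain U \<phi> w where c: "(U, \<phi>) \<in> B" "p \<in> U"
    and v: "\<And>f f'. smooth_near B p f \<Longrightarrow> ((f \<circ> inv_into U \<phi>) has_derivative f') (at (\<phi> p)) \<Longrightarrow> v f = f' w"
    by (rule tangent_vector_via_derivative) blast
  note f = smooth_near_has_derivative[OF assms(2) c] and g = smooth_near_has_derivative[OF assms(3) c]
  have "((\<lambda>q. f q + g q) \<circ> inv_into U \<phi>) = (\<lambda>x. (f \<circ> inv_into U \<phi>) x + (g \<circ> inv_into U \<phi>) x)"
    by auto
  then have "v (\<lambda>q. f q + g q) = frechet_derivative (f \<circ> inv_into U \<phi>) (at (\<phi> p)) w
      + frechet_derivative (g \<circ> inv_into U \<phi>) (at (\<phi> p)) w"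
    using v[OF smooth_near_add[OF assms(2,3)]] has_derivative_add[OF f g] by simp
  then show ?thesis
    using v[OF assms(2) f] v[OF assms(3) g] by simp
qed

lemma tangent_vector_mult:
  assumes "v \<in> tangent_space B p" "smooth_near B p f" "smooth_near B p g"
  shows "v (\<lambda>q. f q * g q) = f p * v g + v f * g p"
proof -
  from assms(1) obtain U \<phi> w where c: "(U, \<phi>) \<in> B" "p \<in> U"
    and v: "\<And>f f'. smooth_near B p f \<Longrightarrow> ((f \<circ> inv_into U \<phi>) has_derivative f') (at (\<phi> p)) \<Longrightarrow> v f = f' w"
    by (rule tangent_vector_via_derivative) blast
  note f = smooth_near_has_derivative[OF assms(2) c] and g = smooth_near_has_derivative[OF assms(3) c]
  have "((\<lambda>q. f q * g q) \<circ> inv_into U \<phi>) = (\<lambda>x. (f \<circ> inv_into U \<phi>) x * (g \<circ> inv_into U \<phi>) x)"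
    by auto
  then have "v (\<lambda>q. f q * g q) = f p * frechet_derivative (g \<circ> inv_into U \<phi>) (at (\<phi> p)) w
      + frechet_derivative (f \<circ> inv_into U \<phi>) (at (\<phi> p)) w * g p"
    using v[OF smooth_near_mult[OF assms(2,3)]] has_derivative_mult[OF f g] by (simp add: chart_inv[OF c])
  then show ?thesis
    using v[OF assms(2) f] v[OF assms(3) g] by simp
qed

lemma tangent_vector_cmult:
  assumes "v \<in> tangent_space B p" "smooth_near B p f"
  shows "v (\<lambda>q. c * f q) = c * v f"
  using tangent_vector_mult[OF assms(1) smooth_near_const assms(2)] tangent_vector_const[OF assms(1)]
    tangent_space_carrier[OF assms(1)] by simp

lemma tangent_vector_sum:
  assumes "v \<in> tangent_space B p" "\<And>i. i \<in> I \<Longrightarrow> smooth_near B p (f i)"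
  shows "v (\<lambda>q. \<Sum>i\<in>I. f i q) = (\<Sum>i\<in>I. v (f i))"
  using assms(2)
proof (induction I rule: infinite_finite_induct)
  case (insert i I)
  then show ?case
    using tangent_vector_add[OF assms(1), of "f i" "\<lambda>q. \<Sum>i\<in>I. f i q"]
      smooth_near_sum[OF tangent_space_carrier[OF assms(1)], of I f] by simp
qed (auto simp: tangent_vector_const[OF assms(1)])

lemma smooth_near_coord:
  assumes chart: "(U, \<phi>) \<in> B" "p \<in> U"
  shows "smooth_near B p (\<lambda>q. \<phi> q \<bullet> b)"
proof (rule smooth_nearI[OF chart open_chart_image[OF chart(1)]])
  show "smooth_on (\<phi> ` U) ((\<lambda>q. \<phi> q \<bullet> b) \<circ> inv_into U \<phi>)"
    by (rule smooth_on_cong[OF _ smooth_on_linear[OF _ bounded_linear_inner_left[of b]]])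
      (auto simp: open_chart_image[OF chart(1)] chart_inv[OF chart(1)])
qed (use chart in auto)

lemma chart_tvec_coord:
  assumes chart: "(U, \<phi>) \<in> B" "p \<in> U"
  shows "chart_tvec B U \<phi> p w (\<lambda>q. \<phi> q \<bullet> b) = w \<bullet> b"
proof -
  have "((\<lambda>x. x \<bullet> b) has_derivative (\<lambda>y. y \<bullet> b)) (at (\<phi> p))"
    by (rule bounded_linear_imp_has_derivative[OF bounded_linear_inner_left])
  then have "(((\<lambda>q. \<phi> q \<bullet> b) \<circ> inv_into U \<phi>) has_derivative (\<lambda>y. y \<bullet> b)) (at (\<phi> p))"
    by (rule has_derivative_transform_within_open[OF _ open_chart_image[OF chart(1)]])
      (use chart in \<open>auto simp: chart_inv[OF chart(1)]\<close>)
  then show ?thesis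
    using smooth_near_coord[OF chart] by (simp add: chart_tvec_def frechet_derivative_at[symmetric])
qed

lemma tangent_vector_expand:
  assumes v: "v \<in> tangent_space B p" and chart: "(U, \<phi>) \<in> B" "p \<in> U"
  shows "v f = (\<Sum>b\<in>Basis. v (\<lambda>q. \<phi> q \<bullet> b) * chart_tvec B U \<phi> p b f)"
proof -
  obtain w where w: "v = chart_tvec B U \<phi> p w"
    by (rule tangent_space_chart[OF v chart])
  show ?thesis
    unfolding w chart_tvec_coord[OF chart] by (rule chart_tvec_expand[OF chart])
qed

lemma tangent_vector_eqI:
  assumes "v \<in> tangent_space B p" "w \<in> tangent_space B p" and chart: "(U, \<phi>) \<in> B" "p \<in> U"
    and "\<And>b. b \<in> Basis \<Longrightarrow> v (\<lambda>q. \<phi> q \<bullet> b) = w (\<lambda>q. \<phi> q \<bullet> b)"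
  shows "v = w"
proof
  show "v f = w f" for f
    unfolding tangent_vector_expand[OF assms(1) chart, of f] tangent_vector_expand[OF assms(2) chart, of f]
    using assms(5) by simp
qed

lemma tangent_space_sum:
  assumes p: "p \<in> carrier_of B" and v: "\<And>i. i \<in> I \<Longrightarrow> v i \<in> tangent_space B p"
  shows "(\<lambda>f. \<Sum>i\<in>I. c i * v i f) \<in> tangent_space B p"
proof -
  obtain U \<phi> where chart: "(U, \<phi>) \<in> B" "p \<in> U"
    using p by (auto simp: in_carrier_of)
  have "\<exists>w. v i = chart_tvec B U \<phi> p w" if "i \<in> I" for i
    using tangent_space_chart[OF v[OF that] chart] by blast
  then obtain w where w: "\<And>i. i \<in> I \<Longrightarrow> v i = chart_tvec B U \<phi> p (w i)"
    by metis
  have "(\<lambda>f. \<Sum>i\<in>I. c i * v i f) = chart_tvec B U \<phi> p (\<Sum>i\<in>I. c i *\<^sub>R w i)"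
    by (simp add: fun_eq_iff w linear_sum[OF chart_tvec_linear[OF chart]]
        linear_scale[OF chart_tvec_linear[OF chart]])
  then show ?thesis
    using chart_tvec_in_tangent_space[OF chart] by simp
qed

lemma tangent_space_lin2:
  assumes "v \<in> tangent_space B p" "w \<in> tangent_space B p"
  shows "(\<lambda>f. a * v f + b * w f) \<in> tangent_space B p"
  using tangent_space_sum[of p UNIV "\<lambda>i. if i then v else w" "\<lambda>i. if i then a else b"]
    assms tangent_space_carrier[OF assms(1)] by (simp add: UNIV_bool add.commute)

subsection \<open>Vector fields\<close>

lemma smooth_near_chart_tvec:
  assumes f: "smooth_near B p f" and chart: "(U, \<phi>) \<in> B" "p \<in> U"
  shows "smooth_near B p (\<lambda>q. chart_tvec B U \<phi> q w f)"
proof -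
  obtain V where V: "open V" "\<phi> p \<in> V" "V \<subseteq> \<phi> ` U" "smooth_on V (f \<circ> inv_into U \<phi>)"
    and near: "\<And>q. q \<in> U \<Longrightarrow> \<phi> q \<in> V \<Longrightarrow> smooth_near B q f"
    using smooth_near_eventually[OF f chart] by blast
  show ?thesis
  proof (rule smooth_nearI[OF chart V(1-3)])
    show "smooth_on V ((\<lambda>q. chart_tvec B U \<phi> q w f) \<circ> inv_into U \<phi>)"
    proof (rule smooth_on_cong[OF V(1) smooth_on_partial[OF V(4,1)]])
      show "frechet_derivative (f \<circ> inv_into U \<phi>) (at x) w = ((\<lambda>q. chart_tvec B U \<phi> q w f) \<circ> inv_into U \<phi>) x"
        if "x \<in> V" for x
        using near[of "inv_into U \<phi> x"] chart_inv_image[OF chart(1), of x] that V(3)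
        by (auto simp: chart_tvec_def)
    qed
  qed
qed

text \<open>Symmetry of second derivatives, stated for functions on the manifold; the existence of
  complete lifts rests on it.\<close>

lemma chart_tvec_commute:
  assumes f: "smooth_near B p f" and chart: "(U, \<phi>) \<in> B" "p \<in> U"
  shows "chart_tvec B U \<phi> p a (\<lambda>q. chart_tvec B U \<phi> q b f) = chart_tvec B U \<phi> p b (\<lambda>q. chart_tvec B U \<phi> q a f)"
proof -
  obtain V where V: "open V" "\<phi> p \<in> V" "V \<subseteq> \<phi> ` U" "smooth_on V (f \<circ> inv_into U \<phi>)"
    and near: "\<And>q. q \<in> U \<Longrightarrow> \<phi> q \<in> V \<Longrightarrow> smooth_near B q f"
    using smooth_near_eventually[OF f chart] by blast
  have "chart_tvec B U \<phi> p a (\<lambda>q. chart_tvec B U \<phi> q b f) =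
      frechet_derivative (\<lambda>x. frechet_derivative (f \<circ> inv_into U \<phi>) (at x) b) (at (\<phi> p)) a" for a b
  proof -
    have "((\<lambda>q. chart_tvec B U \<phi> q b f) \<circ> inv_into U \<phi> has_derivative
        frechet_derivative (\<lambda>x. frechet_derivative (f \<circ> inv_into U \<phi>) (at x) b) (at (\<phi> p))) (at (\<phi> p))"
    proof (rule has_derivative_transform_within_open[OF
          smooth_on_has_derivative[OF smooth_on_partial[OF V(4,1)] V(1,2)] V(1,2)])
      show "frechet_derivative (f \<circ> inv_into U \<phi>) (at x) b = ((\<lambda>q. chart_tvec B U \<phi> q b f) \<circ> inv_into U \<phi>) x"
        if "x \<in> V" for x
        using near[of "inv_into U \<phi> x"] chart_inv_image[OF chart(1), of x] that V(3)
        by (auto simp: chart_tvec_def)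
    qed
    then show ?thesis
      using smooth_near_chart_tvec[OF f chart, of b] frechet_derivative_at
      by (fastforce simp: chart_tvec_def[of B U \<phi> p a])
  qed
  then show ?thesis
    using second_derivative_symmetric[OF V(4,1,2)] by simp
qed

text \<open>The value of the field on a smooth function is a combination of partial derivatives with
  the coordinates of the field as coefficients, so smoothness of the coordinates suffices.\<close>

lemma vector_fieldI:
  assumes tan: "\<And>p. p \<in> carrier_of B \<Longrightarrow> Z p \<in> tangent_space B p"
    and zero: "\<And>p. p \<notin> carrier_of B \<Longrightarrow> Z p = (\<lambda>f. 0)"
    and coord: "\<And>U \<phi> p b. (U, \<phi>) \<in> B \<Longrightarrow> p \<in> U \<Longrightarrow> b \<in> Basis \<Longrightarrow> smooth_near B p (\<lambda>q. Z q (\<lambda>r. \<phi> r \<bullet> b))"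
  shows "vector_field B Z"
proof -
  have "smooth_near B p (\<lambda>q. Z q f)" if p: "p \<in> carrier_of B" and f: "smooth_near B p f" for p f
  proof -
    obtain U \<phi> where chart: "(U, \<phi>) \<in> B" "p \<in> U"
      using p by (auto simp: in_carrier_of)
    have "smooth_near B p (\<lambda>q. \<Sum>b\<in>Basis. Z q (\<lambda>r. \<phi> r \<bullet> b) * chart_tvec B U \<phi> q b f)"
      using coord[OF chart] smooth_near_chart_tvec[OF f chart]
      by (intro smooth_near_sum[OF p] smooth_near_mult) auto
    then show ?thesis
    proof (rule smooth_near_cong_chart[OF _ chart])
      show "(\<Sum>b\<in>Basis. Z q (\<lambda>r. \<phi> r \<bullet> b) * chart_tvec B U \<phi> q b f) = Z q f" if "q \<in> U" for q
        by (rule tangent_vector_expand[OF tan chart(1) that, symmetric])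
          (use chart(1) that in \<open>auto simp: in_carrier_of\<close>)
    qed
  qed
  then show ?thesis
    unfolding vector_field_def using tan zero by blast
qed

lemma vector_field_tangent: "vector_field B Z \<Longrightarrow> p \<in> carrier_of B \<Longrightarrow> Z p \<in> tangent_space B p"
  unfolding vector_field_def by blast

lemma vector_field_smooth: "vector_field B Z \<Longrightarrow> smooth_near B p f \<Longrightarrow> smooth_near B p (\<lambda>q. Z q f)"
  using smooth_near_imp_carrier[of B p f] by (simp add: vector_field_def)

lemma vector_field_off_carrier: "vector_field B Z \<Longrightarrow> p \<notin> carrier_of B \<Longrightarrow> Z p = (\<lambda>f. 0)"
  unfolding vector_field_def by blast

lemma vector_field_sum:
  assumes Z: "\<And>i. i \<in> I \<Longrightarrow> vector_field B (Z i)"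
    and c: "\<And>i p. i \<in> I \<Longrightarrow> p \<in> carrier_of B \<Longrightarrow> smooth_near B p (c i)"
  shows "vector_field B (\<lambda>p f. \<Sum>i\<in>I. c i p * Z i p f)"
proof (rule vector_fieldI)
  show "(\<lambda>f. \<Sum>i\<in>I. c i p * Z i p f) \<in> tangent_space B p" if "p \<in> carrier_of B" for p
    using that Z by (intro tangent_space_sum vector_field_tangent) auto
  show "(\<lambda>f. \<Sum>i\<in>I. c i p * Z i p f) = (\<lambda>f. 0)" if "p \<notin> carrier_of B" for p
    using vector_field_off_carrier[OF Z that] by simp
  show "smooth_near B p (\<lambda>q. \<Sum>i\<in>I. c i q * Z i q (\<lambda>r. \<phi> r \<bullet> b))"
    if "(U, \<phi>) \<in> B" "p \<in> U" for U \<phi> p b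
  proof -
    have p: "p \<in> carrier_of B"
      using that by (auto simp: in_carrier_of)
    then show ?thesis
      by (intro smooth_near_sum smooth_near_mult c vector_field_smooth[OF Z smooth_near_coord[OF that]])
  qed
qed

lemma vector_field_lin2:
  assumes "vector_field B Z" "vector_field B W"
    and "\<And>p. p \<in> carrier_of B \<Longrightarrow> smooth_near B p a" "\<And>p. p \<in> carrier_of B \<Longrightarrow> smooth_near B p b"
  shows "vector_field B (\<lambda>p f. a p * Z p f + b p * W p f)"
proof -
  have "vector_field B (\<lambda>p f. \<Sum>i\<in>UNIV. (if i then b else a) p * (if i then W else Z) p f)"
    using assms by (intro vector_field_sum) auto
  then show ?thesis
    by (simp add: UNIV_bool)
qed

end

section \<open>The tangent bundle, vertical and complete lifts\<close>

definition TQ_dom :: "('q, real ^ 'n::finite) atlas \<Rightarrow> 'q set \<Rightarrow> 'q tbundle set" where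
  "TQ_dom \<A> U = {(q, v). q \<in> U \<and> v \<in> tangent_space \<A> q}"

definition TQ_chart :: "('q \<Rightarrow> real ^ 'n::finite) \<Rightarrow> 'q tbundle \<Rightarrow> (real ^ 'n) \<times> (real ^ 'n)" where
  "TQ_chart \<phi> = (\<lambda>(q, v). (\<phi> q, \<chi> j. v (\<lambda>p. \<phi> p $ j)))"

lemma TQ_eq: "TQ \<A> = (\<lambda>(U, \<phi>). (TQ_dom \<A> U, TQ_chart \<phi>)) ` \<A>"
  by (simp add: TQ_def TQ_dom_def TQ_chart_def)

lemma TQ_memE:
  assumes "(W, \<Phi>) \<in> TQ \<A>"
  obtains U \<phi> where "(U, \<phi>) \<in> \<A>" "W = TQ_dom \<A> U" "\<Phi> = TQ_chart \<phi>"
  using assms unfolding TQ_eq by auto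

lemma TQ_memI: "(U, \<phi>) \<in> \<A> \<Longrightarrow> (TQ_dom \<A> U, TQ_chart \<phi>) \<in> TQ \<A>"
  unfolding TQ_eq by (rule image_eqI) auto

lemma mem_TQ_dom: "u \<in> TQ_dom \<A> U \<longleftrightarrow> fst u \<in> U \<and> snd u \<in> tangent_space \<A> (fst u)"
  by (cases u) (simp add: TQ_dom_def)

lemma TQ_chart_apply: "TQ_chart \<phi> (q, v) = (\<phi> q, \<chi> j. v (\<lambda>p. \<phi> p $ j))"
  by (simp add: TQ_chart_def)

lemma TQ_chart_fst: "fst (TQ_chart \<phi> u) = \<phi> (fst u)"
  by (simp add: TQ_chart_def split_beta)

lemma TQ_chart_inner_base: "TQ_chart \<phi> u \<bullet> (b, 0) = \<phi> (fst u) \<bullet> b"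
  by (simp add: TQ_chart_def split_beta)

lemma TQ_chart_inner_fibre: "b \<in> Basis \<Longrightarrow> TQ_chart \<phi> u \<bullet> (0, b) = snd u (\<lambda>p. \<phi> p \<bullet> b)"
  by (auto simp: TQ_chart_def split_beta Basis_vec_def inner_axis)

locale tangent_bundle = smooth_atlas \<A> for \<A> :: "('q, real ^ 'n::finite) atlas"
begin

lemma chart_tvec_component:
  assumes "(U, \<phi>) \<in> \<A>" "q \<in> U"
  shows "chart_tvec \<A> U \<phi> q w (\<lambda>p. \<phi> p $ j) = w $ j"
  using chart_tvec_coord[OF assms, of w "axis j 1"] by (simp add: inner_axis)

lemma tangent_vector_components:
  assumes v: "v \<in> tangent_space \<A> q" and chart: "(U, \<phi>) \<in> \<A>" "q \<in> U"
  shows "chart_tvec \<A> U \<phi> q (\<chi> j. v (\<lambda>p. \<phi> p $ j)) = v"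
proof -
  obtain w where w: "v = chart_tvec \<A> U \<phi> q w"
    by (rule tangent_space_chart[OF v chart])
  have "(\<chi> j. v (\<lambda>p. \<phi> p $ j)) = w"
    by (simp add: w chart_tvec_component[OF chart] vec_eq_iff)
  then show ?thesis
    by (simp add: w)
qed

lemma inj_TQ_chart:
  assumes "(U, \<phi>) \<in> \<A>"
  shows "inj_on (TQ_chart \<phi>) (TQ_dom \<A> U)"
proof (rule inj_onI)
  fix u w assume u: "u \<in> TQ_dom \<A> U" and w: "w \<in> TQ_dom \<A> U" and eq: "TQ_chart \<phi> u = TQ_chart \<phi> w"
  have q: "fst u = fst w"
    using eq u w inj_onD[OF inj_chart[OF assms]] by (simp add: TQ_chart_def mem_TQ_dom split_beta)
  have comp: "(\<chi> j. snd u (\<lambda>p. \<phi> p $ j)) = (\<chi> j. snd w (\<lambda>p. \<phi> p $ j))"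
    using eq unfolding TQ_chart_def split_beta by (rule Pair_inject)
  have "snd u = chart_tvec \<A> U \<phi> (fst u) (\<chi> j. snd u (\<lambda>p. \<phi> p $ j))"
    using u by (intro tangent_vector_components[OF _ assms, symmetric]) (auto simp: mem_TQ_dom)
  also have "\<dots> = chart_tvec \<A> U \<phi> (fst w) (\<chi> j. snd w (\<lambda>p. \<phi> p $ j))"
    by (simp only: q comp)
  also have "\<dots> = snd w"
    using w by (intro tangent_vector_components[OF _ assms]) (auto simp: mem_TQ_dom)
  finally have "snd u = snd w" .
  with q show "u = w"
    by (simp add: prod_eq_iff)
qed

lemma TQ_chart_of_chart_tvec:
  assumes "(U, \<phi>) \<in> \<A>" "q \<in> U"
  shows "TQ_chart \<phi> (q, chart_tvec \<A> U \<phi> q y) = (\<phi> q, y)"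
  by (simp add: TQ_chart_def chart_tvec_component[OF assms])

lemma image_TQ_chart:
  assumes chart: "(U, \<phi>) \<in> \<A>" and "W \<subseteq> U"
  shows "TQ_chart \<phi> ` TQ_dom \<A> W = \<phi> ` W \<times> (UNIV :: (real ^ 'n) set)"
proof (intro equalityI subsetI)
  fix z assume "z \<in> \<phi> ` W \<times> (UNIV :: (real ^ 'n) set)"
  then obtain q where q: "q \<in> W" "z = (\<phi> q, snd z)"
    by (auto simp: prod_eq_iff)
  then have qU: "q \<in> U"
    using assms(2) by blast
  have "(q, chart_tvec \<A> U \<phi> q (snd z)) \<in> TQ_dom \<A> W"
    using q chart_tvec_in_tangent_space[OF chart qU] by (simp add: mem_TQ_dom)
  moreover have "z = TQ_chart \<phi> (q, chart_tvec \<A> U \<phi> q (snd z))"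
    using q TQ_chart_of_chart_tvec[OF chart qU] by simp
  ultimately show "z \<in> TQ_chart \<phi> ` TQ_dom \<A> W"
    by blast
qed (auto simp: TQ_dom_def TQ_chart_def)

lemma inv_TQ_chart:
  assumes chart: "(U, \<phi>) \<in> \<A>" and x: "x \<in> \<phi> ` U"
  shows "inv_into (TQ_dom \<A> U) (TQ_chart \<phi>) (x, y) =
    (inv_into U \<phi> x, chart_tvec \<A> U \<phi> (inv_into U \<phi> x) y)"
proof -
  let ?q = "inv_into U \<phi> x"
  have q: "?q \<in> U" "\<phi> ?q = x"
    using chart_inv_image[OF chart x] by auto
  have "(?q, chart_tvec \<A> U \<phi> ?q y) \<in> TQ_dom \<A> U"
    using chart_tvec_in_tangent_space[OF chart q(1)] q(1) by (simp add: mem_TQ_dom)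
  then show ?thesis
    using inv_into_f_f[OF inj_TQ_chart[OF chart]] TQ_chart_of_chart_tvec[OF chart q(1), of y] q(2) by metis
qed

text \<open>In the induced charts the change of coordinates is the tangent map of the change of coordinates
  of the base.\<close>

lemma TQ_transition:
  assumes "(U, \<phi>) \<in> \<A>" "(V, \<psi>) \<in> \<A>" and x: "x \<in> \<phi> ` (U \<inter> V)"
  shows "(TQ_chart \<psi> \<circ> inv_into (TQ_dom \<A> U) (TQ_chart \<phi>)) (x, y) =
    ((\<psi> \<circ> inv_into U \<phi>) x, frechet_derivative (\<psi> \<circ> inv_into U \<phi>) (at x) y)"
proof -
  let ?q = "inv_into U \<phi> x" and ?h = "\<psi> \<circ> inv_into U \<phi>"
  have xU: "x \<in> \<phi> ` U" and q: "?q \<in> U" "?q \<in> V" "\<phi> ?q = x"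
    using x chart_inv[OF assms(1)] by auto
  have h: "(?h has_derivative frechet_derivative ?h (at x)) (at x)"
    by (rule smooth_on_has_derivative[OF smooth_transition[OF assms(1,2)] open_overlap[OF assms(1,2)] x])
  have "chart_tvec \<A> U \<phi> ?q y (\<lambda>p. \<psi> p $ j) = frechet_derivative ?h (at x) y $ j" for j
  proof -
    have "smooth_near \<A> ?q (\<lambda>p. \<psi> p $ j)"
      using smooth_near_coord[OF assms(2) q(2), of "axis j 1"] by (simp add: inner_axis)
    moreover have "(((\<lambda>p. \<psi> p $ j) \<circ> inv_into U \<phi>) has_derivative (\<lambda>y. frechet_derivative ?h (at x) y $ j)) (at x)"
      using bounded_linear.has_derivative[OF bounded_linear_vec_nth h, of j] by (simp add: comp_def)
    ultimately show ?thesis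
      using q(3) by (simp add: chart_tvec_def frechet_derivative_at[symmetric])
  qed
  then show ?thesis
    by (simp add: inv_TQ_chart[OF assms(1) xU] TQ_chart_apply vec_eq_iff)
qed

lemma smooth_atlas_TQ: "smooth_atlas (TQ \<A>)"
proof
  fix W \<Phi> assume "(W, \<Phi>) \<in> TQ \<A>"
  then obtain U \<phi> where c: "(U, \<phi>) \<in> \<A>" "W = TQ_dom \<A> U" "\<Phi> = TQ_chart \<phi>"
    by (rule TQ_memE)
  show "inj_on \<Phi> W"
    using c inj_TQ_chart by blast
  show "open (\<Phi> ` W)"
    using c image_TQ_chart[OF c(1) subset_refl] open_chart_image[OF c(1)] by (simp add: open_Times)
  fix W' \<Psi> assume "(W', \<Psi>) \<in> TQ \<A>"
  then obtain V \<psi> where d: "(V, \<psi>) \<in> \<A>" "W' = TQ_dom \<A> V" "\<Psi> = TQ_chart \<psi>"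
    by (rule TQ_memE)
  have im: "\<Phi> ` (W \<inter> W') = \<phi> ` (U \<inter> V) \<times> UNIV"
  proof -
    have "W \<inter> W' = TQ_dom \<A> (U \<inter> V)"
      by (auto simp: c d TQ_dom_def)
    then show ?thesis
      using image_TQ_chart[OF c(1), of "U \<inter> V"] c(3) by simp
  qed
  have o: "open (\<phi> ` (U \<inter> V))" "open (\<phi> ` (U \<inter> V) \<times> (UNIV :: (real ^ 'n) set))"
    using open_overlap[OF c(1) d(1)] by (auto simp: open_Times)
  show "open (\<Phi> ` (W \<inter> W'))"
    using o(2) by (simp add: im)
  let ?h = "\<psi> \<circ> inv_into U \<phi>"
  have "smooth_on (\<phi> ` (U \<inter> V) \<times> UNIV) (\<lambda>z. (?h (fst z), frechet_derivative ?h (at (fst z)) (snd z)))"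
  proof (rule smooth_on_Pair[OF o(2) _ smooth_on_tangent_map[OF smooth_transition[OF c(1) d(1)] o(1)]])
    show "smooth_on (\<phi> ` (U \<inter> V) \<times> (UNIV :: (real ^ 'n) set)) (\<lambda>z. ?h (fst z))"
      by (rule smooth_on_compose[where g="?h" and f=fst, OF o(2) o(1) _
            smooth_on_linear[OF o(2) bounded_linear_fst] smooth_transition[OF c(1) d(1)]]) (auto simp: o)
  qed
  then show "smooth_on (\<Phi> ` (W \<inter> W')) (\<Psi> \<circ> inv_into W \<Phi>)"
    unfolding im unfolding c(2,3) d(2,3)
  proof (rule smooth_on_cong[OF o(2)])
    fix z assume "z \<in> \<phi> ` (U \<inter> V) \<times> (UNIV :: (real ^ 'n) set)"
    then show "(?h (fst z), frechet_derivative ?h (at (fst z)) (snd z)) =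
        (TQ_chart \<psi> \<circ> inv_into (TQ_dom \<A> U) (TQ_chart \<phi>)) z"
      using TQ_transition[OF c(1) d(1), of "fst z" "snd z"] by auto
  qed
qed

end

sublocale tangent_bundle \<subseteq> T: smooth_atlas "TQ \<A>"
  by (rule smooth_atlas_TQ)

context tangent_bundle
begin

lemma carrier_TQ: "u \<in> carrier_of (TQ \<A>) \<longleftrightarrow> snd u \<in> tangent_space \<A> (fst u)"
proof
  assume "u \<in> carrier_of (TQ \<A>)"
  then show "snd u \<in> tangent_space \<A> (fst u)"
    by (auto simp: in_carrier_of mem_TQ_dom elim: TQ_memE)
next
  assume v: "snd u \<in> tangent_space \<A> (fst u)"
  then obtain U \<phi> where c: "(U, \<phi>) \<in> \<A>" "fst u \<in> U"
    using tangent_space_carrier[OF v] by (auto simp: in_carrier_of)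
  with v have "u \<in> TQ_dom \<A> U"
    by (simp add: mem_TQ_dom)
  with TQ_memI[OF c(1)] show "u \<in> carrier_of (TQ \<A>)"
    unfolding in_carrier_of by (intro bexI[rotated]) auto
qed

lemma carrier_TQ_chart:
  assumes "u \<in> carrier_of (TQ \<A>)"
  obtains U \<phi> where "(U, \<phi>) \<in> \<A>" "fst u \<in> U" "(TQ_dom \<A> U, TQ_chart \<phi>) \<in> TQ \<A>" "u \<in> TQ_dom \<A> U"
proof -
  have v: "snd u \<in> tangent_space \<A> (fst u)"
    using assms by (simp add: carrier_TQ)
  then obtain U \<phi> where c: "(U, \<phi>) \<in> \<A>" "fst u \<in> U"
    using tangent_space_carrier[OF v] by (auto simp: in_carrier_of)
  show thesis
    by (rule that[OF c TQ_memI[OF c(1)]]) (simp add: mem_TQ_dom c v)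
qed

lemma smooth_near_TQ_base:
  assumes u: "u \<in> carrier_of (TQ \<A>)" and f: "smooth_near \<A> (fst u) f"
  shows "smooth_near (TQ \<A>) u (\<lambda>w. f (fst w))"
proof -
  obtain U \<phi> where c: "(U, \<phi>) \<in> \<A>" "fst u \<in> U" and T: "(TQ_dom \<A> U, TQ_chart \<phi>) \<in> TQ \<A>" "u \<in> TQ_dom \<A> U"
    by (rule carrier_TQ_chart[OF u])
  obtain V where V: "open V" "\<phi> (fst u) \<in> V" "V \<subseteq> \<phi> ` U" "smooth_on V (f \<circ> inv_into U \<phi>)"
    by (rule smooth_near_chart[OF f c])
  have o: "open (V \<times> (UNIV :: (real ^ 'n) set))"
    using V by (simp add: open_Times)
  show ?thesis
  proof (rule smooth_nearI[OF T o])
    show "TQ_chart \<phi> u \<in> V \<times> UNIV"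
      using V by (simp add: TQ_chart_def split_beta)
    show "V \<times> UNIV \<subseteq> TQ_chart \<phi> ` TQ_dom \<A> U"
      using V image_TQ_chart[OF c(1) subset_refl] by auto
    have "smooth_on (V \<times> (UNIV :: (real ^ 'n) set)) (\<lambda>z. (f \<circ> inv_into U \<phi>) (fst z))"
      by (rule smooth_on_compose[where g="f \<circ> inv_into U \<phi>" and f=fst, OF o V(1) _
            smooth_on_linear[OF o bounded_linear_fst] V(4)]) (auto simp: o)
    then show "smooth_on (V \<times> UNIV) ((\<lambda>w. f (fst w)) \<circ> inv_into (TQ_dom \<A> U) (TQ_chart \<phi>))"
      by (rule smooth_on_cong[OF o]) (use V(3) in \<open>auto simp: inv_TQ_chart[OF c(1)]\<close>)
  qed
qed

lemma smooth_near_TQ_fibre_linear: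
  assumes u: "u \<in> carrier_of (TQ \<A>)" and f: "smooth_near \<A> (fst u) f"
  shows "smooth_near (TQ \<A>) u (\<lambda>w. snd w f)"
proof -
  obtain U \<phi> where c: "(U, \<phi>) \<in> \<A>" "fst u \<in> U" and T: "(TQ_dom \<A> U, TQ_chart \<phi>) \<in> TQ \<A>" "u \<in> TQ_dom \<A> U"
    by (rule carrier_TQ_chart[OF u])
  obtain V where V: "open V" "\<phi> (fst u) \<in> V" "V \<subseteq> \<phi> ` U" "smooth_on V (f \<circ> inv_into U \<phi>)"
    and near: "\<And>q. q \<in> U \<Longrightarrow> \<phi> q \<in> V \<Longrightarrow> smooth_near \<A> q f"
    using smooth_near_eventually[OF f c] by blast
  have o: "open (V \<times> (UNIV :: (real ^ 'n) set))"
    using V by (simp add: open_Times)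
  show ?thesis
  proof (rule smooth_nearI[OF T o])
    show "TQ_chart \<phi> u \<in> V \<times> UNIV"
      using V by (simp add: TQ_chart_def split_beta)
    show "V \<times> UNIV \<subseteq> TQ_chart \<phi> ` TQ_dom \<A> U"
      using V image_TQ_chart[OF c(1) subset_refl] by auto
    show "smooth_on (V \<times> UNIV) ((\<lambda>w. snd w f) \<circ> inv_into (TQ_dom \<A> U) (TQ_chart \<phi>))"
    proof (rule smooth_on_cong[OF o smooth_on_tangent_map[OF V(4,1)]])
      fix z assume "z \<in> V \<times> (UNIV :: (real ^ 'n) set)"
      then have x: "fst z \<in> V" "fst z \<in> \<phi> ` U"
        using V(3) by auto
      then have "smooth_near \<A> (inv_into U \<phi> (fst z)) f"
        using near chart_inv_image[OF c(1) x(2)] by simp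
      then show "frechet_derivative (f \<circ> inv_into U \<phi>) (at (fst z)) (snd z) =
          ((\<lambda>w. snd w f) \<circ> inv_into (TQ_dom \<A> U) (TQ_chart \<phi>)) z"
        using inv_TQ_chart[OF c(1) x(2), of "snd z"] chart_inv_image[OF c(1) x(2)]
        by (simp add: chart_tvec_def)
    qed
  qed
qed

text \<open>The functions \<open>f \<circ> \<tau>\<close> and the fibrewise linear functions \<open>(q, v) \<mapsto> v(f)\<close> contain the
  coordinates of the tangent bundle, so they determine a tangent vector and decide its smoothness.\<close>

lemma TQ_tangent_vector_eqI:
  assumes Z: "Z \<in> tangent_space (TQ \<A>) u" and W: "W \<in> tangent_space (TQ \<A>) u"
    and base: "\<And>f. smooth_near \<A> (fst u) f \<Longrightarrow> Z (\<lambda>w. f (fst w)) = W (\<lambda>w. f (fst w))"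
    and fibre: "\<And>f. smooth_near \<A> (fst u) f \<Longrightarrow> Z (\<lambda>w. snd w f) = W (\<lambda>w. snd w f)"
  shows "Z = W"
proof -
  obtain U \<phi> where c: "(U, \<phi>) \<in> \<A>" "fst u \<in> U" and T: "(TQ_dom \<A> U, TQ_chart \<phi>) \<in> TQ \<A>" "u \<in> TQ_dom \<A> U"
    by (rule carrier_TQ_chart[OF T.tangent_space_carrier[OF Z]])
  show ?thesis
  proof (rule T.tangent_vector_eqI[OF Z W T])
    fix b :: "(real ^ 'n) \<times> (real ^ 'n)" assume "b \<in> Basis"
    then consider b' where "b' \<in> Basis" "b = (b', 0)" | b' where "b' \<in> Basis" "b = (0, b')"
      by (auto simp: Basis_prod_def)
    then show "Z (\<lambda>q. TQ_chart \<phi> q \<bullet> b) = W (\<lambda>q. TQ_chart \<phi> q \<bullet> b)"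
    proof cases
      case 1
      then show ?thesis
        using base[OF smooth_near_coord[OF c]] by (simp only: TQ_chart_inner_base)
    next
      case 2
      then show ?thesis
        using fibre[OF smooth_near_coord[OF c]] by (simp only: TQ_chart_inner_fibre)
    qed
  qed
qed

lemma TQ_vector_fieldI:
  assumes tan: "\<And>u. u \<in> carrier_of (TQ \<A>) \<Longrightarrow> Z u \<in> tangent_space (TQ \<A>) u"
    and zero: "\<And>u. u \<notin> carrier_of (TQ \<A>) \<Longrightarrow> Z u = (\<lambda>f. 0)"
    and base: "\<And>U \<phi> u b. (U, \<phi>) \<in> \<A> \<Longrightarrow> u \<in> TQ_dom \<A> U \<Longrightarrow>
      smooth_near (TQ \<A>) u (\<lambda>w. Z w (\<lambda>r. \<phi> (fst r) \<bullet> b))"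
    and fibre: "\<And>U \<phi> u b. (U, \<phi>) \<in> \<A> \<Longrightarrow> u \<in> TQ_dom \<A> U \<Longrightarrow>
      smooth_near (TQ \<A>) u (\<lambda>w. Z w (\<lambda>r. snd r (\<lambda>s. \<phi> s \<bullet> b)))"
  shows "vector_field (TQ \<A>) Z"
proof (rule T.vector_fieldI[OF tan zero])
  fix W \<Phi> u and b :: "(real ^ 'n) \<times> (real ^ 'n)"
  assume "(W, \<Phi>) \<in> TQ \<A>" and u: "u \<in> W" and b: "b \<in> Basis"
  then obtain U \<phi> where c: "(U, \<phi>) \<in> \<A>" "W = TQ_dom \<A> U" "\<Phi> = TQ_chart \<phi>"
    by (elim TQ_memE)
  consider b' where "b' \<in> Basis" "b = (b', 0)" | b' where "b' \<in> Basis" "b = (0, b')"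
    using b by (auto simp: Basis_prod_def)
  then show "smooth_near (TQ \<A>) u (\<lambda>w. Z w (\<lambda>r. \<Phi> r \<bullet> b))"
  proof cases
    case 1
    then show ?thesis
      using base[OF c(1)] u c by (simp only: TQ_chart_inner_base)
  next
    case 2
    then show ?thesis
      using fibre[OF c(1)] u c by (simp only: TQ_chart_inner_fibre)
  qed
qed auto

lemma chart_tvec_TQ_base:
  assumes c: "(U, \<phi>) \<in> \<A>" and u: "u \<in> TQ_dom \<A> U" and f: "smooth_near \<A> (fst u) f"
  shows "chart_tvec (TQ \<A>) (TQ_dom \<A> U) (TQ_chart \<phi>) u w (\<lambda>r. f (fst r)) = chart_tvec \<A> U \<phi> (fst u) (fst w) f"
proof -
  have q: "fst u \<in> U"
    using u by (simp add: mem_TQ_dom)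
  have u': "u \<in> carrier_of (TQ \<A>)"
    using u by (simp add: carrier_TQ mem_TQ_dom)
  let ?D = "frechet_derivative (f \<circ> inv_into U \<phi>) (at (\<phi> (fst u)))"
  have "((\<lambda>z. (f \<circ> inv_into U \<phi>) (fst z)) has_derivative (\<lambda>z. ?D (fst z))) (at (TQ_chart \<phi> u))"
    by (rule has_derivative_compose[OF has_derivative_fst[OF has_derivative_ident]])
      (simp only: TQ_chart_fst smooth_near_has_derivative[OF f c q])
  then have "((\<lambda>r. f (fst r)) \<circ> inv_into (TQ_dom \<A> U) (TQ_chart \<phi>) has_derivative (\<lambda>z. ?D (fst z))) (at (TQ_chart \<phi> u))"
  proof (rule has_derivative_transform_within_open)
    show "open (\<phi> ` U \<times> (UNIV :: (real ^ 'n) set))"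
      using open_chart_image[OF c] by (simp add: open_Times)
    show "TQ_chart \<phi> u \<in> \<phi> ` U \<times> UNIV"
      using q by (simp add: TQ_chart_def split_beta)
    show "(f \<circ> inv_into U \<phi>) (fst z) = ((\<lambda>r. f (fst r)) \<circ> inv_into (TQ_dom \<A> U) (TQ_chart \<phi>)) z"
      if "z \<in> \<phi> ` U \<times> UNIV" for z
      using that inv_TQ_chart[OF c, of "fst z" "snd z"] by auto
  qed
  then show ?thesis
    using smooth_near_TQ_base[OF u' f] f
    by (simp add: chart_tvec_def frechet_derivative_at[symmetric])
qed

text \<open>In a chart the vertical lift of \<open>Y\<close> points in the direction \<open>(0, Y)\<close>.\<close>

lemma vlift_chart:
  assumes c: "(U, \<phi>) \<in> \<A>" and u: "u \<in> TQ_dom \<A> U" and Y: "Y (fst u) = chart_tvec \<A> U \<phi> (fst u) \<eta>"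
  shows "vlift \<A> Y u = chart_tvec (TQ \<A>) (TQ_dom \<A> U) (TQ_chart \<phi>) u (0, \<eta>)"
proof
  fix F
  have q: "fst u \<in> U" and v: "snd u \<in> tangent_space \<A> (fst u)"
    using u by (auto simp: mem_TQ_dom)
  have u': "u \<in> carrier_of (TQ \<A>)"
    using v by (simp add: carrier_TQ)
  let ?\<Psi> = "inv_into (TQ_dom \<A> U) (TQ_chart \<phi>)"
  show "vlift \<A> Y u F = chart_tvec (TQ \<A>) (TQ_dom \<A> U) (TQ_chart \<phi>) u (0, \<eta>) F"
  proof (cases "smooth_near (TQ \<A>) u F")
    case True
    let ?D = "frechet_derivative (F \<circ> ?\<Psi>) (at (TQ_chart \<phi> u))"
    have D: "(F \<circ> ?\<Psi> has_derivative ?D) (at (TQ_chart \<phi> u))"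
      by (rule T.smooth_near_has_derivative[OF True TQ_memI[OF c] u])
    have line: "?\<Psi> (TQ_chart \<phi> u + t *\<^sub>R (0, \<eta>)) = (fst u, \<lambda>f. snd u f + t * Y (fst u) f)" for t
    proof -
      let ?y = "\<chi> j. snd u (\<lambda>p. \<phi> p $ j)"
      have "TQ_chart \<phi> u + t *\<^sub>R (0, \<eta>) = (\<phi> (fst u), ?y + t *\<^sub>R \<eta>)"
        by (simp add: TQ_chart_def split_beta)
      then have "?\<Psi> (TQ_chart \<phi> u + t *\<^sub>R (0, \<eta>)) = (fst u, chart_tvec \<A> U \<phi> (fst u) (?y + t *\<^sub>R \<eta>))"
        using inv_TQ_chart[OF c, of "\<phi> (fst u)"] q by (simp add: chart_inv[OF c q])
      moreover have "chart_tvec \<A> U \<phi> (fst u) (?y + t *\<^sub>R \<eta>) = (\<lambda>f. snd u f + t * Y (fst u) f)"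
        unfolding Y linear_add[OF chart_tvec_linear[OF c q]] fun_eq_iff
        by (simp add: linear_add[OF chart_tvec_linear[OF c q]] linear_scale[OF chart_tvec_linear[OF c q]]
            tangent_vector_components[OF v c q])
      ultimately show ?thesis
        by simp
    qed
    have "((\<lambda>t. TQ_chart \<phi> u + t *\<^sub>R (0, \<eta>)) has_derivative (\<lambda>s. s *\<^sub>R (0, \<eta>))) (at 0)"
      by (auto intro!: derivative_eq_intros)
    then have "((\<lambda>t. (F \<circ> ?\<Psi>) (TQ_chart \<phi> u + t *\<^sub>R (0, \<eta>))) has_derivative (\<lambda>s. ?D (s *\<^sub>R (0, \<eta>)))) (at 0)"
      by (rule has_derivative_compose) (simp only: scaleR_zero_left add_0_right D)
    moreover have "?D (s *\<^sub>R (0, \<eta>)) = ?D (0, \<eta>) * s" for s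
      by (simp only: linear_scale[OF has_derivative_linear[OF D]] real_scaleR_def mult.commute)
    ultimately have "((\<lambda>t. F (fst u, \<lambda>f. snd u f + t * Y (fst u) f)) has_real_derivative ?D (0, \<eta>)) (at 0)"
      unfolding has_field_derivative_def by (simp only: comp_def line)
    then show ?thesis
      using True u' by (simp add: vlift_def chart_tvec_def DERIV_imp_deriv)
  qed (simp add: vlift_def chart_tvec_def)
qed

lemma vlift_tangent:
  assumes u: "u \<in> carrier_of (TQ \<A>)" and Y: "Y (fst u) \<in> tangent_space \<A> (fst u)"
  shows "vlift \<A> Y u \<in> tangent_space (TQ \<A>) u"
proof -
  obtain U \<phi> where c: "(U, \<phi>) \<in> \<A>" "fst u \<in> U" and T: "(TQ_dom \<A> U, TQ_chart \<phi>) \<in> TQ \<A>" "u \<in> TQ_dom \<A> U"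
    by (rule carrier_TQ_chart[OF u])
  obtain \<eta> where \<eta>: "Y (fst u) = chart_tvec \<A> U \<phi> (fst u) \<eta>"
    by (rule tangent_space_chart[OF Y c])
  from vlift_chart[where Y = Y, OF c(1) T(2) \<eta>] show ?thesis
    using T.chart_tvec_in_tangent_space[OF T] by simp
qed

lemma vlift_off_carrier: "u \<notin> carrier_of (TQ \<A>) \<Longrightarrow> vlift \<A> Y u = (\<lambda>f. 0)"
  by (simp add: vlift_def)

lemma vlift_base: "vlift \<A> Y u (\<lambda>w. f (fst w)) = 0"
  by (simp add: vlift_def)

lemma vlift_fibre_linear:
  assumes "u \<in> carrier_of (TQ \<A>)" "smooth_near \<A> (fst u) f"
  shows "vlift \<A> Y u (\<lambda>w. snd w f) = Y (fst u) f"
proof -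
  have "((\<lambda>t. snd u f + t * Y (fst u) f) has_real_derivative Y (fst u) f) (at 0)"
    by (auto intro!: derivative_eq_intros)
  then show ?thesis
    using smooth_near_TQ_fibre_linear[OF assms] assms(1) by (simp add: vlift_def DERIV_imp_deriv)
qed

lemma vector_field_vlift:
  assumes Y: "vector_field \<A> Y"
  shows "vector_field (TQ \<A>) (vlift \<A> Y)"
proof (rule TQ_vector_fieldI)
  show "vlift \<A> Y u \<in> tangent_space (TQ \<A>) u" if "u \<in> carrier_of (TQ \<A>)" for u
    using that by (intro vlift_tangent vector_field_tangent[OF Y]) (auto simp: carrier_TQ dest!: tangent_space_carrier)
  fix U \<phi> u and b :: "real ^ 'n" assume c: "(U, \<phi>) \<in> \<A>" and u: "u \<in> TQ_dom \<A> U"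
  have u': "u \<in> carrier_of (TQ \<A>)" and q: "fst u \<in> U"
    using u by (simp_all add: carrier_TQ mem_TQ_dom)
  show "smooth_near (TQ \<A>) u (\<lambda>w. vlift \<A> Y w (\<lambda>r. \<phi> (fst r) \<bullet> b))"
    unfolding vlift_base[of Y _ "\<lambda>q. \<phi> q \<bullet> b"] by (rule T.smooth_near_const[OF u'])
  show "smooth_near (TQ \<A>) u (\<lambda>w. vlift \<A> Y w (\<lambda>r. snd r (\<lambda>s. \<phi> s \<bullet> b)))"
  proof (rule T.smooth_near_cong_chart[OF _ TQ_memI[OF c] u])
    show "smooth_near (TQ \<A>) u (\<lambda>w. Y (fst w) (\<lambda>s. \<phi> s \<bullet> b))"
      by (rule smooth_near_TQ_base[OF u' vector_field_smooth[OF Y smooth_near_coord[OF c q]]])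
    show "Y (fst w) (\<lambda>s. \<phi> s \<bullet> b) = vlift \<A> Y w (\<lambda>r. snd r (\<lambda>s. \<phi> s \<bullet> b))" if "w \<in> TQ_dom \<A> U" for w
      using that by (intro vlift_fibre_linear[symmetric] smooth_near_coord[OF c]) (auto simp: carrier_TQ mem_TQ_dom)
  qed
qed (rule vlift_off_carrier)

text \<open>The complete lift exists because second partial derivatives commute: expanding \<open>f\<close> in
  a chart, the identity \<open>Y\<^sup>C(f') = (Y f)'\<close> reduces to the symmetry of
  \<open>v\<^sup>c Y\<^sup>b \<partial>\<^bsub>c\<^esub>\<partial>\<^bsub>b\<^esub>f\<close> in \<open>v\<close> and \<open>Y\<close>.\<close>

lemma clift_exists:
  assumes Y: "vector_field \<A> Y" and u: "u \<in> carrier_of (TQ \<A>)"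
  shows "\<exists>Z. Z \<in> tangent_space (TQ \<A>) u \<and>
    (\<forall>f. smooth_near \<A> (fst u) f \<longrightarrow>
      Z (\<lambda>w. f (fst w)) = Y (fst u) f \<and> Z (\<lambda>w. snd w f) = snd u (\<lambda>q. Y q f))"
proof -
  obtain U \<phi> where c: "(U, \<phi>) \<in> \<A>" "fst u \<in> U" and T: "(TQ_dom \<A> U, TQ_chart \<phi>) \<in> TQ \<A>" "u \<in> TQ_dom \<A> U"
    by (rule carrier_TQ_chart[OF u])
  have v: "snd u \<in> tangent_space \<A> (fst u)" and q: "fst u \<in> carrier_of \<A>"
    using u tangent_space_carrier by (auto simp: carrier_TQ)
  note Yq = vector_field_tangent[OF Y q]
  obtain \<eta> where \<eta>: "Y (fst u) = chart_tvec \<A> U \<phi> (fst u) \<eta>"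
    by (rule tangent_space_chart[OF Yq c])
  let ?x = "\<lambda>b q. \<phi> q \<bullet> b" and ?d = "\<lambda>b f q. chart_tvec \<A> U \<phi> q b f"
  define \<zeta> :: "real ^ 'n" where "\<zeta> = (\<Sum>b\<in>Basis. snd u (\<lambda>q. Y q (?x b)) *\<^sub>R b)"
  define Z where "Z = chart_tvec (TQ \<A>) (TQ_dom \<A> U) (TQ_chart \<phi>) u (\<eta>, \<zeta>)"
  have Z: "Z \<in> tangent_space (TQ \<A>) u"
    unfolding Z_def by (rule T.chart_tvec_in_tangent_space[OF T])
  have base: "Z (\<lambda>w. f (fst w)) = Y (fst u) f" if "smooth_near \<A> (fst u) f" for f
    using chart_tvec_TQ_base[OF c(1) T(2) that] by (simp add: Z_def \<eta>)
  have coord: "Z (\<lambda>w. snd w (?x b)) = snd u (\<lambda>q. Y q (?x b))" if "b \<in> Basis" for b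
    using T.chart_tvec_coord[OF T, of "(\<eta>, \<zeta>)" "(0, b)"] that
    by (simp only: TQ_chart_inner_fibre[OF that] flip: Z_def)
      (simp add: inner_Pair \<zeta>_def)
  have "Z (\<lambda>w. snd w f) = snd u (\<lambda>q. Y q f)" if f: "smooth_near \<A> (fst u) f" for f
  proof -
    note df = smooth_near_chart_tvec[OF f c] and x = smooth_near_coord[OF c]
    note Yx = vector_field_smooth[OF Y x]
    note df' = smooth_near_TQ_base[OF u df] and x' = smooth_near_TQ_fibre_linear[OF u x]
    have "Z (\<lambda>w. snd w f) = Z (\<lambda>w. \<Sum>b\<in>Basis. snd w (?x b) * ?d b f (fst w))"
    proof (rule T.tangent_vector_cong[OF Z T open_UNIV UNIV_I])
      show "snd w f = (\<Sum>b\<in>Basis. snd w (?x b) * ?d b f (fst w))" if "w \<in> TQ_dom \<A> U" for w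
        using that by (intro tangent_vector_expand[OF _ c(1)]) (auto simp: mem_TQ_dom)
    qed
    also have "\<dots> = (\<Sum>b\<in>Basis. Z (\<lambda>w. snd w (?x b) * ?d b f (fst w)))"
      by (intro T.tangent_vector_sum[OF Z] T.smooth_near_mult x' df')
    also have "\<dots> = (\<Sum>b\<in>Basis. snd u (?x b) * Y (fst u) (?d b f) + snd u (\<lambda>q. Y q (?x b)) * ?d b f (fst u))"
      by (intro sum.cong refl) (simp add: T.tangent_vector_mult[OF Z x' df'] base[OF df] coord)
    also have "\<dots> = (\<Sum>b\<in>Basis. snd u (?x b) * Y (fst u) (?d b f)) + (\<Sum>b\<in>Basis. snd u (\<lambda>q. Y q (?x b)) * ?d b f (fst u))"
      by (rule sum.distrib)
    also have "(\<Sum>b\<in>Basis. snd u (?x b) * Y (fst u) (?d b f)) = (\<Sum>b\<in>Basis. Y (fst u) (?x b) * snd u (?d b f))"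
    proof -
      have "(\<Sum>b\<in>Basis. snd u (?x b) * Y (fst u) (?d b f)) =
          (\<Sum>b\<in>Basis. \<Sum>c\<in>Basis. snd u (?x b) * (Y (fst u) (?x c) * ?d c (?d b f) (fst u)))"
        unfolding tangent_vector_expand[OF Yq c, of "?d _ f"] sum_distrib_left ..
      also have "\<dots> = (\<Sum>c\<in>Basis. \<Sum>b\<in>Basis. snd u (?x b) * (Y (fst u) (?x c) * ?d c (?d b f) (fst u)))"
        by (rule sum.swap)
      also have "\<dots> = (\<Sum>c\<in>Basis. \<Sum>b\<in>Basis. Y (fst u) (?x c) * (snd u (?x b) * ?d b (?d c f) (fst u)))"
        by (intro sum.cong refl) (simp add: chart_tvec_commute[OF f c, of _ _])
      also have "\<dots> = (\<Sum>c\<in>Basis. Y (fst u) (?x c) * snd u (?d c f))"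
        unfolding tangent_vector_expand[OF v c, of "?d _ f"] sum_distrib_left ..
      finally show ?thesis .
    qed
    also have "(\<Sum>b\<in>Basis. Y (fst u) (?x b) * snd u (?d b f)) + (\<Sum>b\<in>Basis. snd u (\<lambda>q. Y q (?x b)) * ?d b f (fst u)) =
        (\<Sum>b\<in>Basis. snd u (\<lambda>q. Y q (?x b) * ?d b f q))"
      by (simp add: tangent_vector_mult[OF v Yx df] sum.distrib)
    also have "\<dots> = snd u (\<lambda>q. \<Sum>b\<in>Basis. Y q (?x b) * ?d b f q)"
      by (rule tangent_vector_sum[OF v, symmetric]) (intro smooth_near_mult Yx df)
    also have "\<dots> = snd u (\<lambda>q. Y q f)"
    proof (rule tangent_vector_cong[OF v c open_UNIV UNIV_I])
      show "(\<Sum>b\<in>Basis. Y q (?x b) * ?d b f q) = Y q f" if "q \<in> U" for q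
        using that c by (intro tangent_vector_expand[OF vector_field_tangent[OF Y] c(1), symmetric])
          (auto simp: in_carrier_of)
    qed
    finally show ?thesis .
  qed
  with Z base show ?thesis by blast
qed

lemma
  assumes Y: "vector_field \<A> Y" and u: "u \<in> carrier_of (TQ \<A>)"
  shows clift_tangent: "clift \<A> Y u \<in> tangent_space (TQ \<A>) u"
    and clift_base: "smooth_near \<A> (fst u) f \<Longrightarrow> clift \<A> Y u (\<lambda>w. f (fst w)) = Y (fst u) f"
    and clift_fibre_linear: "smooth_near \<A> (fst u) f \<Longrightarrow> clift \<A> Y u (\<lambda>w. snd w f) = snd u (\<lambda>q. Y q f)"
proof -
  let ?P = "\<lambda>Z. Z \<in> tangent_space (TQ \<A>) u \<and>
    (\<forall>f. smooth_near \<A> (fst u) f \<longrightarrow>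
      Z (\<lambda>w. f (fst w)) = Y (fst u) f \<and> Z (\<lambda>w. snd w f) = snd u (\<lambda>q. Y q f))"
  have "\<exists>!Z. ?P Z"
  proof (rule ex_ex1I[OF clift_exists[OF Y u]])
    show "Z = W" if "?P Z" "?P W" for Z W
      using that by (intro TQ_tangent_vector_eqI) auto
  qed
  from theI'[OF this] have "?P (clift \<A> Y u)"
    using u by (simp add: clift_def)
  then show "clift \<A> Y u \<in> tangent_space (TQ \<A>) u"
    and "smooth_near \<A> (fst u) f \<Longrightarrow> clift \<A> Y u (\<lambda>w. f (fst w)) = Y (fst u) f"
    and "smooth_near \<A> (fst u) f \<Longrightarrow> clift \<A> Y u (\<lambda>w. snd w f) = snd u (\<lambda>q. Y q f)"
    by blast+
qed

lemma clift_off_carrier: "u \<notin> carrier_of (TQ \<A>) \<Longrightarrow> clift \<A> Y u = (\<lambda>f. 0)"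
  by (simp add: clift_def)

lemma vector_field_clift:
  assumes Y: "vector_field \<A> Y"
  shows "vector_field (TQ \<A>) (clift \<A> Y)"
proof (rule TQ_vector_fieldI[OF clift_tangent[OF Y]])
  fix U \<phi> u and b :: "real ^ 'n" assume c: "(U, \<phi>) \<in> \<A>" and u: "u \<in> TQ_dom \<A> U"
  have u': "u \<in> carrier_of (TQ \<A>)" and q: "fst u \<in> U"
    using u by (simp_all add: carrier_TQ mem_TQ_dom)
  note Yx = vector_field_smooth[OF Y smooth_near_coord[OF c q]]
  show "smooth_near (TQ \<A>) u (\<lambda>w. clift \<A> Y w (\<lambda>r. \<phi> (fst r) \<bullet> b))"
  proof (rule T.smooth_near_cong_chart[OF smooth_near_TQ_base[OF u' Yx] TQ_memI[OF c] u])
    show "Y (fst w) (\<lambda>s. \<phi> s \<bullet> b) = clift \<A> Y w (\<lambda>r. \<phi> (fst r) \<bullet> b)" if "w \<in> TQ_dom \<A> U" for w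
      using that by (intro clift_base[OF Y, symmetric] smooth_near_coord[OF c]) (auto simp: carrier_TQ mem_TQ_dom)
  qed
  show "smooth_near (TQ \<A>) u (\<lambda>w. clift \<A> Y w (\<lambda>r. snd r (\<lambda>s. \<phi> s \<bullet> b)))"
  proof (rule T.smooth_near_cong_chart[OF smooth_near_TQ_fibre_linear[OF u' Yx] TQ_memI[OF c] u])
    show "snd w (\<lambda>q. Y q (\<lambda>s. \<phi> s \<bullet> b)) = clift \<A> Y w (\<lambda>r. snd r (\<lambda>s. \<phi> s \<bullet> b))" if "w \<in> TQ_dom \<A> U" for w
      using that by (intro clift_fibre_linear[OF Y, symmetric] smooth_near_coord[OF c]) (auto simp: carrier_TQ mem_TQ_dom)
  qed
qed (simp_all add: clift_off_carrier)

end

section \<open>Frames and second order fields\<close>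

locale framed_manifold = tangent_bundle \<A> for \<A> :: "('q, real ^ 'n::finite) atlas" +
  fixes X :: "'n \<Rightarrow> 'q \<Rightarrow> 'q tvec"
  assumes frame_field: "vector_field \<A> (X \<alpha>)"
    and frame_unique: "v \<in> tangent_space \<A> q \<Longrightarrow> \<exists>!c. v = (\<lambda>f. \<Sum>\<alpha>\<in>UNIV. c \<alpha> * X \<alpha> q f)"
begin

lemma frame_tangent: "q \<in> carrier_of \<A> \<Longrightarrow> X \<alpha> q \<in> tangent_space \<A> q"
  by (rule vector_field_tangent[OF frame_field])

lemma frame_combination_tangent:
  "q \<in> carrier_of \<A> \<Longrightarrow> (\<lambda>f. \<Sum>\<alpha>\<in>I. c \<alpha> * X \<alpha> q f) \<in> tangent_space \<A> q"
  by (intro tangent_space_sum frame_tangent)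

lemma frame_coeff_combination:
  assumes "q \<in> carrier_of \<A>" "v = (\<lambda>f. \<Sum>\<alpha>\<in>UNIV. c \<alpha> * X \<alpha> q f)"
  shows "frame_coeff X q v = c"
  unfolding frame_coeff_def
  using frame_unique[of v q] frame_combination_tangent[OF assms(1), where I = UNIV and c = c] assms(2)
  by (intro the1_equality) auto

lemma frame_coeff_expand:
  assumes "v \<in> tangent_space \<A> q"
  shows "v f = (\<Sum>\<alpha>\<in>UNIV. frame_coeff X q v \<alpha> * X \<alpha> q f)"
proof -
  have "v = (\<lambda>f. \<Sum>\<alpha>\<in>UNIV. frame_coeff X q v \<alpha> * X \<alpha> q f)"
    unfolding frame_coeff_def by (rule theI'[OF frame_unique[OF assms]])
  then show ?thesis
    by (rule fun_cong)
qed

lemma frame_components_injective: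
  assumes c: "(U, \<phi>) \<in> \<A>" "q \<in> U" and z: "\<And>j. (\<Sum>\<alpha>\<in>UNIV. X \<alpha> q (\<lambda>p. \<phi> p $ j) * z \<alpha>) = 0"
  shows "z = (\<lambda>_. 0)"
proof -
  have q: "q \<in> carrier_of \<A>"
    using c by (auto simp: in_carrier_of)
  have "(\<lambda>f. \<Sum>\<alpha>\<in>UNIV. z \<alpha> * X \<alpha> q f) = (\<lambda>f. \<Sum>\<alpha>\<in>UNIV. 0 * X \<alpha> q f)"
  proof (rule tangent_vector_eqI[OF frame_combination_tangent[OF q] frame_combination_tangent[OF q] c])
    show "(\<Sum>\<alpha>\<in>UNIV. z \<alpha> * X \<alpha> q (\<lambda>p. \<phi> p \<bullet> b)) = (\<Sum>\<alpha>\<in>UNIV. 0 * X \<alpha> q (\<lambda>p. \<phi> p \<bullet> b))"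
      if "b \<in> Basis" for b
      using that z by (auto simp: Basis_vec_def inner_axis mult.commute)
  qed
  then have "frame_coeff X q (\<lambda>f. \<Sum>\<alpha>\<in>UNIV. z \<alpha> * X \<alpha> q f) = (\<lambda>_. 0)"
    by (intro frame_coeff_combination[OF q])
  then show ?thesis
    using frame_coeff_combination[OF q refl] by simp
qed

lemma smooth_near_component: "(U, \<phi>) \<in> \<A> \<Longrightarrow> q \<in> U \<Longrightarrow> smooth_near \<A> q (\<lambda>p. \<phi> p $ j)"
  using smooth_near_coord[of U \<phi> q "axis j 1"] by (simp add: inner_axis)

lemma smooth_near_frame_coeff:
  assumes Y: "vector_field \<A> Y" and q: "q \<in> carrier_of \<A>"
  shows "smooth_near \<A> q (\<lambda>r. frame_coeff X r (Y r) \<alpha>)"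
proof -
  obtain U \<phi> where c: "(U, \<phi>) \<in> \<A>" "q \<in> U"
    using q by (auto simp: in_carrier_of)
  show ?thesis
  proof (rule smooth_near_linear_system[OF c, where M = "\<lambda>j \<alpha> r. X \<alpha> r (\<lambda>p. \<phi> p $ j)"
        and y = "\<lambda>j r. Y r (\<lambda>p. \<phi> p $ j)"])
    show "(\<Sum>\<alpha>\<in>UNIV. X \<alpha> r (\<lambda>p. \<phi> p $ j) * frame_coeff X r (Y r) \<alpha>) = Y r (\<lambda>p. \<phi> p $ j)" if "r \<in> U" for r j
    proof -
      have "r \<in> carrier_of \<A>"
        using that c by (auto simp: in_carrier_of)
      from frame_coeff_expand[OF vector_field_tangent[OF Y this], of "\<lambda>p. \<phi> p $ j"] show ?thesis
        by (simp add: mult.commute)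
    qed
  qed (use frame_components_injective[OF c(1)] vector_field_smooth[OF _ smooth_near_component[OF c]]
      frame_field Y in auto)
qed

lemma smooth_near_qvel:
  assumes u: "u \<in> carrier_of (TQ \<A>)"
  shows "smooth_near (TQ \<A>) u (qvel X \<alpha>)"
proof -
  obtain U \<phi> where c: "(U, \<phi>) \<in> \<A>" "fst u \<in> U" and T: "(TQ_dom \<A> U, TQ_chart \<phi>) \<in> TQ \<A>" "u \<in> TQ_dom \<A> U"
    by (rule carrier_TQ_chart[OF u])
  show ?thesis
  proof (rule T.smooth_near_linear_system[OF T, where M = "\<lambda>j \<alpha> w. X \<alpha> (fst w) (\<lambda>p. \<phi> p $ j)"
        and y = "\<lambda>j w. snd w (\<lambda>p. \<phi> p $ j)"])
    show "(\<Sum>\<alpha>\<in>UNIV. X \<alpha> (fst w) (\<lambda>p. \<phi> p $ j) * qvel X \<alpha> w) = snd w (\<lambda>p. \<phi> p $ j)"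
      if "w \<in> TQ_dom \<A> U" for w j
      using frame_coeff_expand[of "snd w" "fst w" "\<lambda>p. \<phi> p $ j"] that
      by (auto simp: mult.commute mem_TQ_dom qvel_def)
    show "z = (\<lambda>_. 0)" if "w \<in> TQ_dom \<A> U" "\<And>j. (\<Sum>\<alpha>\<in>UNIV. X \<alpha> (fst w) (\<lambda>p. \<phi> p $ j) * z \<alpha>) = 0" for w z
      using frame_components_injective[OF c(1)] that by (auto simp: mem_TQ_dom)
    show "smooth_near (TQ \<A>) u (\<lambda>w. X \<alpha> (fst w) (\<lambda>p. \<phi> p $ j))" for j \<alpha>
      by (rule smooth_near_TQ_base[OF u vector_field_smooth[OF frame_field smooth_near_component[OF c]]])
    show "smooth_near (TQ \<A>) u (\<lambda>w. snd w (\<lambda>p. \<phi> p $ j))" for j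
      by (rule smooth_near_TQ_fibre_linear[OF u smooth_near_component[OF c]])
  qed
qed

lemma velocity_expand:
  "u \<in> carrier_of (TQ \<A>) \<Longrightarrow> snd u f = (\<Sum>\<alpha>\<in>UNIV. qvel X \<alpha> u * X \<alpha> (fst u) f)"
  unfolding qvel_def by (rule frame_coeff_expand) (simp add: carrier_TQ)

lemma carrier_TQ_fst: "u \<in> carrier_of (TQ \<A>) \<Longrightarrow> fst u \<in> carrier_of \<A>"
  using carrier_TQ tangent_space_carrier by blast

text \<open>The fibrewise linear functions are combinations of the quasi-velocities with coefficients from the base,
  which reduces all computations on the tangent bundle to the quasi-velocities.\<close>

lemma fibre_linear_derivative:
  assumes Z: "Z \<in> tangent_space (TQ \<A>) u" and f: "smooth_near \<A> (fst u) f"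
  shows "Z (\<lambda>w. snd w f) =
    (\<Sum>\<alpha>\<in>UNIV. qvel X \<alpha> u * Z (\<lambda>w. X \<alpha> (fst w) f) + Z (qvel X \<alpha>) * X \<alpha> (fst u) f)"
proof -
  note u = T.tangent_space_carrier[OF Z]
  note Xf = smooth_near_TQ_base[OF u vector_field_smooth[OF frame_field f]]
  have "Z (\<lambda>w. snd w f) = Z (\<lambda>w. \<Sum>\<alpha>\<in>UNIV. qvel X \<alpha> w * X \<alpha> (fst w) f)"
    by (rule T.tangent_vector_cong_carrier[OF Z velocity_expand])
  also have "\<dots> = (\<Sum>\<alpha>\<in>UNIV. Z (\<lambda>w. qvel X \<alpha> w * X \<alpha> (fst w) f))"
    by (intro T.tangent_vector_sum[OF Z] T.smooth_near_mult smooth_near_qvel[OF u] Xf)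
  also have "\<dots> = (\<Sum>\<alpha>\<in>UNIV. qvel X \<alpha> u * Z (\<lambda>w. X \<alpha> (fst w) f) + Z (qvel X \<alpha>) * X \<alpha> (fst u) f)"
    by (intro sum.cong refl T.tangent_vector_mult[OF Z smooth_near_qvel[OF u] Xf])
  finally show ?thesis .
qed

lemma tangent_frame_coeffI:
  assumes q: "q \<in> carrier_of \<A>" and v: "\<And>f. \<not> smooth_near \<A> q f \<Longrightarrow> v f = 0"
    and eq: "\<And>f. smooth_near \<A> q f \<Longrightarrow> v f = (\<Sum>\<alpha>\<in>UNIV. c \<alpha> * X \<alpha> q f)"
  shows "v = (\<lambda>f. \<Sum>\<alpha>\<in>UNIV. c \<alpha> * X \<alpha> q f)"
proof
  show "v f = (\<Sum>\<alpha>\<in>UNIV. c \<alpha> * X \<alpha> q f)" for f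
    using v eq tangent_vector_nonsmooth[OF frame_combination_tangent[OF q]] by metis
qed

lemma vlift_qvel:
  assumes u: "u \<in> carrier_of (TQ \<A>)" and Y: "Y (fst u) \<in> tangent_space \<A> (fst u)"
  shows "vlift \<A> Y u (qvel X \<alpha>) = frame_coeff X (fst u) (Y (fst u)) \<alpha>"
proof -
  have "Y (fst u) = (\<lambda>f. \<Sum>\<alpha>\<in>UNIV. vlift \<A> Y u (qvel X \<alpha>) * X \<alpha> (fst u) f)"
  proof (rule tangent_frame_coeffI[OF carrier_TQ_fst[OF u] tangent_vector_nonsmooth[OF Y]])
    show "Y (fst u) f = (\<Sum>\<alpha>\<in>UNIV. vlift \<A> Y u (qvel X \<alpha>) * X \<alpha> (fst u) f)" if f: "smooth_near \<A> (fst u) f" for f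
      using fibre_linear_derivative[OF vlift_tangent[where Y = Y, OF u Y] f] vlift_fibre_linear[OF u f, of Y]
        vlift_base[of Y u "\<lambda>q. X _ q f"] by simp
  qed
  from frame_coeff_combination[OF carrier_TQ_fst[OF u] this] show ?thesis
    by simp
qed

lemma frame_coeff_frame: "q \<in> carrier_of \<A> \<Longrightarrow> frame_coeff X q (X \<beta> q) = (\<lambda>\<alpha>. if \<alpha> = \<beta> then 1 else 0)"
  by (rule frame_coeff_combination) (simp_all add: if_distrib[of "\<lambda>x. x * _"] cong: if_cong)

lemma vlift_frame_qvel:
  "u \<in> carrier_of (TQ \<A>) \<Longrightarrow> vlift \<A> (X \<beta>) u (qvel X \<alpha>) = (if \<alpha> = \<beta> then 1 else 0)"
  using vlift_qvel[of u "X \<beta>"] frame_tangent[OF carrier_TQ_fst] frame_coeff_frame[OF carrier_TQ_fst] by simp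

text \<open>The complete lift computes the structure functions: at the tangent vector \<open>X\<^bsub>\<gamma>\<^esub>(q)\<close> the
  numbers \<open>X\<^bsub>\<alpha>\<^esub>\<^sup>C(v\<^sup>\<beta>)\<close> are the components of the bracket. In particular the bracket is a tangent
  vector.\<close>

lemma lie_bracket_frame:
  assumes q: "q \<in> carrier_of \<A>"
  shows "lie_bracket \<A> (X \<gamma>) (X \<alpha>) q = (\<lambda>f. \<Sum>\<beta>\<in>UNIV. clift \<A> (X \<alpha>) (q, X \<gamma> q) (qvel X \<beta>) * X \<beta> q f)"
proof (rule tangent_frame_coeffI[OF q])
  let ?u = "(q, X \<gamma> q)"
  have u: "?u \<in> carrier_of (TQ \<A>)"
    by (simp add: carrier_TQ frame_tangent[OF q])
  show "lie_bracket \<A> (X \<gamma>) (X \<alpha>) q f = (\<Sum>\<beta>\<in>UNIV. clift \<A> (X \<alpha>) ?u (qvel X \<beta>) * X \<beta> q f)"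
    if f: "smooth_near \<A> q f" for f
  proof -
    have "X \<gamma> q (\<lambda>r. X \<alpha> r f) = (\<Sum>\<beta>\<in>UNIV. (if \<beta> = \<gamma> then 1 else 0) * X \<alpha> q (\<lambda>r. X \<beta> r f)
        + clift \<A> (X \<alpha>) ?u (qvel X \<beta>) * X \<beta> q f)"
      using fibre_linear_derivative[OF clift_tangent[OF frame_field u], of f \<alpha>] f
        clift_fibre_linear[OF frame_field u, of f \<alpha>]
        clift_base[OF frame_field u, of "\<lambda>r. X _ r f" \<alpha>] vector_field_smooth[OF frame_field f]
      by (simp add: qvel_def frame_coeff_frame[OF q])
    then show ?thesis
      using f by (simp add: lie_bracket_def sum.distrib if_distrib[of "\<lambda>x. x * _"] cong: if_cong)
  qed
qed (simp add: lie_bracket_def)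

lemma lie_bracket_frame_expand:
  assumes "smooth_near \<A> q f"
  shows "X \<gamma> q (\<lambda>r. X \<alpha> r f) - X \<alpha> q (\<lambda>r. X \<gamma> r f) = (\<Sum>\<beta>\<in>UNIV. struct_fun \<A> X \<beta> \<gamma> \<alpha> q * X \<beta> q f)"
proof -
  note q = smooth_near_imp_carrier[OF assms]
  have "lie_bracket \<A> (X \<gamma>) (X \<alpha>) q \<in> tangent_space \<A> q"
    unfolding lie_bracket_frame[OF q] by (rule frame_combination_tangent[OF q])
  from frame_coeff_expand[OF this, of f] show ?thesis
    using assms by (simp add: struct_fun_def lie_bracket_def)
qed

lemma struct_fun_antisym:
  assumes q: "q \<in> carrier_of \<A>"
  shows "struct_fun \<A> X \<gamma> \<alpha> \<beta> q = - struct_fun \<A> X \<gamma> \<beta> \<alpha> q"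
proof -
  have "lie_bracket \<A> (X \<alpha>) (X \<beta>) q = (\<lambda>f. \<Sum>\<gamma>\<in>UNIV. - struct_fun \<A> X \<gamma> \<beta> \<alpha> q * X \<gamma> q f)"
  proof (rule tangent_frame_coeffI[OF q])
    show "lie_bracket \<A> (X \<alpha>) (X \<beta>) q f = (\<Sum>\<gamma>\<in>UNIV. - struct_fun \<A> X \<gamma> \<beta> \<alpha> q * X \<gamma> q f)"
      if "smooth_near \<A> q f" for f
      using lie_bracket_frame_expand[OF that, of \<beta> \<alpha>] that by (simp add: lie_bracket_def sum_negf)
  qed (simp add: lie_bracket_def)
  from frame_coeff_combination[OF q this] show ?thesis
    by (simp add: struct_fun_def)
qed

lemma smooth_near_struct_fun:
  assumes q: "q \<in> carrier_of \<A>"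
  shows "smooth_near \<A> q (struct_fun \<A> X \<gamma> \<alpha> \<beta>)"
proof -
  have "vector_field \<A> (lie_bracket \<A> (X \<alpha>) (X \<beta>))"
  proof (rule vector_fieldI)
    show "lie_bracket \<A> (X \<alpha>) (X \<beta>) p \<in> tangent_space \<A> p" if "p \<in> carrier_of \<A>" for p
      unfolding lie_bracket_frame[OF that] by (rule frame_combination_tangent[OF that])
    show "lie_bracket \<A> (X \<alpha>) (X \<beta>) p = (\<lambda>f. 0)" if "p \<notin> carrier_of \<A>" for p
      using that smooth_near_imp_carrier[of \<A> p] by (auto simp: lie_bracket_def fun_eq_iff)
    fix U \<phi> p and b :: "real ^ 'n" assume c: "(U, \<phi>) \<in> \<A>" "p \<in> U"
    note x = smooth_near_coord[OF c, of b]
    have "smooth_near \<A> p (\<lambda>q. X \<alpha> q (\<lambda>r. X \<beta> r (\<lambda>s. \<phi> s \<bullet> b)) - X \<beta> q (\<lambda>r. X \<alpha> r (\<lambda>s. \<phi> s \<bullet> b)))"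
      by (intro smooth_near_diff vector_field_smooth[OF frame_field vector_field_smooth[OF frame_field x]])
    then show "smooth_near \<A> p (\<lambda>q. lie_bracket \<A> (X \<alpha>) (X \<beta>) q (\<lambda>s. \<phi> s \<bullet> b))"
      by (rule smooth_near_cong_chart[OF _ c]) (simp add: lie_bracket_def smooth_near_coord[OF c(1)])
  qed
  from smooth_near_frame_coeff[OF this q] show ?thesis
    unfolding struct_fun_def .
qed

text \<open>Apply the complete lift to \<open>v(f) = v\<^sup>\<gamma> X\<^bsub>\<gamma>\<^esub>(f)\<close>: its value \<open>v\<^sup>\<gamma> X\<^bsub>\<gamma>\<^esub>(X\<^bsub>\<alpha>\<^esub> f)\<close> differs from the term
  \<open>v\<^sup>\<gamma> X\<^bsub>\<alpha>\<^esub>(X\<^bsub>\<gamma>\<^esub> f)\<close> of the product rule by a bracket, and the remainder \<open>X\<^bsub>\<alpha>\<^esub>\<^sup>C(v\<^sup>\<beta>) X\<^bsub>\<beta>\<^esub>(f)\<close> accounts for it.\<close>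

lemma clift_frame_qvel:
  assumes u: "u \<in> carrier_of (TQ \<A>)"
  shows "clift \<A> (X \<alpha>) u (qvel X \<beta>) = (\<Sum>\<gamma>\<in>UNIV. qvel X \<gamma> u * struct_fun \<A> X \<beta> \<gamma> \<alpha> (fst u))"
proof -
  let ?C = "clift \<A> (X \<alpha>) u" and ?R = "\<lambda>\<beta>. \<Sum>\<gamma>\<in>UNIV. qvel X \<gamma> u * struct_fun \<A> X \<beta> \<gamma> \<alpha> (fst u)"
  note q = carrier_TQ_fst[OF u]
  have "(\<lambda>f. \<Sum>\<beta>\<in>UNIV. ?R \<beta> * X \<beta> (fst u) f) = (\<lambda>f. \<Sum>\<beta>\<in>UNIV. ?C (qvel X \<beta>) * X \<beta> (fst u) f)"
  proof (rule tangent_frame_coeffI[OF q tangent_vector_nonsmooth[OF frame_combination_tangent[OF q]]])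
    fix f assume f: "smooth_near \<A> (fst u) f"
    note Xf = vector_field_smooth[OF frame_field f]
    have "(\<Sum>\<beta>\<in>UNIV. ?R \<beta> * X \<beta> (fst u) f) =
        (\<Sum>\<gamma>\<in>UNIV. qvel X \<gamma> u * (\<Sum>\<beta>\<in>UNIV. struct_fun \<A> X \<beta> \<gamma> \<alpha> (fst u) * X \<beta> (fst u) f))"
      unfolding sum_distrib_left sum_distrib_right by (subst sum.swap) (simp add: mult.assoc)
    also have "\<dots> = (\<Sum>\<gamma>\<in>UNIV. qvel X \<gamma> u * X \<gamma> (fst u) (\<lambda>r. X \<alpha> r f)) -
        (\<Sum>\<gamma>\<in>UNIV. qvel X \<gamma> u * X \<alpha> (fst u) (\<lambda>r. X \<gamma> r f))"
      unfolding lie_bracket_frame_expand[OF f, symmetric] by (simp add: right_diff_distrib sum_subtractf)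
    also have "(\<Sum>\<gamma>\<in>UNIV. qvel X \<gamma> u * X \<gamma> (fst u) (\<lambda>r. X \<alpha> r f)) = ?C (\<lambda>w. snd w f)"
      by (simp add: clift_fibre_linear[OF frame_field u f] velocity_expand[OF u])
    also have "\<dots> = (\<Sum>\<gamma>\<in>UNIV. qvel X \<gamma> u * X \<alpha> (fst u) (\<lambda>r. X \<gamma> r f) + ?C (qvel X \<gamma>) * X \<gamma> (fst u) f)"
      unfolding fibre_linear_derivative[OF clift_tangent[OF frame_field u] f]
      by (simp add: clift_base[OF frame_field u Xf])
    finally show "(\<Sum>\<beta>\<in>UNIV. ?R \<beta> * X \<beta> (fst u) f) = (\<Sum>\<beta>\<in>UNIV. ?C (qvel X \<beta>) * X \<beta> (fst u) f)"
      by (simp add: sum.distrib)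
  qed
  from frame_coeff_combination[OF q this] frame_coeff_combination[OF q refl, of ?R]
  show ?thesis
    by (simp add: fun_eq_iff)
qed

end

definition second_order_field ::
  "('q, real ^ 'n::finite) atlas \<Rightarrow> ('n \<Rightarrow> 'q \<Rightarrow> 'q tvec) \<Rightarrow> ('n \<Rightarrow> 'q tbundle \<Rightarrow> real)
    \<Rightarrow> 'q tbundle \<Rightarrow> 'q tbundle tvec" where
  "second_order_field \<A> X F =
     (\<lambda>u h. \<Sum>\<alpha>\<in>UNIV. qvel X \<alpha> u * clift \<A> (X \<alpha>) u h + F \<alpha> u * vlift \<A> (X \<alpha>) u h)"

text \<open>The pointwise notion also covers the nonholonomic field, which lives on the constraint manifold only.\<close>

definition second_order_at ::
  "('q, real ^ 'n::finite) atlas \<Rightarrow> 'q tbundle \<Rightarrow> 'q tbundle tvec \<Rightarrow> bool" where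
  "second_order_at \<A> u Z \<longleftrightarrow> Z \<in> tangent_space (TQ \<A>) u \<and>
     (\<forall>f. smooth_near \<A> (fst u) f \<longrightarrow> Z (\<lambda>w. f (fst w)) = snd u f)"

text \<open>For the kinetic energy of a metric and along a second order vector this is the covariant
  acceleration paired with \<open>Y\<close>.\<close>

definition euler_lagrange ::
  "('q, real ^ 'n::finite) atlas \<Rightarrow> ('q tbundle \<Rightarrow> real) \<Rightarrow> 'q tbundle tvec \<Rightarrow> ('q \<Rightarrow> 'q tvec)
    \<Rightarrow> 'q tbundle \<Rightarrow> real" where
  "euler_lagrange \<A> L Z Y u = Z (\<lambda>w. vlift \<A> Y w L) - clift \<A> Y u L"

context framed_manifold
begin

lemma vlift_frame_tangent:
  "u \<in> carrier_of (TQ \<A>) \<Longrightarrow> vlift \<A> (X \<alpha>) u \<in> tangent_space (TQ \<A>) u"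
  by (rule T.vector_field_tangent[OF vector_field_vlift[OF frame_field]])

lemma second_order_field_tangent:
  assumes u: "u \<in> carrier_of (TQ \<A>)"
  shows "second_order_field \<A> X F u \<in> tangent_space (TQ \<A>) u"
  using T.tangent_space_lin2[OF
      T.tangent_space_sum[where I = UNIV and c = "\<lambda>\<alpha>. qvel X \<alpha> u", OF u clift_tangent[OF frame_field u]]
      T.tangent_space_sum[where I = UNIV and c = "\<lambda>\<alpha>. F \<alpha> u", OF u vlift_frame_tangent[OF u]], where a = 1 and b = 1]
  by (simp add: second_order_field_def sum.distrib)

lemma second_order_field_off_carrier:
  "u \<notin> carrier_of (TQ \<A>) \<Longrightarrow> second_order_field \<A> X F u = (\<lambda>h. 0)"
  by (simp add: second_order_field_def clift_off_carrier vlift_off_carrier)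

lemma second_order_field_at:
  assumes u: "u \<in> carrier_of (TQ \<A>)"
  shows "second_order_at \<A> u (second_order_field \<A> X F u)"
  unfolding second_order_at_def
proof (intro conjI allI impI second_order_field_tangent[OF u])
  fix f assume f: "smooth_near \<A> (fst u) f"
  show "second_order_field \<A> X F u (\<lambda>w. f (fst w)) = snd u f"
    by (simp add: second_order_field_def vlift_base clift_base[OF frame_field u f] velocity_expand[OF u])
qed

text \<open>\<open>v\<^sup>\<alpha> X\<^bsub>\<alpha>\<^esub>\<^sup>C\<close> annihilates the quasi-velocities: \<open>v\<^sup>\<alpha> v\<^sup>\<gamma> R\<^sup>\<beta>\<^bsub>\<gamma>\<alpha>\<^esub> = 0\<close> because \<open>R\<close> is antisymmetric.\<close>

lemma quadratic_struct_fun: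
  assumes q: "q \<in> carrier_of \<A>"
  shows "(\<Sum>\<alpha>\<in>UNIV. v \<alpha> * (\<Sum>\<gamma>\<in>UNIV. v \<gamma> * struct_fun \<A> X \<beta> \<gamma> \<alpha> q)) = 0"
proof -
  let ?s = "\<Sum>\<alpha>\<in>UNIV. \<Sum>\<gamma>\<in>UNIV. v \<alpha> * (v \<gamma> * struct_fun \<A> X \<beta> \<gamma> \<alpha> q)"
  have "?s = (\<Sum>\<alpha>\<in>UNIV. \<Sum>\<gamma>\<in>UNIV. v \<gamma> * (v \<alpha> * struct_fun \<A> X \<beta> \<alpha> \<gamma> q))"
    by (rule sum.swap)
  also have "\<dots> = (\<Sum>\<alpha>\<in>UNIV. \<Sum>\<gamma>\<in>UNIV. - (v \<alpha> * (v \<gamma> * struct_fun \<A> X \<beta> \<gamma> \<alpha> q)))"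
    by (intro sum.cong refl) (subst struct_fun_antisym[OF q], simp)
  also have "\<dots> = - ?s"
    by (simp add: sum_negf)
  finally have "?s = 0"
    by simp
  then show ?thesis
    by (simp add: sum_distrib_left)
qed

lemma second_order_field_qvel:
  assumes u: "u \<in> carrier_of (TQ \<A>)"
  shows "second_order_field \<A> X F u (qvel X \<beta>) = F \<beta> u"
proof -
  have "second_order_field \<A> X F u (qvel X \<beta>) =
      (\<Sum>\<alpha>\<in>UNIV. qvel X \<alpha> u * (\<Sum>\<gamma>\<in>UNIV. qvel X \<gamma> u * struct_fun \<A> X \<beta> \<gamma> \<alpha> (fst u)))
      + (\<Sum>\<alpha>\<in>UNIV. F \<alpha> u * (if \<beta> = \<alpha> then 1 else 0))"
    by (simp add: second_order_field_def clift_frame_qvel[OF u] vlift_frame_qvel[OF u] sum.distrib)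
  then show ?thesis
    by (simp add: quadratic_struct_fun[OF carrier_TQ_fst[OF u]] if_distrib[of "\<lambda>x. _ * x"] cong: if_cong)
qed

lemma sode_iff:
  "sode \<A> X \<Gamma> \<longleftrightarrow>
    (\<exists>F. (\<forall>\<alpha>. smooth_fun (TQ \<A>) (F \<alpha>)) \<and> \<Gamma> = second_order_field \<A> X F)"
proof -
  have "vector_field (TQ \<A>) (second_order_field \<A> X F)" if F: "\<And>\<alpha>. smooth_fun (TQ \<A>) (F \<alpha>)" for F
  proof -
    have "vector_field (TQ \<A>) (\<lambda>u h. \<Sum>\<alpha>\<in>UNIV. qvel X \<alpha> u * clift \<A> (X \<alpha>) u h)"
      by (intro T.vector_field_sum vector_field_clift frame_field smooth_near_qvel)
    moreover have "vector_field (TQ \<A>) (\<lambda>u h. \<Sum>\<alpha>\<in>UNIV. F \<alpha> u * vlift \<A> (X \<alpha>) u h)"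
      using F by (intro T.vector_field_sum vector_field_vlift frame_field) (auto simp: smooth_fun_def)
    ultimately show ?thesis
      using T.vector_field_lin2[of _ _ "\<lambda>_. 1" "\<lambda>_. 1"] T.smooth_near_const
      by (simp add: second_order_field_def sum.distrib)
  qed
  then show ?thesis
    unfolding sode_def second_order_field_def[symmetric] by auto
qed

lemma vlift_expand:
  assumes u: "u \<in> carrier_of (TQ \<A>)" and Y: "Y (fst u) \<in> tangent_space \<A> (fst u)"
  shows "vlift \<A> Y u h = (\<Sum>\<alpha>\<in>UNIV. frame_coeff X (fst u) (Y (fst u)) \<alpha> * vlift \<A> (X \<alpha>) u h)"
proof -
  have "vlift \<A> Y u = (\<lambda>h. \<Sum>\<alpha>\<in>UNIV. frame_coeff X (fst u) (Y (fst u)) \<alpha> * vlift \<A> (X \<alpha>) u h)"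
  proof (rule TQ_tangent_vector_eqI[OF vlift_tangent[where Y = Y, OF u Y]
        T.tangent_space_sum[OF u vlift_frame_tangent[OF u]]])
    show "vlift \<A> Y u (\<lambda>w. snd w f) = (\<Sum>\<alpha>\<in>UNIV. frame_coeff X (fst u) (Y (fst u)) \<alpha> * vlift \<A> (X \<alpha>) u (\<lambda>w. snd w f))"
      if "smooth_near \<A> (fst u) f" for f
      using frame_coeff_expand[OF Y] by (simp add: vlift_fibre_linear[OF u that])
  qed (simp add: vlift_base)
  then show ?thesis
    by (rule fun_cong)
qed

lemma clift_expand:
  assumes Y: "vector_field \<A> Y" and u: "u \<in> carrier_of (TQ \<A>)"
  shows "clift \<A> Y u h = (\<Sum>\<alpha>\<in>UNIV. frame_coeff X (fst u) (Y (fst u)) \<alpha> * clift \<A> (X \<alpha>) u h)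
    + (\<Sum>\<alpha>\<in>UNIV. snd u (\<lambda>q. frame_coeff X q (Y q) \<alpha>) * vlift \<A> (X \<alpha>) u h)"
proof -
  note q = carrier_TQ_fst[OF u]
  have v: "snd u \<in> tangent_space \<A> (fst u)"
    using u by (simp add: carrier_TQ)
  let ?y = "\<lambda>\<alpha> q. frame_coeff X q (Y q) \<alpha>"
  let ?W = "\<lambda>h. (\<Sum>\<alpha>\<in>UNIV. ?y \<alpha> (fst u) * clift \<A> (X \<alpha>) u h) + (\<Sum>\<alpha>\<in>UNIV. snd u (?y \<alpha>) * vlift \<A> (X \<alpha>) u h)"
  have "?W \<in> tangent_space (TQ \<A>) u"
    using T.tangent_space_lin2[OF
        T.tangent_space_sum[where I = UNIV and c = "\<lambda>\<alpha>. ?y \<alpha> (fst u)", OF u clift_tangent[OF frame_field u]]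
        T.tangent_space_sum[where I = UNIV and c = "\<lambda>\<alpha>. snd u (?y \<alpha>)", OF u vlift_frame_tangent[OF u]], where a = 1 and b = 1]
    by simp
  then have "clift \<A> Y u = ?W"
  proof (rule TQ_tangent_vector_eqI[OF clift_tangent[OF Y u]])
    fix f assume f: "smooth_near \<A> (fst u) f"
    show "clift \<A> Y u (\<lambda>w. f (fst w)) = ?W (\<lambda>w. f (fst w))"
      using frame_coeff_expand[OF vector_field_tangent[OF Y q]]
      by (simp add: clift_base[OF Y u f] clift_base[OF frame_field u f] vlift_base)
    note Xf = vector_field_smooth[OF frame_field f] and y = smooth_near_frame_coeff[OF Y q]
    have "clift \<A> Y u (\<lambda>w. snd w f) = snd u (\<lambda>q. Y q f)"
      by (rule clift_fibre_linear[OF Y u f])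
    also have "\<dots> = snd u (\<lambda>q. \<Sum>\<alpha>\<in>UNIV. ?y \<alpha> q * X \<alpha> q f)"
      by (rule tangent_vector_cong_carrier[OF v frame_coeff_expand[OF vector_field_tangent[OF Y]]])
    also have "\<dots> = (\<Sum>\<alpha>\<in>UNIV. snd u (\<lambda>q. ?y \<alpha> q * X \<alpha> q f))"
      by (intro tangent_vector_sum[OF v] smooth_near_mult Xf y)
    also have "\<dots> = ?W (\<lambda>w. snd w f)"
      by (simp add: tangent_vector_mult[OF v y Xf] sum.distrib clift_fibre_linear[OF frame_field u f]
          vlift_fibre_linear[OF u f])
    finally show "clift \<A> Y u (\<lambda>w. snd w f) = ?W (\<lambda>w. snd w f)" .
  qed
  then show ?thesis
    by (rule fun_cong)
qed

text \<open>Along a second order vector the Euler-Lagrange expression is linear over functions of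
  the base: the term \<open>Z(y\<^sup>\<alpha>) X\<^bsub>\<alpha>\<^esub>\<^sup>V(L)\<close> of the product rule cancels against the vertical part of
  \<open>(y\<^sup>\<alpha> X\<^bsub>\<alpha>\<^esub>)\<^sup>C\<close>. Hence it suffices to test the equations on the frame.\<close>

lemma euler_lagrange_expand:
  assumes Z: "second_order_at \<A> u Z" and Y: "vector_field \<A> Y"
    and L: "smooth_fun (TQ \<A>) L"
  shows "euler_lagrange \<A> L Z Y u =
    (\<Sum>\<alpha>\<in>UNIV. frame_coeff X (fst u) (Y (fst u)) \<alpha> * euler_lagrange \<A> L Z (X \<alpha>) u)"
proof -
  have Zt: "Z \<in> tangent_space (TQ \<A>) u" and Zb: "\<And>f. smooth_near \<A> (fst u) f \<Longrightarrow> Z (\<lambda>w. f (fst w)) = snd u f"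
    using Z by (auto simp: second_order_at_def)
  note u = T.tangent_space_carrier[OF Zt]
  let ?y = "\<lambda>\<alpha> q. frame_coeff X q (Y q) \<alpha>"
  note y = smooth_near_frame_coeff[OF Y carrier_TQ_fst[OF u]]
  note y' = smooth_near_TQ_base[OF u y]
  have "smooth_near (TQ \<A>) u L"
    using L u by (simp add: smooth_fun_def)
  note VL = T.vector_field_smooth[OF vector_field_vlift[OF frame_field] this]
  have "Z (\<lambda>w. vlift \<A> Y w L) = Z (\<lambda>w. \<Sum>\<alpha>\<in>UNIV. ?y \<alpha> (fst w) * vlift \<A> (X \<alpha>) w L)"
    by (intro T.tangent_vector_cong_carrier[OF Zt] vlift_expand vector_field_tangent[OF Y] carrier_TQ_fst)
  also have "\<dots> = (\<Sum>\<alpha>\<in>UNIV. Z (\<lambda>w. ?y \<alpha> (fst w) * vlift \<A> (X \<alpha>) w L))"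
    by (intro T.tangent_vector_sum[OF Zt] T.smooth_near_mult y' VL)
  also have "\<dots> = (\<Sum>\<alpha>\<in>UNIV. ?y \<alpha> (fst u) * Z (\<lambda>w. vlift \<A> (X \<alpha>) w L) + snd u (?y \<alpha>) * vlift \<A> (X \<alpha>) u L)"
    by (simp add: T.tangent_vector_mult[OF Zt y' VL] Zb[OF y])
  finally show ?thesis
    unfolding euler_lagrange_def clift_expand[OF Y u]
    by (simp add: sum.distrib right_diff_distrib sum_subtractf)
qed

end

section \<open>The geodesic spray of a metric\<close>

definition gram :: "('q \<Rightarrow> 'q tvec \<Rightarrow> 'q tvec \<Rightarrow> real) \<Rightarrow> ('n \<Rightarrow> 'q \<Rightarrow> 'q tvec) \<Rightarrow> 'n \<Rightarrow> 'n \<Rightarrow> 'q \<Rightarrow> real" where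
  "gram g X \<alpha> \<beta> q = g q (X \<alpha> q) (X \<beta> q)"

text \<open>The right hand side of the geodesic equations \<open>g\<^bsub>\<alpha>\<beta>\<^esub> F\<^sup>\<beta> = M\<^bsub>\<alpha>\<^esub>\<close> in quasi-velocities.\<close>

definition spray_force ::
  "('q, real ^ 'n::finite) atlas \<Rightarrow> ('q \<Rightarrow> 'q tvec \<Rightarrow> 'q tvec \<Rightarrow> real) \<Rightarrow> ('n \<Rightarrow> 'q \<Rightarrow> 'q tvec)
    \<Rightarrow> 'n \<Rightarrow> 'q tbundle \<Rightarrow> real" where
  "spray_force \<A> g X \<alpha> u =
     1 / 2 * (\<Sum>\<beta>\<in>UNIV. \<Sum>\<gamma>\<in>UNIV. X \<alpha> (fst u) (gram g X \<beta> \<gamma>) * (qvel X \<beta> u * qvel X \<gamma> u))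
     + (\<Sum>\<beta>\<in>UNIV. \<Sum>\<gamma>\<in>UNIV. gram g X \<beta> \<gamma> (fst u) * qvel X \<beta> u
          * (\<Sum>\<delta>\<in>UNIV. qvel X \<delta> u * struct_fun \<A> X \<gamma> \<delta> \<alpha> (fst u)))
     - (\<Sum>\<beta>\<in>UNIV. snd u (gram g X \<alpha> \<beta>) * qvel X \<beta> u)"

definition spray_coeff ::
  "('q, real ^ 'n::finite) atlas \<Rightarrow> ('q \<Rightarrow> 'q tvec \<Rightarrow> 'q tvec \<Rightarrow> real) \<Rightarrow> ('n \<Rightarrow> 'q \<Rightarrow> 'q tvec)
    \<Rightarrow> 'n \<Rightarrow> 'q tbundle \<Rightarrow> real" where
  "spray_coeff \<A> g X \<beta> u =
     (matrix_inv (\<chi> \<alpha> \<beta>. gram g X \<alpha> \<beta> (fst u)) *v (\<chi> \<alpha>. spray_force \<A> g X \<alpha> u)) $ \<beta>"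

lemma matrix_inv_right: "invertible A \<Longrightarrow> A ** matrix_inv A = mat 1"
  for A :: "real ^ 'k::finite ^ 'k"
  unfolding invertible_def matrix_inv_def by (rule someI_ex[THEN conjunct1])

lemma matrix_inv_left: "invertible A \<Longrightarrow> matrix_inv A ** A = mat 1"
  for A :: "real ^ 'k::finite ^ 'k"
  unfolding invertible_def matrix_inv_def by (rule someI_ex[THEN conjunct2])

locale riemannian_frame = framed_manifold \<A> X
  for \<A> :: "('q, real ^ 'n::finite) atlas" and X +
  fixes g :: "'q \<Rightarrow> 'q tvec \<Rightarrow> 'q tvec \<Rightarrow> real"
  assumes metric: "riemannian_metric \<A> g"
begin

lemma metric_sym: "v \<in> tangent_space \<A> q \<Longrightarrow> w \<in> tangent_space \<A> q \<Longrightarrow> g q v w = g q w v"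
  using metric tangent_space_carrier unfolding riemannian_metric_def by blast

lemma metric_pos: "v \<in> tangent_space \<A> q \<Longrightarrow> v \<noteq> (\<lambda>f. 0) \<Longrightarrow> g q v v > 0"
  using metric tangent_space_carrier unfolding riemannian_metric_def by blast

lemma metric_lin2:
  "u \<in> tangent_space \<A> q \<Longrightarrow> v \<in> tangent_space \<A> q \<Longrightarrow> w \<in> tangent_space \<A> q \<Longrightarrow>
    g q (\<lambda>f. c * u f + d * v f) w = c * g q u w + d * g q v w"
  using metric tangent_space_carrier unfolding riemannian_metric_def by blast

lemma metric_sum_left:
  assumes w: "w \<in> tangent_space \<A> q" and v: "\<And>i. i \<in> I \<Longrightarrow> v i \<in> tangent_space \<A> q"
  shows "g q (\<lambda>f. \<Sum>i\<in>I. c i * v i f) w = (\<Sum>i\<in>I. c i * g q (v i) w)"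
proof -
  note q = tangent_space_carrier[OF w]
  have zero: "g q (\<lambda>f. 0) w = 0"
    using metric_lin2[OF w w w, of 0 0] by simp
  show ?thesis
    using v
  proof (induction I rule: infinite_finite_induct)
    case (insert i I)
    then show ?case
      using metric_lin2[OF _ tangent_space_sum[OF q] w, of "v i" I v "c i" 1 c] by simp
  qed (simp_all add: zero)
qed

lemma metric_sum_right:
  assumes w: "w \<in> tangent_space \<A> q" and v: "\<And>i. i \<in> I \<Longrightarrow> v i \<in> tangent_space \<A> q"
  shows "g q w (\<lambda>f. \<Sum>i\<in>I. c i * v i f) = (\<Sum>i\<in>I. c i * g q w (v i))"
proof -
  have "g q w (\<lambda>f. \<Sum>i\<in>I. c i * v i f) = g q (\<lambda>f. \<Sum>i\<in>I. c i * v i f) w"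
    by (intro metric_sym[OF w] tangent_space_sum tangent_space_carrier[OF w] v)
  also have "\<dots> = (\<Sum>i\<in>I. c i * g q (v i) w)"
    by (rule metric_sum_left[OF w v])
  finally show ?thesis
    by (simp add: metric_sym[OF w v])
qed

lemma gram_sym: "q \<in> carrier_of \<A> \<Longrightarrow> gram g X \<alpha> \<beta> q = gram g X \<beta> \<alpha> q"
  unfolding gram_def by (intro metric_sym frame_tangent)

lemma smooth_near_gram: "q \<in> carrier_of \<A> \<Longrightarrow> smooth_near \<A> q (gram g X \<alpha> \<beta>)"
  using metric frame_field unfolding riemannian_metric_def smooth_fun_def gram_def[abs_def] by blast

lemma metric_frame:
  assumes q: "q \<in> carrier_of \<A>"
  shows "g q (\<lambda>f. \<Sum>\<alpha>\<in>UNIV. c \<alpha> * X \<alpha> q f) (\<lambda>f. \<Sum>\<alpha>\<in>UNIV. d \<alpha> * X \<alpha> q f) =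
    (\<Sum>\<alpha>\<in>UNIV. \<Sum>\<beta>\<in>UNIV. gram g X \<alpha> \<beta> q * (c \<alpha> * d \<beta>))"
proof -
  have "g q (\<lambda>f. \<Sum>\<alpha>\<in>UNIV. c \<alpha> * X \<alpha> q f) (\<lambda>f. \<Sum>\<alpha>\<in>UNIV. d \<alpha> * X \<alpha> q f) =
      (\<Sum>\<alpha>\<in>UNIV. c \<alpha> * g q (X \<alpha> q) (\<lambda>f. \<Sum>\<alpha>\<in>UNIV. d \<alpha> * X \<alpha> q f))"
    by (rule metric_sum_left[OF frame_combination_tangent[OF q] frame_tangent[OF q]])
  also have "\<dots> = (\<Sum>\<alpha>\<in>UNIV. c \<alpha> * (\<Sum>\<beta>\<in>UNIV. d \<beta> * g q (X \<alpha> q) (X \<beta> q)))"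
    by (simp add: metric_sum_right[OF frame_tangent[OF q] frame_tangent[OF q]])
  finally show ?thesis
    by (simp add: gram_def sum_distrib_left mult_ac)
qed

lemma gram_injective:
  assumes q: "q \<in> carrier_of \<A>" and z: "\<And>\<alpha>. (\<Sum>\<beta>\<in>UNIV. gram g X \<alpha> \<beta> q * z \<beta>) = 0"
  shows "z = (\<lambda>_. 0)"
proof -
  let ?v = "\<lambda>f. \<Sum>\<alpha>\<in>UNIV. z \<alpha> * X \<alpha> q f"
  have "g q ?v ?v = (\<Sum>\<alpha>\<in>UNIV. z \<alpha> * (\<Sum>\<beta>\<in>UNIV. gram g X \<alpha> \<beta> q * z \<beta>))"
    by (simp add: metric_frame[OF q] sum_distrib_left mult_ac)
  then have "g q ?v ?v = 0"
    by (simp add: z)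
  then have "?v = (\<lambda>f. \<Sum>\<alpha>\<in>UNIV. 0 * X \<alpha> q f)"
    using metric_pos[OF frame_combination_tangent[where I = UNIV and c = z, OF q]] by force
  from frame_coeff_combination[OF q this] frame_coeff_combination[OF q refl, of z] show ?thesis
    by simp
qed

lemma kinetic_expand:
  assumes u: "u \<in> carrier_of (TQ \<A>)"
  shows "kinetic g u = 1 / 2 * (\<Sum>\<alpha>\<in>UNIV. \<Sum>\<beta>\<in>UNIV. gram g X \<alpha> \<beta> (fst u) * (qvel X \<alpha> u * qvel X \<beta> u))"
proof -
  have "snd u = (\<lambda>f. \<Sum>\<alpha>\<in>UNIV. qvel X \<alpha> u * X \<alpha> (fst u) f)"
    using velocity_expand[OF u] by auto
  then show ?thesis
    using metric_frame[OF carrier_TQ_fst[OF u], of "\<lambda>\<alpha>. qvel X \<alpha> u" "\<lambda>\<alpha>. qvel X \<alpha> u"]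
    by (simp add: kinetic_def)
qed

lemma smooth_near_kinetic:
  assumes u: "u \<in> carrier_of (TQ \<A>)"
  shows "smooth_near (TQ \<A>) u (kinetic g)"
proof (rule T.smooth_near_cong_carrier)
  show "smooth_near (TQ \<A>) u (\<lambda>w. 1 / 2 * (\<Sum>\<alpha>\<in>UNIV. \<Sum>\<beta>\<in>UNIV. gram g X \<alpha> \<beta> (fst w) * (qvel X \<alpha> w * qvel X \<beta> w)))"
    by (intro T.smooth_near_cmult T.smooth_near_sum u T.smooth_near_mult smooth_near_qvel
        smooth_near_TQ_base smooth_near_gram carrier_TQ_fst)
qed (rule kinetic_expand[symmetric])

lemma smooth_fun_kinetic: "smooth_fun (TQ \<A>) (kinetic g)"
  by (simp add: smooth_fun_def smooth_near_kinetic)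

lemma kinetic_derivative:
  assumes Z: "Z \<in> tangent_space (TQ \<A>) u"
  shows "Z (kinetic g) =
    1 / 2 * (\<Sum>\<alpha>\<in>UNIV. \<Sum>\<beta>\<in>UNIV. Z (\<lambda>w. gram g X \<alpha> \<beta> (fst w)) * (qvel X \<alpha> u * qvel X \<beta> u))
    + (\<Sum>\<alpha>\<in>UNIV. \<Sum>\<beta>\<in>UNIV. gram g X \<alpha> \<beta> (fst u) * qvel X \<alpha> u * Z (qvel X \<beta>))"
proof -
  note u = T.tangent_space_carrier[OF Z]
  note v = smooth_near_qvel[OF u] and G = smooth_near_TQ_base[OF u smooth_near_gram[OF carrier_TQ_fst[OF u]]]
  have sm: "smooth_near (TQ \<A>) u (\<lambda>w. gram g X \<alpha> \<beta> (fst w) * (qvel X \<alpha> w * qvel X \<beta> w))" for \<alpha> \<beta>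
    by (intro T.smooth_near_mult v G)
  have product_rule: "Z (\<lambda>w. gram g X \<alpha> \<beta> (fst w) * (qvel X \<alpha> w * qvel X \<beta> w)) =
      Z (\<lambda>w. gram g X \<alpha> \<beta> (fst w)) * (qvel X \<alpha> u * qvel X \<beta> u)
      + gram g X \<alpha> \<beta> (fst u) * qvel X \<alpha> u * Z (qvel X \<beta>) + gram g X \<alpha> \<beta> (fst u) * qvel X \<beta> u * Z (qvel X \<alpha>)" for \<alpha> \<beta>
    unfolding T.tangent_vector_mult[OF Z G T.smooth_near_mult[OF v v]] T.tangent_vector_mult[OF Z v v]
    by (simp add: algebra_simps)
  have "Z (kinetic g) = Z (\<lambda>w. 1 / 2 * (\<Sum>\<alpha>\<in>UNIV. \<Sum>\<beta>\<in>UNIV. gram g X \<alpha> \<beta> (fst w) * (qvel X \<alpha> w * qvel X \<beta> w)))"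
    by (rule T.tangent_vector_cong_carrier[OF Z kinetic_expand])
  also have "\<dots> = 1 / 2 * Z (\<lambda>w. \<Sum>\<alpha>\<in>UNIV. \<Sum>\<beta>\<in>UNIV. gram g X \<alpha> \<beta> (fst w) * (qvel X \<alpha> w * qvel X \<beta> w))"
    by (intro T.tangent_vector_cmult[OF Z] T.smooth_near_sum u sm)
  also have "Z (\<lambda>w. \<Sum>\<alpha>\<in>UNIV. \<Sum>\<beta>\<in>UNIV. gram g X \<alpha> \<beta> (fst w) * (qvel X \<alpha> w * qvel X \<beta> w)) =
      (\<Sum>\<alpha>\<in>UNIV. Z (\<lambda>w. \<Sum>\<beta>\<in>UNIV. gram g X \<alpha> \<beta> (fst w) * (qvel X \<alpha> w * qvel X \<beta> w)))"
    by (intro T.tangent_vector_sum[OF Z] T.smooth_near_sum u sm)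
  also have "\<dots> = (\<Sum>\<alpha>\<in>UNIV. \<Sum>\<beta>\<in>UNIV. Z (\<lambda>w. gram g X \<alpha> \<beta> (fst w) * (qvel X \<alpha> w * qvel X \<beta> w)))"
    by (intro sum.cong refl T.tangent_vector_sum[OF Z] sm)
  also have "\<dots> = (\<Sum>\<alpha>\<in>UNIV. \<Sum>\<beta>\<in>UNIV. Z (\<lambda>w. gram g X \<alpha> \<beta> (fst w)) * (qvel X \<alpha> u * qvel X \<beta> u)
      + gram g X \<alpha> \<beta> (fst u) * qvel X \<alpha> u * Z (qvel X \<beta>) + gram g X \<alpha> \<beta> (fst u) * qvel X \<beta> u * Z (qvel X \<alpha>))"
    by (simp only: product_rule)
  also have "\<dots> = (\<Sum>\<alpha>\<in>UNIV. \<Sum>\<beta>\<in>UNIV. Z (\<lambda>w. gram g X \<alpha> \<beta> (fst w)) * (qvel X \<alpha> u * qvel X \<beta> u))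
      + (\<Sum>\<alpha>\<in>UNIV. \<Sum>\<beta>\<in>UNIV. gram g X \<alpha> \<beta> (fst u) * qvel X \<alpha> u * Z (qvel X \<beta>))
      + (\<Sum>\<alpha>\<in>UNIV. \<Sum>\<beta>\<in>UNIV. gram g X \<alpha> \<beta> (fst u) * qvel X \<beta> u * Z (qvel X \<alpha>))"
    by (simp add: sum.distrib)
  also have "(\<Sum>\<alpha>\<in>UNIV. \<Sum>\<beta>\<in>UNIV. gram g X \<alpha> \<beta> (fst u) * qvel X \<beta> u * Z (qvel X \<alpha>)) =
      (\<Sum>\<alpha>\<in>UNIV. \<Sum>\<beta>\<in>UNIV. gram g X \<alpha> \<beta> (fst u) * qvel X \<alpha> u * Z (qvel X \<beta>))"
    by (subst sum.swap) (simp add: gram_sym[OF carrier_TQ_fst[OF u]])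
  finally show ?thesis
    by (simp add: algebra_simps)
qed

lemma vlift_frame_kinetic:
  assumes u: "u \<in> carrier_of (TQ \<A>)"
  shows "vlift \<A> (X \<alpha>) u (kinetic g) = (\<Sum>\<beta>\<in>UNIV. gram g X \<alpha> \<beta> (fst u) * qvel X \<beta> u)"
proof -
  have "vlift \<A> (X \<alpha>) u (kinetic g) = (\<Sum>\<gamma>\<in>UNIV. \<Sum>\<beta>\<in>UNIV. gram g X \<gamma> \<beta> (fst u) * qvel X \<gamma> u * (if \<beta> = \<alpha> then 1 else 0))"
    using vlift_base[of "X \<alpha>" u "gram g X _ _"]
    by (simp add: kinetic_derivative[OF vlift_frame_tangent[OF u]] vlift_frame_qvel[OF u])
  also have "\<dots> = (\<Sum>\<gamma>\<in>UNIV. gram g X \<gamma> \<alpha> (fst u) * qvel X \<gamma> u)"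
    by (simp add: if_distrib[of "\<lambda>x. _ * x"] cong: if_cong)
  finally show ?thesis
    by (simp add: gram_sym[OF carrier_TQ_fst[OF u], of _ \<alpha>])
qed

lemma euler_lagrange_frame:
  assumes Z: "second_order_at \<A> u Z"
  shows "euler_lagrange \<A> (kinetic g) Z (X \<alpha>) u =
    (\<Sum>\<beta>\<in>UNIV. gram g X \<alpha> \<beta> (fst u) * Z (qvel X \<beta>)) - spray_force \<A> g X \<alpha> u"
proof -
  have Zt: "Z \<in> tangent_space (TQ \<A>) u" and Zb: "\<And>f. smooth_near \<A> (fst u) f \<Longrightarrow> Z (\<lambda>w. f (fst w)) = snd u f"
    using Z by (auto simp: second_order_at_def)
  note u = T.tangent_space_carrier[OF Zt]
  note gs = smooth_near_gram[OF carrier_TQ_fst[OF u]]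
  note v = smooth_near_qvel[OF u] and G = smooth_near_TQ_base[OF u gs]
  have "Z (\<lambda>w. vlift \<A> (X \<alpha>) w (kinetic g)) = Z (\<lambda>w. \<Sum>\<beta>\<in>UNIV. gram g X \<alpha> \<beta> (fst w) * qvel X \<beta> w)"
    by (rule T.tangent_vector_cong_carrier[OF Zt vlift_frame_kinetic])
  also have "\<dots> = (\<Sum>\<beta>\<in>UNIV. Z (\<lambda>w. gram g X \<alpha> \<beta> (fst w) * qvel X \<beta> w))"
    by (intro T.tangent_vector_sum[OF Zt] T.smooth_near_mult v G)
  also have "\<dots> = (\<Sum>\<beta>\<in>UNIV. gram g X \<alpha> \<beta> (fst u) * Z (qvel X \<beta>) + snd u (gram g X \<alpha> \<beta>) * qvel X \<beta> u)"
    by (simp add: T.tangent_vector_mult[OF Zt G v] Zb[OF gs])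
  finally show ?thesis
    unfolding euler_lagrange_def kinetic_derivative[OF clift_tangent[OF frame_field u]]
    by (simp add: spray_force_def clift_base[OF frame_field u gs] clift_frame_qvel[OF u] sum.distrib)
qed

lemma gram_matrix_invertible:
  assumes q: "q \<in> carrier_of \<A>"
  shows "invertible (\<chi> \<alpha> \<beta>. gram g X \<alpha> \<beta> q)"
proof -
  have "z = 0" if "(\<chi> \<alpha> \<beta>. gram g X \<alpha> \<beta> q) *v z = 0" for z
  proof -
    have "(\<lambda>\<beta>. z $ \<beta>) = (\<lambda>_. 0)"
      using that by (intro gram_injective[OF q]) (simp add: matrix_vector_mult_def vec_eq_iff)
    then show ?thesis
      by (simp add: vec_eq_iff fun_eq_iff)
  qed
  then show ?thesis
    using matrix_left_invertible_ker invertible_left_inverse by blast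
qed

lemma spray_coeff_equation:
  assumes u: "u \<in> carrier_of (TQ \<A>)"
  shows "(\<Sum>\<beta>\<in>UNIV. gram g X \<alpha> \<beta> (fst u) * spray_coeff \<A> g X \<beta> u) = spray_force \<A> g X \<alpha> u"
proof -
  let ?G = "(\<chi> \<alpha> \<beta>. gram g X \<alpha> \<beta> (fst u)) :: real ^ 'n ^ 'n" and ?M = "\<chi> \<alpha>. spray_force \<A> g X \<alpha> u"
  have "?G *v (matrix_inv ?G *v ?M) = ?M"
    using gram_matrix_invertible[OF carrier_TQ_fst[OF u]]
    by (simp add: matrix_vector_mul_assoc matrix_inv_right)
  then have "(?G *v (matrix_inv ?G *v ?M)) $ \<alpha> = spray_force \<A> g X \<alpha> u"
    by simp
  then show ?thesis
    unfolding spray_coeff_def by (subst (asm) (1) matrix_vector_mult_def) simp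
qed

lemma smooth_near_spray_force:
  assumes u: "u \<in> carrier_of (TQ \<A>)"
  shows "smooth_near (TQ \<A>) u (spray_force \<A> g X \<alpha>)"
proof -
  note q = carrier_TQ_fst[OF u]
  note v = smooth_near_qvel[OF u]
  note gs = smooth_near_gram[OF q]
  show ?thesis
    unfolding spray_force_def[abs_def]
    by (intro T.smooth_near_add T.smooth_near_diff T.smooth_near_cmult T.smooth_near_sum T.smooth_near_mult
        u v smooth_near_TQ_base[OF u gs] smooth_near_TQ_fibre_linear[OF u gs]
        smooth_near_TQ_base[OF u vector_field_smooth[OF frame_field gs]]
        smooth_near_TQ_base[OF u smooth_near_struct_fun[OF q]])
qed

lemma smooth_near_spray_coeff:
  assumes u: "u \<in> carrier_of (TQ \<A>)"
  shows "smooth_near (TQ \<A>) u (spray_coeff \<A> g X \<beta>)"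
proof -
  obtain U \<phi> where T: "(TQ_dom \<A> U, TQ_chart \<phi>) \<in> TQ \<A>" "u \<in> TQ_dom \<A> U"
    by (rule carrier_TQ_chart[OF u])
  have c: "w \<in> carrier_of (TQ \<A>)" if "w \<in> TQ_dom \<A> U" for w
    using that by (simp add: carrier_TQ mem_TQ_dom)
  show ?thesis
  proof (rule T.smooth_near_linear_system[OF T, where M = "\<lambda>\<alpha> \<beta> w. gram g X \<alpha> \<beta> (fst w)"
        and y = "spray_force \<A> g X"])
    show "smooth_near (TQ \<A>) u (\<lambda>w. gram g X \<alpha> \<beta> (fst w))" for \<alpha> \<beta>
      by (intro smooth_near_TQ_base u smooth_near_gram carrier_TQ_fst)
    show "z = (\<lambda>_. 0)" if "w \<in> TQ_dom \<A> U" "\<And>\<alpha>. (\<Sum>\<beta>\<in>UNIV. gram g X \<alpha> \<beta> (fst w) * z \<beta>) = 0" for w z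
      by (rule gram_injective[OF carrier_TQ_fst[OF c[OF that(1)]] that(2)])
  qed (simp_all add: smooth_near_spray_force u spray_coeff_equation c)
qed

lemma spray_coeff_unique:
  assumes u: "u \<in> carrier_of (TQ \<A>)"
    and F: "\<And>\<alpha>. (\<Sum>\<beta>\<in>UNIV. gram g X \<alpha> \<beta> (fst u) * F \<beta>) = spray_force \<A> g X \<alpha> u"
  shows "F \<beta> = spray_coeff \<A> g X \<beta> u"
proof -
  have "(\<lambda>\<beta>. F \<beta> - spray_coeff \<A> g X \<beta> u) = (\<lambda>_. 0)"
    by (rule gram_injective[OF carrier_TQ_fst[OF u]])
      (simp add: right_diff_distrib sum_subtractf F spray_coeff_equation[OF u])
  then show ?thesis
    by (simp add: fun_eq_iff)
qed

theorem geodesic_spray_eq: "geodesic_spray \<A> X g = second_order_field \<A> X (spray_coeff \<A> g X)"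
  unfolding lagrangian_field_def euler_lagrange_def[symmetric]
proof (rule the_equality)
  let ?S = "second_order_field \<A> X (spray_coeff \<A> g X)"
  have "euler_lagrange \<A> (kinetic g) (?S u) Y u = 0" if Y: "vector_field \<A> Y" and u: "u \<in> carrier_of (TQ \<A>)" for Y u
  proof -
    have "euler_lagrange \<A> (kinetic g) (?S u) (X \<alpha>) u = 0" for \<alpha>
      by (simp add: euler_lagrange_frame[OF second_order_field_at[OF u]] second_order_field_qvel[OF u]
          spray_coeff_equation[OF u])
    with euler_lagrange_expand[OF second_order_field_at[OF u] Y smooth_fun_kinetic] show ?thesis
      by simp
  qed
  moreover have "sode \<A> X ?S"
    unfolding sode_iff smooth_fun_def
    by (intro exI[of _ "spray_coeff \<A> g X"]) (simp add: smooth_near_spray_coeff)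
  ultimately show "sode \<A> X ?S \<and>
      (\<forall>Y. vector_field \<A> Y \<longrightarrow> (\<forall>u\<in>carrier_of (TQ \<A>). euler_lagrange \<A> (kinetic g) (?S u) Y u = 0))"
    by blast
  fix \<Gamma>
  assume \<Gamma>: "sode \<A> X \<Gamma> \<and>
      (\<forall>Y. vector_field \<A> Y \<longrightarrow> (\<forall>u\<in>carrier_of (TQ \<A>). euler_lagrange \<A> (kinetic g) (\<Gamma> u) Y u = 0))"
  then obtain F where F: "\<Gamma> = second_order_field \<A> X F"
    by (auto simp: sode_iff)
  show "\<Gamma> = ?S"
  proof
    fix u
    show "\<Gamma> u = ?S u"
    proof (cases "u \<in> carrier_of (TQ \<A>)")
      case u: True
      have "F \<beta> u = spray_coeff \<A> g X \<beta> u" for \<beta>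
      proof (rule spray_coeff_unique[OF u])
        show "(\<Sum>\<beta>\<in>UNIV. gram g X \<alpha> \<beta> (fst u) * F \<beta> u) = spray_force \<A> g X \<alpha> u" for \<alpha>
          using \<Gamma> frame_field u euler_lagrange_frame[OF second_order_field_at[OF u, of F], of \<alpha>]
          by (simp add: F second_order_field_qvel[OF u])
      qed
      then show ?thesis
        by (simp add: F second_order_field_def)
    next
      case False
      then show ?thesis
        by (simp add: F second_order_field_off_carrier)
    qed
  qed
qed

end

section \<open>Two metrics that agree on the distribution\<close>

text \<open>The components of \<open>Xhat\<^sub>i = X\<^bsub>i\<^esub> - g\<^sup>a\<^sup>b gh\<^bsub>bi\<^esub> X\<^bsub>a\<^esub>\<close> in the frame.\<close>

definition hat_coeff ::
  "('q \<Rightarrow> 'q tvec \<Rightarrow> 'q tvec \<Rightarrow> real) \<Rightarrow> ('q \<Rightarrow> 'q tvec \<Rightarrow> 'q tvec \<Rightarrow> real)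
    \<Rightarrow> ('n::finite \<Rightarrow> 'q \<Rightarrow> 'q tvec) \<Rightarrow> 'n set \<Rightarrow> 'n \<Rightarrow> 'n \<Rightarrow> 'q \<Rightarrow> real" where
  "hat_coeff g gh X S i \<alpha> q =
     (if \<alpha> \<in> S then - (\<Sum>b\<in>S. gram_inv g X S q \<alpha> b * gram gh X b i q) else if \<alpha> = i then 1 else 0)"

text \<open>The coefficients of the projected spray, which is the spray of \<open>gh\<close> minus \<open>F\<^sup>i Xhat\<^sub>i\<^sup>V\<close>.\<close>

definition tangential_coeff ::
  "('q, real ^ 'n::finite) atlas \<Rightarrow> ('q \<Rightarrow> 'q tvec \<Rightarrow> 'q tvec \<Rightarrow> real)
    \<Rightarrow> ('q \<Rightarrow> 'q tvec \<Rightarrow> 'q tvec \<Rightarrow> real) \<Rightarrow> ('n \<Rightarrow> 'q \<Rightarrow> 'q tvec) \<Rightarrow> 'n set \<Rightarrow> 'n \<Rightarrow> 'q tbundle \<Rightarrow> real" where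
  "tangential_coeff \<A> g gh X S \<alpha> u =
     spray_coeff \<A> gh X \<alpha> u - (\<Sum>i\<in>-S. spray_coeff \<A> gh X i u * hat_coeff g gh X S i \<alpha> (fst u))"

locale modified_metric = riemannian_frame \<A> X g + hat: riemannian_frame \<A> X gh
  for \<A> :: "('q, real ^ 'n::finite) atlas" and X and g gh +
  fixes S :: "'n set" and D :: "'q \<Rightarrow> 'q tvec set"
  assumes gram_orthogonal: "q \<in> carrier_of \<A> \<Longrightarrow> a \<in> S \<Longrightarrow> i \<notin> S \<Longrightarrow> gram g X a i q = 0"
    and gram_agree: "q \<in> carrier_of \<A> \<Longrightarrow> a \<in> S \<Longrightarrow> b \<in> S \<Longrightarrow> gram gh X a b q = gram g X a b q"
    and distribution_span: "q \<in> carrier_of \<A> \<Longrightarrow> D q = {v. \<exists>c. v = (\<lambda>f. \<Sum>a\<in>S. c a * X a q f)}"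
begin

lemma sum_split: "(\<Sum>\<alpha>\<in>UNIV. f \<alpha>) = (\<Sum>a\<in>S. f a) + (\<Sum>i\<in>-S. f i)" for f :: "'n \<Rightarrow> real"
  using sum.subset_diff[of S UNIV f] by (simp add: Compl_eq_Diff_UNIV add.commute)

lemma sum_restrict: "(\<And>i. i \<notin> S \<Longrightarrow> f i = 0) \<Longrightarrow> (\<Sum>\<alpha>\<in>UNIV. f \<alpha>) = (\<Sum>a\<in>S. f a)" for f :: "'n \<Rightarrow> real"
  by (simp add: sum_split)

lemma constraint_setD:
  "u \<in> constraint_set \<A> X S \<Longrightarrow> u \<in> carrier_of (TQ \<A>)"
  "u \<in> constraint_set \<A> X S \<Longrightarrow> i \<notin> S \<Longrightarrow> qvel X i u = 0"
  by (auto simp: constraint_set_def)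

lemma constraint_point:
  fixes v :: "'n \<Rightarrow> real"
  assumes q: "q \<in> carrier_of \<A>"
  defines "u \<equiv> (q, \<lambda>f. \<Sum>a\<in>S. v a * X a q f)"
  shows "u \<in> constraint_set \<A> X S" "a \<in> S \<Longrightarrow> qvel X a u = v a"
proof -
  have "(\<lambda>f. \<Sum>a\<in>S. v a * X a q f) = (\<lambda>f. \<Sum>\<alpha>\<in>UNIV. (if \<alpha> \<in> S then v \<alpha> else 0) * X \<alpha> q f)"
    by (subst sum_restrict) (auto intro!: sum.cong)
  then have "qvel X \<alpha> u = (if \<alpha> \<in> S then v \<alpha> else 0)" for \<alpha>
    using frame_coeff_combination[OF q] by (simp add: u_def qvel_def)
  moreover have "u \<in> carrier_of (TQ \<A>)"
    by (simp add: u_def carrier_TQ frame_combination_tangent[OF q])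
  ultimately show "u \<in> constraint_set \<A> X S" "a \<in> S \<Longrightarrow> qvel X a u = v a"
    by (auto simp: constraint_set_def)
qed

subsection \<open>The condition on the structure functions\<close>

text \<open>On the constraint manifold only the components \<open>g\<^bsub>a\<beta>\<^esub>\<close> with \<open>a \<in> S\<close> enter the geodesic
  equations in the directions of the distribution. All terms are common to both metrics, except
  that \<open>gh\<^bsub>bk\<^esub>\<close> need not vanish, and it is paired with \<open>R\<^sup>k\<^bsub>ac\<^esub>\<close>.\<close>

lemma spray_force_difference:
  assumes u: "u \<in> constraint_set \<A> X S" and c: "c \<in> S"
  shows "spray_force \<A> gh X c u - spray_force \<A> g X c u =
    (\<Sum>a\<in>S. \<Sum>b\<in>S. \<Sum>k\<in>-S. gh (fst u) (X b (fst u)) (X k (fst u)) * struct_fun \<A> X k a c (fst u)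
      * qvel X a u * qvel X b u)"
proof -
  note u' = constraint_setD(1)[OF u] and v0 = constraint_setD(2)[OF u]
  note q = carrier_TQ_fst[OF u']
  have v: "snd u \<in> tangent_space \<A> (fst u)"
    using u' by (simp add: carrier_TQ)
  let ?\<rho> = "\<lambda>\<gamma>. \<Sum>\<delta>\<in>UNIV. qvel X \<delta> u * struct_fun \<A> X \<gamma> \<delta> c (fst u)"
  \<comment> \<open>The components on the distribution agree on all of the manifold, hence so do their derivatives.\<close>
  have 1: "X c (fst u) (gram gh X \<beta> \<gamma>) * (qvel X \<beta> u * qvel X \<gamma> u) =
      X c (fst u) (gram g X \<beta> \<gamma>) * (qvel X \<beta> u * qvel X \<gamma> u)" for \<beta> \<gamma>
  proof (cases "\<beta> \<in> S \<and> \<gamma> \<in> S")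
    case True
    then show ?thesis
      using tangent_vector_cong_carrier[OF frame_tangent[OF q], of "gram gh X \<beta> \<gamma>" "gram g X \<beta> \<gamma>"]
      by (simp add: gram_agree)
  qed (auto simp: v0)
  have 2: "snd u (gram gh X c \<beta>) * qvel X \<beta> u = snd u (gram g X c \<beta>) * qvel X \<beta> u" for \<beta>
  proof (cases "\<beta> \<in> S")
    case True
    then show ?thesis
      using tangent_vector_cong_carrier[OF v, of "gram gh X c \<beta>" "gram g X c \<beta>"] c
      by (simp add: gram_agree)
  qed (simp add: v0)
  have 3: "gram gh X \<beta> \<gamma> (fst u) * qvel X \<beta> u * ?\<rho> \<gamma> - gram g X \<beta> \<gamma> (fst u) * qvel X \<beta> u * ?\<rho> \<gamma> =
      (if \<beta> \<in> S \<and> \<gamma> \<notin> S then gram gh X \<beta> \<gamma> (fst u) * qvel X \<beta> u * ?\<rho> \<gamma> else 0)" for \<beta> \<gamma>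
    by (cases "\<beta> \<in> S"; cases "\<gamma> \<in> S") (simp_all add: v0 gram_agree[OF q] gram_orthogonal[OF q])
  have "spray_force \<A> gh X c u - spray_force \<A> g X c u =
      (\<Sum>\<beta>\<in>UNIV. \<Sum>\<gamma>\<in>UNIV. gram gh X \<beta> \<gamma> (fst u) * qvel X \<beta> u * ?\<rho> \<gamma>)
      - (\<Sum>\<beta>\<in>UNIV. \<Sum>\<gamma>\<in>UNIV. gram g X \<beta> \<gamma> (fst u) * qvel X \<beta> u * ?\<rho> \<gamma>)"
    unfolding spray_force_def by (simp only: 1 2)
  also have "\<dots> = (\<Sum>\<beta>\<in>UNIV. \<Sum>\<gamma>\<in>UNIV. if \<beta> \<in> S \<and> \<gamma> \<notin> S then gram gh X \<beta> \<gamma> (fst u) * qvel X \<beta> u * ?\<rho> \<gamma> else 0)"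
    by (simp only: sum_subtractf[symmetric] 3)
  also have "\<dots> = (\<Sum>b\<in>S. \<Sum>\<gamma>\<in>UNIV. if b \<in> S \<and> \<gamma> \<notin> S then gram gh X b \<gamma> (fst u) * qvel X b u * ?\<rho> \<gamma> else 0)"
    by (rule sum_restrict) simp
  also have "\<dots> = (\<Sum>b\<in>S. \<Sum>k\<in>-S. gram gh X b k (fst u) * qvel X b u * ?\<rho> k)"
    by (rule sum.cong[OF refl]) (simp add: sum_split)
  also have "\<dots> = (\<Sum>b\<in>S. \<Sum>k\<in>-S. \<Sum>a\<in>S. gram gh X b k (fst u) * struct_fun \<A> X k a c (fst u) * qvel X a u * qvel X b u)"
  proof (intro sum.cong refl)
    fix b k
    have "?\<rho> k = (\<Sum>a\<in>S. qvel X a u * struct_fun \<A> X k a c (fst u))"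
      by (rule sum_restrict) (simp add: v0)
    then show "gram gh X b k (fst u) * qvel X b u * ?\<rho> k =
        (\<Sum>a\<in>S. gram gh X b k (fst u) * struct_fun \<A> X k a c (fst u) * qvel X a u * qvel X b u)"
      by (simp add: sum_distrib_left mult_ac)
  qed
  also have "\<dots> = (\<Sum>b\<in>S. \<Sum>a\<in>S. \<Sum>k\<in>-S. gram gh X b k (fst u) * struct_fun \<A> X k a c (fst u) * qvel X a u * qvel X b u)"
    by (rule sum.cong[OF refl sum.swap])
  also have "\<dots> = (\<Sum>a\<in>S. \<Sum>b\<in>S. \<Sum>k\<in>-S. gram gh X b k (fst u) * struct_fun \<A> X k a c (fst u) * qvel X a u * qvel X b u)"
    by (rule sum.swap)
  finally show ?thesis
    by (simp add: gram_def)
qed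

lemma condition_A_iff:
  "condition_A \<A> X S gh \<longleftrightarrow>
    (\<forall>u\<in>constraint_set \<A> X S. \<forall>c\<in>S. spray_force \<A> gh X c u = spray_force \<A> g X c u)"
proof
  assume A: "condition_A \<A> X S gh"
  show "\<forall>u\<in>constraint_set \<A> X S. \<forall>c\<in>S. spray_force \<A> gh X c u = spray_force \<A> g X c u"
  proof (intro ballI)
    fix u c assume u: "u \<in> constraint_set \<A> X S" and c: "c \<in> S"
    have "spray_force \<A> gh X c u - spray_force \<A> g X c u = 0"
      unfolding spray_force_difference[OF u c]
      using A c carrier_TQ_fst[OF constraint_setD(1)[OF u]] by (simp add: condition_A_def)
    then show "spray_force \<A> gh X c u = spray_force \<A> g X c u"
      by simp
  qed
next
  assume eq: "\<forall>u\<in>constraint_set \<A> X S. \<forall>c\<in>S. spray_force \<A> gh X c u = spray_force \<A> g X c u"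
  show "condition_A \<A> X S gh"
    unfolding condition_A_def
  proof (intro ballI allI)
    fix q c and v :: "'n \<Rightarrow> real" assume q: "q \<in> carrier_of \<A>" and c: "c \<in> S"
    note p = constraint_point[where v = v, OF q]
    have "(\<Sum>a\<in>S. \<Sum>b\<in>S. \<Sum>k\<in>-S. gh q (X b q) (X k q) * struct_fun \<A> X k a c q * v a * v b) =
        (\<Sum>a\<in>S. \<Sum>b\<in>S. \<Sum>k\<in>-S. gh q (X b q) (X k q) * struct_fun \<A> X k a c q
          * qvel X a (q, \<lambda>f. \<Sum>a\<in>S. v a * X a q f) * qvel X b (q, \<lambda>f. \<Sum>a\<in>S. v a * X a q f))"
      by (intro sum.cong refl) (simp add: p(2))
    also have "\<dots> = 0"
      using spray_force_difference[OF p(1) c] eq p(1) c by simp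
    finally show "(\<Sum>a\<in>S. \<Sum>b\<in>S. \<Sum>k\<in>-S. gh q (X b q) (X k q) * struct_fun \<A> X k a c q * v a * v b) = 0" .
  qed
qed

subsection \<open>The nonholonomic field\<close>

lemma gram_sum_restrict:
  "q \<in> carrier_of \<A> \<Longrightarrow> c \<in> S \<Longrightarrow> (\<Sum>\<beta>\<in>UNIV. gram g X c \<beta> q * z \<beta>) = (\<Sum>b\<in>S. gram g X c b q * z b)"
  by (rule sum_restrict) (simp add: gram_orthogonal)

lemma gram_injective_restrict:
  assumes q: "q \<in> carrier_of \<A>" and z: "\<And>c. c \<in> S \<Longrightarrow> (\<Sum>b\<in>S. gram g X c b q * z b) = 0" and b: "b \<in> S"
  shows "z b = 0"
proof -
  have "(\<lambda>b. if b \<in> S then z b else 0) = (\<lambda>_. 0)"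
  proof (rule gram_injective[OF q])
    fix c
    have "(\<Sum>\<beta>\<in>UNIV. gram g X c \<beta> q * (if \<beta> \<in> S then z \<beta> else 0)) = (\<Sum>b\<in>S. gram g X c b q * z b)"
      by (subst sum_restrict) (auto intro!: sum.cong)
    also have "\<dots> = 0"
    proof (cases "c \<in> S")
      case False
      then show ?thesis
        by (intro sum.neutral) (simp add: gram_sym[OF q, of c] gram_orthogonal[OF q])
    qed (rule z)
    finally show "(\<Sum>\<beta>\<in>UNIV. gram g X c \<beta> q * (if \<beta> \<in> S then z \<beta> else 0)) = 0" .
  qed
  with b show ?thesis
    by (metis (mono_tags))
qed

text \<open>The equations in the directions of the distribution involve only the block
  \<open>(g\<^bsub>ab\<^esub>)\<close>, which is invertible, and the geodesic spray of \<open>g\<close> provides a solution.\<close>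

lemma spray_coeff_restrict_unique:
  assumes u: "u \<in> carrier_of (TQ \<A>)"
  shows "(\<forall>a\<in>S. F a = spray_coeff \<A> g X a u) \<longleftrightarrow>
    (\<forall>c\<in>S. (\<Sum>b\<in>S. gram g X c b (fst u) * F b) = spray_force \<A> g X c u)"
proof
  note q = carrier_TQ_fst[OF u]
  have eq: "(\<Sum>b\<in>S. gram g X c b (fst u) * spray_coeff \<A> g X b u) = spray_force \<A> g X c u" if "c \<in> S" for c
    using gram_sum_restrict[OF q that, of "\<lambda>\<beta>. spray_coeff \<A> g X \<beta> u"] spray_coeff_equation[OF u, of c] by simp
  show "\<forall>c\<in>S. (\<Sum>b\<in>S. gram g X c b (fst u) * F b) = spray_force \<A> g X c u"
    if "\<forall>a\<in>S. F a = spray_coeff \<A> g X a u"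
    using eq that by simp
  show "\<forall>a\<in>S. F a = spray_coeff \<A> g X a u"
    if "\<forall>c\<in>S. (\<Sum>b\<in>S. gram g X c b (fst u) * F b) = spray_force \<A> g X c u"
  proof
    show "F a = spray_coeff \<A> g X a u" if "a \<in> S" for a
      using gram_injective_restrict[OF q _ that, of "\<lambda>b. F b - spray_coeff \<A> g X b u"] eq
        \<open>\<forall>c\<in>S. (\<Sum>b\<in>S. gram g X c b (fst u) * F b) = spray_force \<A> g X c u\<close>
      by (simp add: right_diff_distrib sum_subtractf)
  qed
qed

lemma section_frame_coeff:
  assumes Y: "Y \<in> sections_of \<A> D" and q: "q \<in> carrier_of \<A>" and i: "i \<notin> S"
  shows "frame_coeff X q (Y q) i = 0"
proof -
  have "Y q \<in> D q"
    using Y q by (simp add: sections_of_def)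
  then obtain c where "Y q = (\<lambda>f. \<Sum>a\<in>S. c a * X a q f)"
    by (auto simp: distribution_span[OF q])
  also have "\<dots> = (\<lambda>f. \<Sum>\<alpha>\<in>UNIV. (if \<alpha> \<in> S then c \<alpha> else 0) * X \<alpha> q f)"
    by (subst sum_restrict) (auto intro!: sum.cong)
  finally show ?thesis
    using i by (simp add: frame_coeff_combination[OF q])
qed

lemma frame_section: "a \<in> S \<Longrightarrow> X a \<in> sections_of \<A> D"
proof -
  assume a: "a \<in> S"
  have eq: "X a q = (\<lambda>f. \<Sum>b\<in>S. (if b = a then 1 else 0) * X b q f)" for q
    using a by (simp add: if_distrib[of "\<lambda>x. x * _"] cong: if_cong)
  then have "X a q \<in> D q" if "q \<in> carrier_of \<A>" for q
    unfolding distribution_span[OF that] by (intro CollectI exI) (rule eq)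
  then show ?thesis
    by (simp add: sections_of_def frame_field)
qed

lemma second_order_field_constraint:
  assumes "u \<in> constraint_set \<A> X S"
  shows "(\<Sum>a\<in>S. qvel X a u * clift \<A> (X a) u h + F a u * vlift \<A> (X a) u h) =
    second_order_field \<A> X (\<lambda>\<alpha> w. if \<alpha> \<in> S then F \<alpha> w else 0) u h"
  unfolding second_order_field_def
  by (subst sum_restrict) (auto simp: constraint_setD(2)[OF assms] intro!: sum.cong)

text \<open>A section of the distribution has no components in the directions outside \<open>S\<close>, and the Euler-Lagrange
  expression is linear over functions of the base.\<close>

lemma euler_lagrange_sections_iff:
  assumes Z: "second_order_at \<A> u Z" and L: "smooth_fun (TQ \<A>) L"
  shows "(\<forall>Y\<in>sections_of \<A> D. euler_lagrange \<A> L Z Y u = 0) \<longleftrightarrow> (\<forall>c\<in>S. euler_lagrange \<A> L Z (X c) u = 0)"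
proof
  have q: "fst u \<in> carrier_of \<A>"
    using Z unfolding second_order_at_def by (intro carrier_TQ_fst T.tangent_space_carrier) (rule conjunct1)
  show "\<forall>Y\<in>sections_of \<A> D. euler_lagrange \<A> L Z Y u = 0" if X: "\<forall>c\<in>S. euler_lagrange \<A> L Z (X c) u = 0"
  proof
    fix Y assume Y: "Y \<in> sections_of \<A> D"
    have Y': "vector_field \<A> Y"
      using Y by (simp add: sections_of_def)
    have terms: "frame_coeff X (fst u) (Y (fst u)) \<alpha> * euler_lagrange \<A> L Z (X \<alpha>) u = 0" for \<alpha>
      using X section_frame_coeff[OF Y q, of \<alpha>] by (cases "\<alpha> \<in> S") auto
    then show "euler_lagrange \<A> L Z Y u = 0"
      by (simp only: euler_lagrange_expand[OF Z Y' L] terms sum.neutral_const)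
  qed
qed (use frame_section in blast)

lemma euler_lagrange_constraint:
  fixes F :: "'n \<Rightarrow> 'q tbundle \<Rightarrow> real"
  assumes u: "u \<in> constraint_set \<A> X S" and c: "c \<in> S"
  defines "Z \<equiv> second_order_field \<A> X (\<lambda>\<alpha> w. if \<alpha> \<in> S then F \<alpha> w else 0) u"
  shows "euler_lagrange \<A> (kinetic g) Z (X c) u = (\<Sum>b\<in>S. gram g X c b (fst u) * F b u) - spray_force \<A> g X c u"
    and "euler_lagrange \<A> (kinetic gh) Z (X c) u = (\<Sum>b\<in>S. gram g X c b (fst u) * F b u) - spray_force \<A> gh X c u"
proof -
  note u' = constraint_setD(1)[OF u]
  note q = carrier_TQ_fst[OF u']
  have r: "(\<Sum>\<beta>\<in>UNIV. k \<beta> * (if \<beta> \<in> S then F \<beta> u else 0)) = (\<Sum>b\<in>S. k b * F b u)" for k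
    by (subst sum_restrict) (auto intro!: sum.cong)
  show "euler_lagrange \<A> (kinetic g) Z (X c) u = (\<Sum>b\<in>S. gram g X c b (fst u) * F b u) - spray_force \<A> g X c u"
    unfolding Z_def euler_lagrange_frame[OF second_order_field_at[OF u']] second_order_field_qvel[OF u'] r ..
  show "euler_lagrange \<A> (kinetic gh) Z (X c) u = (\<Sum>b\<in>S. gram g X c b (fst u) * F b u) - spray_force \<A> gh X c u"
    unfolding Z_def hat.euler_lagrange_frame[OF second_order_field_at[OF u']] second_order_field_qvel[OF u'] r
    using c by (simp add: gram_agree[OF q])
qed

text \<open>Because the matrix \<open>(g\<^bsub>\<alpha>\<beta>\<^esub>)\<close> is block diagonal, the nonholonomic equations coincide with the geodesic
  equations of \<open>g\<close> in the directions of \<open>S\<close>; the remaining components of the geodesic spray are dropped.\<close>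

lemma nonholonomic_field_eq:
  "nonholonomic_field \<A> X S D (kinetic g) =
    (\<lambda>u h. if u \<in> constraint_set \<A> X S
      then second_order_field \<A> X (\<lambda>\<alpha> w. if \<alpha> \<in> S then spray_coeff \<A> g X \<alpha> w else 0) u h else 0)"
  (is "_ = ?N")
  unfolding nonholonomic_field_def euler_lagrange_def[symmetric]
proof (rule the_equality)
  let ?C = "constraint_set \<A> X S" and ?f = "spray_coeff \<A> g X"
  let ?Z = "\<lambda>F. second_order_field \<A> X (\<lambda>\<alpha> w. if \<alpha> \<in> S then F \<alpha> w else 0)"
  have N: "?N u = ?Z ?f u" if "u \<in> ?C" for u
    using that by simp
  have solves: "(\<forall>Y\<in>sections_of \<A> D. euler_lagrange \<A> (kinetic g) (?Z F u) Y u = 0) \<longleftrightarrow>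
      (\<forall>a\<in>S. F a u = ?f a u)" if u: "u \<in> ?C" for F u
    unfolding spray_coeff_restrict_unique[OF constraint_setD(1)[OF u]]
      euler_lagrange_sections_iff[OF second_order_field_at[OF constraint_setD(1)[OF u]] smooth_fun_kinetic]
    by (simp add: euler_lagrange_constraint(1)[OF u])
  have "nonholonomic_form \<A> X S ?N"
    unfolding nonholonomic_form_def
  proof (intro conjI ballI exI[of _ ?f])
    fix u assume u: "u \<in> ?C"
    show "?N u \<in> tangent_space (TQ \<A>) u"
      using second_order_field_tangent[OF constraint_setD(1)[OF u]] by (simp add: u)
    show "?N u (qvel X i) = 0" if "i \<in> - S" for i
      using that by (simp add: u second_order_field_qvel[OF constraint_setD(1)[OF u]])
  next
    show "smooth_fun_on (TQ \<A>) ?C (?f a)" for a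
      unfolding smooth_fun_on_def
    proof
      fix u assume "u \<in> ?C"
      note u = constraint_setD(1)[OF this]
      obtain U \<phi> where "(TQ_dom \<A> U, TQ_chart \<phi>) \<in> TQ \<A>" "u \<in> TQ_dom \<A> U"
        by (rule carrier_TQ_chart[OF u])
      then show "\<exists>F. smooth_near (TQ \<A>) u F \<and> (\<exists>(U, \<phi>)\<in>TQ \<A>. u \<in> U \<and>
          (\<exists>V. open V \<and> \<phi> u \<in> V \<and> (\<forall>w\<in>?C \<inter> U. \<phi> w \<in> V \<longrightarrow> ?f a w = F w)))"
        using smooth_near_spray_coeff[OF u] by (intro exI[of _ "?f a"]) auto
    qed
    show "?N = (\<lambda>u h. if u \<in> ?C then \<Sum>a\<in>S. qvel X a u * clift \<A> (X a) u h + ?f a u * vlift \<A> (X a) u h else 0)"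
      by (intro ext) (simp add: second_order_field_constraint)
  qed
  moreover have "\<forall>Y\<in>sections_of \<A> D. euler_lagrange \<A> (kinetic g) (?N u) Y u = 0" if u: "u \<in> ?C" for u
    using solves[OF u, of ?f] u by simp
  ultimately show "nonholonomic_form \<A> X S ?N \<and>
      (\<forall>Y\<in>sections_of \<A> D. \<forall>u\<in>?C. euler_lagrange \<A> (kinetic g) (?N u) Y u = 0)"
    by blast
  fix \<Gamma>
  assume \<Gamma>: "nonholonomic_form \<A> X S \<Gamma> \<and>
      (\<forall>Y\<in>sections_of \<A> D. \<forall>u\<in>?C. euler_lagrange \<A> (kinetic g) (\<Gamma> u) Y u = 0)"
  then obtain F where F: "\<Gamma> = (\<lambda>u h. if u \<in> ?C
      then \<Sum>a\<in>S. qvel X a u * clift \<A> (X a) u h + F a u * vlift \<A> (X a) u h else 0)"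
    unfolding nonholonomic_form_def by blast
  then have F': "\<Gamma> u = ?Z F u" if "u \<in> ?C" for u
    using that by (simp add: second_order_field_constraint)
  show "\<Gamma> = ?N"
  proof
    fix u
    show "\<Gamma> u = ?N u"
    proof (cases "u \<in> ?C")
      case True
      then have "\<forall>Y\<in>sections_of \<A> D. euler_lagrange \<A> (kinetic g) (?Z F u) Y u = 0"
        using \<Gamma> by (simp flip: F'[OF True])
      then have "\<forall>a\<in>S. F a u = ?f a u"
        unfolding solves[OF True] .
      then have "?Z F u = ?Z ?f u"
        by (simp add: second_order_field_def cong: if_cong)
      then show ?thesis
        using F'[OF True] True by simp
    qed (simp add: F)
  qed
qed

lemma nonholonomic_solves_hat_iff:
  "(\<forall>Y\<in>sections_of \<A> D. \<forall>u\<in>constraint_set \<A> X S.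
      euler_lagrange \<A> (kinetic gh) (nonholonomic_field \<A> X S D (kinetic g) u) Y u = 0)
    \<longleftrightarrow> condition_A \<A> X S gh"
proof -
  let ?Z = "second_order_field \<A> X (\<lambda>\<alpha> w. if \<alpha> \<in> S then spray_coeff \<A> g X \<alpha> w else 0)"
  have "(\<forall>Y\<in>sections_of \<A> D. euler_lagrange \<A> (kinetic gh) (nonholonomic_field \<A> X S D (kinetic g) u) Y u = 0)
      \<longleftrightarrow> (\<forall>c\<in>S. spray_force \<A> gh X c u = spray_force \<A> g X c u)" if u: "u \<in> constraint_set \<A> X S" for u
  proof -
    note u' = constraint_setD(1)[OF u]
    have "nonholonomic_field \<A> X S D (kinetic g) u = ?Z u"
      using u by (simp add: nonholonomic_field_eq)
    moreover have "(\<forall>Y\<in>sections_of \<A> D. euler_lagrange \<A> (kinetic gh) (?Z u) Y u = 0) \<longleftrightarrow>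
        (\<forall>c\<in>S. (\<Sum>b\<in>S. gram g X c b (fst u) * spray_coeff \<A> g X b u) - spray_force \<A> gh X c u = 0)"
      unfolding euler_lagrange_sections_iff[OF second_order_field_at[OF u'] hat.smooth_fun_kinetic]
      by (simp add: euler_lagrange_constraint(2)[OF u])
    moreover have "\<forall>c\<in>S. (\<Sum>b\<in>S. gram g X c b (fst u) * spray_coeff \<A> g X b u) = spray_force \<A> g X c u"
      using spray_coeff_restrict_unique[OF u', of "\<lambda>b. spray_coeff \<A> g X b u"] by simp
    ultimately show ?thesis
      by auto
  qed
  then show ?thesis
    unfolding condition_A_iff by blast
qed

subsection \<open>The complement of the distribution with respect to the modified metric\<close>

text \<open>The matrix \<open>(g\<^bsub>\<alpha>\<beta>\<^esub>)\<close> is block diagonal, so the inverse of its block is the block of its inverse.\<close>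

lemma gram_inv_eq:
  assumes q: "q \<in> carrier_of \<A>"
  shows "gram_inv g X S q =
    (\<lambda>a b. if a \<in> S \<and> b \<in> S then matrix_inv (\<chi> \<alpha> \<beta>. gram g X \<alpha> \<beta> q) $ a $ b else 0)"
  (is "_ = ?h")
  unfolding gram_inv_def gram_def[symmetric]
proof (rule the_equality)
  let ?G = "(\<chi> \<alpha> \<beta>. gram g X \<alpha> \<beta> q) :: real ^ 'n ^ 'n"
  have left: "(\<Sum>b\<in>S. ?h a b * gram g X b c q) = (if a = c then 1 else 0)" if ac: "a \<in> S" "c \<in> S" for a c
  proof -
    have "(\<Sum>\<beta>\<in>UNIV. matrix_inv ?G $ a $ \<beta> * gram g X \<beta> c q) = (matrix_inv ?G ** ?G) $ a $ c"
      by (simp add: matrix_matrix_mult_def)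
    also have "\<dots> = (if a = c then 1 else 0)"
      by (simp add: matrix_inv_left[OF gram_matrix_invertible[OF q]] mat_def)
    also have "(\<Sum>\<beta>\<in>UNIV. matrix_inv ?G $ a $ \<beta> * gram g X \<beta> c q) = (\<Sum>b\<in>S. matrix_inv ?G $ a $ b * gram g X b c q)"
      by (rule sum_restrict) (use ac in \<open>simp add: gram_sym[OF q, of _ c] gram_orthogonal[OF q]\<close>)
    finally show ?thesis
      using ac by (simp cong: sum.cong)
  qed
  then show "(\<forall>a b. a \<notin> S \<or> b \<notin> S \<longrightarrow> ?h a b = 0) \<and>
      (\<forall>a\<in>S. \<forall>c\<in>S. (\<Sum>b\<in>S. ?h a b * gram g X b c q) = (if a = c then 1 else 0))"
    by simp
  fix h
  assume h: "(\<forall>a b. a \<notin> S \<or> b \<notin> S \<longrightarrow> h a b = 0) \<and>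
      (\<forall>a\<in>S. \<forall>c\<in>S. (\<Sum>b\<in>S. h a b * gram g X b c q) = (if a = c then 1 else 0))"
  show "h = ?h"
  proof (intro ext)
    fix a b
    show "h a b = ?h a b"
    proof (cases "a \<in> S \<and> b \<in> S")
      case True
      have "h a b - ?h a b = 0"
      proof (rule gram_injective_restrict[OF q, of "\<lambda>b. h a b - ?h a b"])
        show "(\<Sum>b\<in>S. gram g X c b q * (h a b - ?h a b)) = 0" if c: "c \<in> S" for c
        proof -
          have "(\<Sum>b\<in>S. gram g X c b q * (h a b - ?h a b)) =
              (\<Sum>b\<in>S. h a b * gram g X b c q) - (\<Sum>b\<in>S. ?h a b * gram g X b c q)"
            by (simp add: right_diff_distrib sum_subtractf gram_sym[OF q, of c] mult.commute)
          then show ?thesis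
            using h True c left[of a c] by simp
        qed
      qed (use True in simp)
      then show ?thesis
        by simp
    qed (use h in auto)
  qed
qed

lemma smooth_near_gram_inv:
  assumes q: "q \<in> carrier_of \<A>"
  shows "smooth_near \<A> q (\<lambda>r. gram_inv g X S r a b)"
proof (cases "a \<in> S \<and> b \<in> S")
  case True
  obtain U \<phi> where c: "(U, \<phi>) \<in> \<A>" "q \<in> U"
    using q by (auto simp: in_carrier_of)
  have r: "r \<in> carrier_of \<A>" if "r \<in> U" for r
    using that c by (auto simp: in_carrier_of)
  have "smooth_near \<A> q (\<lambda>r. matrix_inv (\<chi> \<alpha> \<beta>. gram g X \<alpha> \<beta> r) $ a $ b)"
  proof (rule smooth_near_linear_system[OF c, where M = "gram g X" and y = "\<lambda>\<alpha> r. if \<alpha> = b then 1 else 0"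
        and c = "\<lambda>\<beta> r. matrix_inv (\<chi> \<alpha> \<beta>. gram g X \<alpha> \<beta> r) $ \<beta> $ b"])
    fix r \<alpha> assume "r \<in> U"
    let ?G = "(\<chi> \<alpha> \<beta>. gram g X \<alpha> \<beta> r) :: real ^ 'n ^ 'n"
    have "(\<Sum>\<beta>\<in>UNIV. gram g X \<alpha> \<beta> r * matrix_inv ?G $ \<beta> $ b) = (?G ** matrix_inv ?G) $ \<alpha> $ b"
      by (simp add: matrix_matrix_mult_def)
    then show "(\<Sum>\<beta>\<in>UNIV. gram g X \<alpha> \<beta> r * matrix_inv ?G $ \<beta> $ b) = (if \<alpha> = b then 1 else 0)"
      by (simp add: matrix_inv_right[OF gram_matrix_invertible[OF r[OF \<open>r \<in> U\<close>]]] mat_def)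
  next
    show "z = (\<lambda>_. 0)" if "r \<in> U" "\<And>\<alpha>. (\<Sum>\<beta>\<in>UNIV. gram g X \<alpha> \<beta> r * z \<beta>) = 0" for r z
      by (rule gram_injective[OF r[OF that(1)] that(2)])
  qed (simp_all add: smooth_near_gram[OF q] smooth_near_const[OF q])
  then show ?thesis
    by (rule smooth_near_cong_carrier) (simp add: gram_inv_eq True)
next
  case False
  show ?thesis
    by (rule smooth_near_cong_carrier[OF smooth_near_const[OF q, of 0]]) (use False in \<open>auto simp: gram_inv_eq\<close>)
qed

lemma smooth_near_hat_coeff:
  assumes q: "q \<in> carrier_of \<A>"
  shows "smooth_near \<A> q (hat_coeff g gh X S i \<alpha>)"
proof (cases "\<alpha> \<in> S")
  case True
  have "smooth_near \<A> q (\<lambda>r. - (\<Sum>b\<in>S. gram_inv g X S r \<alpha> b * gram gh X b i r))"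
    by (intro smooth_near_minus smooth_near_sum q smooth_near_mult smooth_near_gram_inv hat.smooth_near_gram)
  with True show ?thesis
    by (simp add: hat_coeff_def[abs_def])
next
  case False
  then show ?thesis
    using smooth_near_const[OF q] by (simp add: hat_coeff_def[abs_def])
qed

text \<open>Since \<open>gh\<^bsub>ca\<^esub> g\<^sup>a\<^sup>b = g\<^bsub>ca\<^esub> g\<^sup>a\<^sup>b = \<delta>\<^bsub>c\<^esub>\<^sup>b\<close>, the correction term of \<open>Xhat\<^sub>i\<close> cancels \<open>gh\<^bsub>ci\<^esub>\<close>: the field is
  \<open>gh\<close>-orthogonal to the distribution.\<close>

lemma hat_coeff_orthogonal:
  assumes q: "q \<in> carrier_of \<A>" and i: "i \<notin> S" and c: "c \<in> S"
  shows "(\<Sum>\<alpha>\<in>UNIV. gram gh X c \<alpha> q * hat_coeff g gh X S i \<alpha> q) = 0"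
proof -
  let ?G = "(\<chi> \<alpha> \<beta>. gram g X \<alpha> \<beta> q) :: real ^ 'n ^ 'n"
  have right: "(\<Sum>a\<in>S. gram g X c a q * gram_inv g X S q a b) = (if c = b then 1 else 0)" if b: "b \<in> S" for b
  proof -
    have "(\<Sum>a\<in>S. gram g X c a q * gram_inv g X S q a b) = (\<Sum>a\<in>S. gram g X c a q * matrix_inv ?G $ a $ b)"
      using b by (simp add: gram_inv_eq[OF q] cong: sum.cong)
    also have "\<dots> = (\<Sum>\<alpha>\<in>UNIV. gram g X c \<alpha> q * matrix_inv ?G $ \<alpha> $ b)"
      by (rule gram_sum_restrict[OF q c, symmetric])
    also have "\<dots> = (?G ** matrix_inv ?G) $ c $ b"
      by (simp add: matrix_matrix_mult_def)
    finally show ?thesis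
      by (simp add: matrix_inv_right[OF gram_matrix_invertible[OF q]] mat_def)
  qed
  have "(\<Sum>a\<in>S. gram gh X c a q * hat_coeff g gh X S i a q) =
      - (\<Sum>a\<in>S. \<Sum>b\<in>S. gram g X c a q * gram_inv g X S q a b * gram gh X b i q)"
    using c by (simp add: hat_coeff_def gram_agree[OF q] sum_distrib_left sum_negf mult.assoc cong: sum.cong)
  also have "(\<Sum>a\<in>S. \<Sum>b\<in>S. gram g X c a q * gram_inv g X S q a b * gram gh X b i q) =
      (\<Sum>b\<in>S. (\<Sum>a\<in>S. gram g X c a q * gram_inv g X S q a b) * gram gh X b i q)"
    unfolding sum_distrib_right by (rule sum.swap)
  also have "\<dots> = (\<Sum>b\<in>S. (if c = b then 1 else 0) * gram gh X b i q)"
    by (simp add: right cong: sum.cong)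
  also have "\<dots> = gram gh X c i q"
    using c by (simp add: if_distrib[of "\<lambda>x. x * _"] cong: if_cong)
  finally have "(\<Sum>a\<in>S. gram gh X c a q * hat_coeff g gh X S i a q) = - gram gh X c i q" .
  moreover have "(\<Sum>\<alpha>\<in>-S. gram gh X c \<alpha> q * hat_coeff g gh X S i \<alpha> q) = gram gh X c i q"
    using i by (simp add: hat_coeff_def if_distrib[of "\<lambda>x. _ * x"] cong: if_cong)
  ultimately show ?thesis
    by (simp add: sum_split)
qed

lemma Xhat_expand:
  assumes i: "i \<notin> S"
  shows "Xhat g gh X S i q = (\<lambda>f. \<Sum>\<alpha>\<in>UNIV. hat_coeff g gh X S i \<alpha> q * X \<alpha> q f)"
proof
  fix f
  have "(\<Sum>\<alpha>\<in>-S. hat_coeff g gh X S i \<alpha> q * X \<alpha> q f) = X i q f"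
    using i by (simp add: hat_coeff_def if_distrib[of "\<lambda>x. x * _"] cong: if_cong)
  moreover have "(\<Sum>a\<in>S. hat_coeff g gh X S i a q * X a q f) =
      - (\<Sum>a\<in>S. \<Sum>b\<in>S. gram_inv g X S q a b * gh q (X b q) (X i q) * X a q f)"
    by (simp add: hat_coeff_def gram_def sum_distrib_right sum_negf cong: sum.cong)
  ultimately show "Xhat g gh X S i q f = (\<Sum>\<alpha>\<in>UNIV. hat_coeff g gh X S i \<alpha> q * X \<alpha> q f)"
    by (simp add: Xhat_def sum_split)
qed

lemma sum_hat_coeff_complement:
  "j \<notin> S \<Longrightarrow> (\<Sum>i\<in>-S. \<xi> i * hat_coeff g gh X S i j q) = \<xi> j"
  by (simp add: hat_coeff_def if_distrib[of "\<lambda>x. _ * x"] cong: if_cong)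

lemma vlift_Xhat:
  assumes u: "u \<in> carrier_of (TQ \<A>)"
  shows "(\<Sum>i\<in>-S. \<xi> i * vlift \<A> (Xhat g gh X S i) u h) =
    (\<Sum>\<alpha>\<in>UNIV. (\<Sum>i\<in>-S. \<xi> i * hat_coeff g gh X S i \<alpha> (fst u)) * vlift \<A> (X \<alpha>) u h)"
proof -
  note q = carrier_TQ_fst[OF u]
  have "vlift \<A> (Xhat g gh X S i) u h = (\<Sum>\<alpha>\<in>UNIV. hat_coeff g gh X S i \<alpha> (fst u) * vlift \<A> (X \<alpha>) u h)"
    if "i \<in> -S" for i
    using that vlift_expand[OF u, of "Xhat g gh X S i" h] Xhat_expand[of i "fst u"]
      frame_combination_tangent[OF q] frame_coeff_combination[OF q Xhat_expand[of i "fst u"]] by simp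
  then have "(\<Sum>i\<in>-S. \<xi> i * vlift \<A> (Xhat g gh X S i) u h) =
      (\<Sum>i\<in>-S. \<Sum>\<alpha>\<in>UNIV. \<xi> i * hat_coeff g gh X S i \<alpha> (fst u) * vlift \<A> (X \<alpha>) u h)"
    by (intro sum.cong[OF refl]) (simp add: sum_distrib_left mult.assoc)
  also have "\<dots> = (\<Sum>\<alpha>\<in>UNIV. \<Sum>i\<in>-S. \<xi> i * hat_coeff g gh X S i \<alpha> (fst u) * vlift \<A> (X \<alpha>) u h)"
    by (rule sum.swap)
  finally show ?thesis
    by (simp only: sum_distrib_right)
qed

subsection \<open>The projected spray\<close>

lemma smooth_near_tangential_coeff:
  "u \<in> carrier_of (TQ \<A>) \<Longrightarrow> smooth_near (TQ \<A>) u (tangential_coeff \<A> g gh X S \<alpha>)"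
  unfolding tangential_coeff_def[abs_def]
  by (intro T.smooth_near_diff T.smooth_near_sum T.smooth_near_mult hat.smooth_near_spray_coeff
      smooth_near_TQ_base smooth_near_hat_coeff carrier_TQ_fst)

lemma tangential_coeff_complement: "i \<notin> S \<Longrightarrow> tangential_coeff \<A> g gh X S i u = 0"
  by (simp add: tangential_coeff_def sum_hat_coeff_complement)

text \<open>By orthogonality, subtracting a combination of the \<open>Xhat\<^sub>i\<^sup>V\<close> does not change the geodesic equations of
  \<open>gh\<close> in the directions of the distribution.\<close>

lemma tangential_coeff_equation:
  assumes u: "u \<in> carrier_of (TQ \<A>)" and c: "c \<in> S"
  shows "(\<Sum>b\<in>S. gram g X c b (fst u) * tangential_coeff \<A> g gh X S b u) = spray_force \<A> gh X c u"
proof -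
  note q = carrier_TQ_fst[OF u]
  let ?G = "\<lambda>\<alpha>. gram gh X c \<alpha> (fst u)" and ?F = "\<lambda>\<alpha>. spray_coeff \<A> gh X \<alpha> u"
    and ?h = "\<lambda>i \<alpha>. hat_coeff g gh X S i \<alpha> (fst u)"
  have "(\<Sum>b\<in>S. gram g X c b (fst u) * tangential_coeff \<A> g gh X S b u) =
      (\<Sum>b\<in>S. ?G b * tangential_coeff \<A> g gh X S b u)"
    using c by (simp add: gram_agree[OF q] cong: sum.cong)
  also have "\<dots> = (\<Sum>\<alpha>\<in>UNIV. ?G \<alpha> * tangential_coeff \<A> g gh X S \<alpha> u)"
    by (rule sum_restrict[symmetric]) (simp add: tangential_coeff_complement)
  also have "\<dots> = (\<Sum>\<alpha>\<in>UNIV. ?G \<alpha> * ?F \<alpha>) - (\<Sum>\<alpha>\<in>UNIV. \<Sum>i\<in>-S. ?F i * (?G \<alpha> * ?h i \<alpha>))"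
    by (simp add: tangential_coeff_def right_diff_distrib sum_subtractf sum_distrib_left mult_ac)
  also have "(\<Sum>\<alpha>\<in>UNIV. \<Sum>i\<in>-S. ?F i * (?G \<alpha> * ?h i \<alpha>)) = (\<Sum>i\<in>-S. ?F i * (\<Sum>\<alpha>\<in>UNIV. ?G \<alpha> * ?h i \<alpha>))"
    by (subst sum.swap) (simp add: sum_distrib_left)
  also have "\<dots> = 0"
    by (simp add: hat_coeff_orthogonal[OF q _ c])
  also have "(\<Sum>\<alpha>\<in>UNIV. ?G \<alpha> * ?F \<alpha>) = spray_force \<A> gh X c u"
    by (rule hat.spray_coeff_equation[OF u])
  finally show ?thesis
    by simp
qed

text \<open>The coefficients of the projected spray and of the nonholonomic field solve linear systems with the same
  invertible matrix \<open>(g\<^bsub>ab\<^esub>)\<close>, whose right hand sides are the forces of \<open>gh\<close> and of \<open>g\<close>. So they agree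
  exactly when the forces do.\<close>

lemma sode_extension_iff:
  assumes F: "\<And>\<alpha>. smooth_fun (TQ \<A>) (F \<alpha>)"
    and FC: "\<And>u \<alpha>. u \<in> constraint_set \<A> X S \<Longrightarrow> F \<alpha> u = tangential_coeff \<A> g gh X S \<alpha> u"
  shows "sode_extension \<A> X S (nonholonomic_field \<A> X S D (kinetic g)) (second_order_field \<A> X F)
    \<longleftrightarrow> condition_A \<A> X S gh"
proof -
  have "second_order_field \<A> X F u = nonholonomic_field \<A> X S D (kinetic g) u \<longleftrightarrow>
      (\<forall>c\<in>S. spray_force \<A> gh X c u = spray_force \<A> g X c u)" if u: "u \<in> constraint_set \<A> X S" for u
  proof -
    note u' = constraint_setD(1)[OF u]
    let ?E = "\<lambda>\<alpha> w. if \<alpha> \<in> S then spray_coeff \<A> g X \<alpha> w else 0"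
    have "second_order_field \<A> X F u = nonholonomic_field \<A> X S D (kinetic g) u \<longleftrightarrow>
        second_order_field \<A> X F u = second_order_field \<A> X ?E u"
      using u by (simp add: nonholonomic_field_eq)
    also have "second_order_field \<A> X F u = second_order_field \<A> X ?E u \<longleftrightarrow> (\<forall>\<alpha>. F \<alpha> u = ?E \<alpha> u)"
    proof
      assume eq: "second_order_field \<A> X F u = second_order_field \<A> X ?E u"
      show "\<forall>\<alpha>. F \<alpha> u = ?E \<alpha> u"
      proof
        show "F \<alpha> u = ?E \<alpha> u" for \<alpha>
          using fun_cong[OF eq, of "qvel X \<alpha>"] unfolding second_order_field_qvel[OF u'] .
      qed
    next
      assume "\<forall>\<alpha>. F \<alpha> u = ?E \<alpha> u"
      then show "second_order_field \<A> X F u = second_order_field \<A> X ?E u"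
        unfolding second_order_field_def by presburger
    qed
    also have "(\<forall>\<alpha>. F \<alpha> u = ?E \<alpha> u) \<longleftrightarrow> (\<forall>a\<in>S. tangential_coeff \<A> g gh X S a u = spray_coeff \<A> g X a u)"
      using FC[OF u] tangential_coeff_complement by auto
    also have "\<dots> \<longleftrightarrow> (\<forall>c\<in>S. spray_force \<A> gh X c u = spray_force \<A> g X c u)"
      unfolding spray_coeff_restrict_unique[OF u'] by (simp add: tangential_coeff_equation[OF u'])
    finally show ?thesis .
  qed
  moreover have "sode \<A> X (second_order_field \<A> X F)"
    unfolding sode_iff using F by blast
  ultimately show ?thesis
    unfolding sode_extension_def condition_A_iff by blast
qed

text \<open>Both the existence and the uniqueness of the decomposition are read off on the functions \<open>v\<^sup>i\<close>: the first
  summand annihilates them, and \<open>Xhat\<^sub>j\<^sup>V(v\<^sup>i) = \<delta>\<^sub>i\<^sub>j\<close>, so the coefficients of the second summand are \<open>F\<^sup>i\<close>.\<close>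

lemma phat_spray: "phat \<A> g gh X S (geodesic_spray \<A> X gh) = second_order_field \<A> X (tangential_coeff \<A> g gh X S)"
  unfolding phat_def
proof (rule the_equality)
  let ?W = "second_order_field \<A> X (tangential_coeff \<A> g gh X S)"
  let ?F = "spray_coeff \<A> gh X"
  let ?V = "\<lambda>u h. \<Sum>i\<in>-S. ?F i u * vlift \<A> (Xhat g gh X S i) u h"
  have V: "?V \<in> XhatV \<A> g gh X S"
    unfolding XhatV_def smooth_fun_def
    by (intro CollectI exI[of _ ?F]) (simp add: hat.smooth_near_spray_coeff)
  have "sode \<A> X ?W"
    unfolding sode_iff smooth_fun_def
    by (intro exI[of _ "tangential_coeff \<A> g gh X S"]) (simp add: smooth_near_tangential_coeff)
  then have W: "?W \<in> XT \<A> X S"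
    unfolding XT_def sode_def by (simp add: second_order_field_qvel tangential_coeff_complement)
  have decomposition: "geodesic_spray \<A> X gh u h = ?W u h + ?V u h" for u h
  proof (cases "u \<in> carrier_of (TQ \<A>)")
    case True
    show ?thesis
      unfolding hat.geodesic_spray_eq vlift_Xhat[OF True] second_order_field_def tangential_coeff_def
      by (simp add: left_diff_distrib sum.distrib sum_subtractf)
  next
    case False
    then show ?thesis
      by (simp add: hat.geodesic_spray_eq second_order_field_off_carrier vlift_off_carrier)
  qed
  with W V show "?W \<in> XT \<A> X S \<and> (\<exists>V\<in>XhatV \<A> g gh X S. geodesic_spray \<A> X gh = (\<lambda>u h. ?W u h + V u h))"
    by (intro conjI bexI[OF _ V] ext) auto
  fix W' assume "W' \<in> XT \<A> X S \<and> (\<exists>V\<in>XhatV \<A> g gh X S. geodesic_spray \<A> X gh = (\<lambda>u h. W' u h + V u h))"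
  then obtain \<xi> where W': "vector_field (TQ \<A>) W'"
    "\<And>i u. i \<notin> S \<Longrightarrow> u \<in> carrier_of (TQ \<A>) \<Longrightarrow> W' u (qvel X i) = 0"
    and split: "\<And>u h. geodesic_spray \<A> X gh u h = W' u h + (\<Sum>i\<in>-S. \<xi> i u * vlift \<A> (Xhat g gh X S i) u h)"
    unfolding XT_def XhatV_def by auto
  show "W' = ?W"
  proof
    fix u
    show "W' u = ?W u"
    proof (cases "u \<in> carrier_of (TQ \<A>)")
      case u: True
      have "\<xi> j u = ?F j u" if j: "j \<notin> S" for j
      proof -
        have "?F j u = (\<Sum>i\<in>-S. \<xi> i u * vlift \<A> (Xhat g gh X S i) u (qvel X j))"
          using split[of u "qvel X j"] W'(2)[OF j u] by (simp add: hat.geodesic_spray_eq second_order_field_qvel[OF u])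
        also have "\<dots> = (\<Sum>i\<in>-S. \<xi> i u * hat_coeff g gh X S i j (fst u))"
          unfolding vlift_Xhat[OF u]
          by (simp add: vlift_frame_qvel[OF u] if_distrib[of "\<lambda>x. _ * x"] cong: if_cong)
        finally show ?thesis
          by (simp add: sum_hat_coeff_complement[OF j])
      qed
      then have "(\<Sum>i\<in>-S. \<xi> i u * vlift \<A> (Xhat g gh X S i) u h) = ?V u h" for h
        by (intro sum.cong refl) simp
      then have "W' u h = ?W u h" for h
        using split[of u h] decomposition[of u h] by simp
      then show ?thesis
        by blast
    next
      case False
      then show ?thesis
        using T.vector_field_off_carrier[OF W'(1)] by (simp add: second_order_field_off_carrier)
    qed
  qed
qed

subsection \<open>The spray corrected by the dynamical covariant derivative\<close>

lemma sode_coeff_second_order_field: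
  assumes u: "u \<in> carrier_of (TQ \<A>)"
  shows "sode_coeff \<A> X (second_order_field \<A> X F) \<alpha> u = F \<alpha> u"
proof -
  have "(THE c. second_order_field \<A> X F u = second_order_field \<A> X (\<lambda>\<beta> _. c \<beta>) u) = (\<lambda>\<beta>. F \<beta> u)"
  proof (rule the_equality)
    fix c assume eq: "second_order_field \<A> X F u = second_order_field \<A> X (\<lambda>\<beta> _. c \<beta>) u"
    show "c = (\<lambda>\<beta>. F \<beta> u)"
    proof
      show "c \<beta> = F \<beta> u" for \<beta>
        using fun_cong[OF eq, of "qvel X \<beta>"] unfolding second_order_field_qvel[OF u] by simp
    qed
  qed (simp add: second_order_field_def)
  then show ?thesis
    unfolding sode_coeff_def by (simp add: second_order_field_def)
qed

lemma hat_combination_orthogonal: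
  assumes q: "q \<in> carrier_of \<A>" and c: "c \<in> S"
  shows "(\<Sum>\<alpha>\<in>UNIV. gram gh X c \<alpha> q * (\<Sum>i\<in>-S. \<xi> i * hat_coeff g gh X S i \<alpha> q)) = 0"
proof -
  have "(\<Sum>\<alpha>\<in>UNIV. gram gh X c \<alpha> q * (\<Sum>i\<in>-S. \<xi> i * hat_coeff g gh X S i \<alpha> q)) =
      (\<Sum>i\<in>-S. \<xi> i * (\<Sum>\<alpha>\<in>UNIV. gram gh X c \<alpha> q * hat_coeff g gh X S i \<alpha> q))"
    unfolding sum_distrib_left by (subst sum.swap) (simp add: mult_ac)
  then show ?thesis
    by (simp add: hat_coeff_orthogonal[OF q _ c])
qed

lemma distribution_tangent:
  assumes q: "q \<in> carrier_of \<A>" and d: "d \<in> D q"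
  shows "d \<in> tangent_space \<A> q"
  using d frame_combination_tangent[OF q, of _ S] unfolding distribution_span[OF q] by auto

text \<open>\<open>Qhat(T) = v\<^sup>i Xhat\<^sub>i\<close>: the right hand side is orthogonal to the distribution, and it differs from
  \<open>T = v\<^sup>\<alpha> X\<^bsub>\<alpha>\<^esub>\<close> by a vector of the distribution.\<close>

lemma Qhat_canonical:
  assumes w: "w \<in> carrier_of (TQ \<A>)"
  shows "Qhat \<A> gh D (canonical_along X) w =
    (\<lambda>f. \<Sum>\<alpha>\<in>UNIV. (\<Sum>i\<in>-S. qvel X i w * hat_coeff g gh X S i \<alpha> (fst w)) * X \<alpha> (fst w) f)"
  unfolding Qhat_def
proof (rule the_equality)
  let ?q = "fst w" and ?\<zeta> = "\<lambda>\<alpha>. \<Sum>i\<in>-S. qvel X i w * hat_coeff g gh X S i \<alpha> (fst w)"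
  let ?P = "\<lambda>f. \<Sum>\<alpha>\<in>UNIV. ?\<zeta> \<alpha> * X \<alpha> ?q f" and ?T = "canonical_along X w"
  let ?N = "orth_compl \<A> gh D ?q"
  note q = carrier_TQ_fst[OF w]
  have P: "?P \<in> tangent_space \<A> ?q" and T: "?T \<in> tangent_space \<A> ?q"
    unfolding canonical_along_def by (rule frame_combination_tangent[OF q])+
  have N: "z \<in> ?N \<longleftrightarrow> z \<in> tangent_space \<A> ?q \<and> (\<forall>d\<in>D ?q. gh ?q z d = 0)" for z
    by (simp add: orth_compl_def)
  have diff: "(\<lambda>f. x f - y f) \<in> tangent_space \<A> ?q"
    if "x \<in> tangent_space \<A> ?q" "y \<in> tangent_space \<A> ?q" for x y
    using tangent_space_lin2[OF that, of 1 "-1"] by simp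
  have gh_diff: "gh ?q (\<lambda>f. x f - y f) z = gh ?q x z - gh ?q y z"
    if "x \<in> tangent_space \<A> ?q" "y \<in> tangent_space \<A> ?q" "z \<in> tangent_space \<A> ?q" for x y z
    using hat.metric_lin2[OF that, of 1 "-1"] by simp
  have "gh ?q ?P d = 0" if dD: "d \<in> D ?q" for d
  proof -
    obtain e where d: "d = (\<lambda>f. \<Sum>c\<in>S. e c * X c ?q f)"
      using dD by (auto simp: distribution_span[OF q])
    have frame: "gh ?q ?P (X c ?q) = (\<Sum>\<alpha>\<in>UNIV. ?\<zeta> \<alpha> * gram gh X \<alpha> c ?q)" for c
      unfolding gram_def by (rule hat.metric_sum_left[OF frame_tangent[OF q] frame_tangent[OF q]])
    have "gh ?q ?P d = (\<Sum>c\<in>S. e c * gh ?q ?P (X c ?q))"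
      unfolding d by (rule hat.metric_sum_right[OF P frame_tangent[OF q]])
    also have "\<dots> = (\<Sum>c\<in>S. e c * (\<Sum>\<alpha>\<in>UNIV. ?\<zeta> \<alpha> * gram gh X \<alpha> c ?q))"
      by (simp only: frame)
    also have "\<dots> = 0"
    proof (rule sum.neutral, rule ballI)
      fix c assume c: "c \<in> S"
      have "(\<Sum>\<alpha>\<in>UNIV. ?\<zeta> \<alpha> * gram gh X \<alpha> c ?q) = (\<Sum>\<alpha>\<in>UNIV. gram gh X c \<alpha> ?q * ?\<zeta> \<alpha>)"
        by (rule sum.cong[OF refl]) (subst hat.gram_sym[OF q], rule mult.commute)
      also have "\<dots> = 0"
        by (rule hat_combination_orthogonal[OF q c])
      finally have "(\<Sum>\<alpha>\<in>UNIV. ?\<zeta> \<alpha> * gram gh X \<alpha> c ?q) = 0" .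
      then show "e c * (\<Sum>\<alpha>\<in>UNIV. ?\<zeta> \<alpha> * gram gh X \<alpha> c ?q) = 0"
        by simp
    qed
    finally show ?thesis .
  qed
  then have PN: "?P \<in> ?N"
    using P by (simp add: N)
  have "(\<lambda>f. ?T f - ?P f) = (\<lambda>f. \<Sum>\<alpha>\<in>UNIV. (qvel X \<alpha> w - ?\<zeta> \<alpha>) * X \<alpha> ?q f)"
    by (simp add: canonical_along_def left_diff_distrib sum_subtractf)
  also have "\<dots> = (\<lambda>f. \<Sum>a\<in>S. (qvel X a w - ?\<zeta> a) * X a ?q f)"
    by (rule ext, rule sum_restrict) (simp add: sum_hat_coeff_complement)
  finally have "(\<lambda>f. ?T f - ?P f) = (\<lambda>f. \<Sum>a\<in>S. (qvel X a w - ?\<zeta> a) * X a ?q f)" .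
  then have TP: "(\<lambda>f. ?T f - ?P f) \<in> D ?q"
    unfolding distribution_span[OF q] mem_Collect_eq by (rule exI[of _ "\<lambda>a. qvel X a w - ?\<zeta> a"])
  have ortho: "gh ?q (\<lambda>f. ?T f - ?P f) z = 0" if "z \<in> ?N" for z
    using that TP hat.metric_sym[OF distribution_tangent[OF q TP], of z] by (auto simp: N)
  then show "?P \<in> ?N \<and> (\<forall>z\<in>?N. gh ?q (\<lambda>f. ?T f - ?P f) z = 0)"
    using PN by blast
  fix p assume p: "p \<in> ?N \<and> (\<forall>z\<in>?N. gh ?q (\<lambda>f. ?T f - p f) z = 0)"
  then have pt: "p \<in> tangent_space \<A> ?q"
    by (simp add: N)
  let ?z = "\<lambda>f. ?P f - p f"
  have z: "?z \<in> tangent_space \<A> ?q"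
    by (rule diff[OF P pt])
  have "gh ?q ?z d = 0" if "d \<in> D ?q" for d
    using that p PN by (simp add: gh_diff[OF P pt distribution_tangent[OF q that]] N)
  then have zN: "?z \<in> ?N"
    using z by (simp add: N)
  \<comment> \<open>The difference of two candidates is orthogonal to itself.\<close>
  have "gh ?q ?z ?z = gh ?q (\<lambda>f. ?T f - p f) ?z - gh ?q (\<lambda>f. ?T f - ?P f) ?z"
    by (simp only: gh_diff[OF P pt z] gh_diff[OF T pt z] gh_diff[OF T P z])
  also have "\<dots> = 0"
    using p ortho[OF zN] zN by simp
  finally have "?z = (\<lambda>f. 0)"
    using hat.metric_pos[OF z] by fastforce
  then show "p = ?P"
    by (simp add: fun_eq_iff)
qed

text \<open>\<open>Z\<close> denotes the components \<open>v\<^sup>i (Xhat\<^sub>i)\<^sup>\<alpha>\<close> of \<open>Qhat(T)\<close> and \<open>K\<close> the coefficients of the corrected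
  spray. The terms of the covariant derivative that are linear in \<open>Z\<close> vanish on the constraint manifold, and the remaining
  ones are \<open>F\<^sup>i (Xhat\<^sub>i)\<^sup>\<alpha>\<close>, exactly what the projection subtracts.\<close>

lemma sode_extension_spray_dyn_cov:
  "sode_extension \<A> X S (nonholonomic_field \<A> X S D (kinetic g))
     (\<lambda>u h. geodesic_spray \<A> X gh u h
        - vlift_along \<A> X (dyn_cov \<A> X (geodesic_spray \<A> X gh) (Qhat \<A> gh D (canonical_along X))) u h)
    \<longleftrightarrow> condition_A \<A> X S gh"
proof -
  let ?F = "spray_coeff \<A> gh X" and ?\<Gamma> = "second_order_field \<A> X (spray_coeff \<A> gh X)"
  let ?Q = "Qhat \<A> gh D (canonical_along X)"
  define Z where "Z \<alpha> w = frame_coeff X (fst w) (?Q w) \<alpha>" for \<alpha> w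
  define K where "K \<beta> u = ?F \<beta> u - frame_coeff X (fst u) (dyn_cov \<A> X ?\<Gamma> ?Q u) \<beta>" for \<beta> u
  have spray: "sode \<A> X ?\<Gamma>"
    unfolding sode_iff smooth_fun_def
    by (intro exI[of _ ?F]) (simp add: hat.smooth_near_spray_coeff)
  then have \<Gamma>: "vector_field (TQ \<A>) ?\<Gamma>"
    by (simp add: sode_def)
  have Z: "Z \<alpha> w = (\<Sum>i\<in>-S. qvel X i w * hat_coeff g gh X S i \<alpha> (fst w))" if "w \<in> carrier_of (TQ \<A>)" for \<alpha> w
    unfolding Z_def Qhat_canonical[OF that] frame_coeff_combination[OF carrier_TQ_fst[OF that] refl] ..
  have hc: "smooth_near (TQ \<A>) u (\<lambda>w. hat_coeff g gh X S i \<alpha> (fst w))" if "u \<in> carrier_of (TQ \<A>)" for i \<alpha> u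
    by (rule smooth_near_TQ_base[OF that smooth_near_hat_coeff[OF carrier_TQ_fst[OF that]]])
  have smooth_Z: "smooth_near (TQ \<A>) u (Z \<alpha>)" if u: "u \<in> carrier_of (TQ \<A>)" for \<alpha> u
  proof (rule T.smooth_near_cong_carrier)
    show "smooth_near (TQ \<A>) u (\<lambda>w. \<Sum>i\<in>-S. qvel X i w * hat_coeff g gh X S i \<alpha> (fst w))"
      by (intro T.smooth_near_sum u T.smooth_near_mult smooth_near_qvel hc)
  qed (simp add: Z)
  have coeff: "frame_coeff X (fst u) (dyn_cov \<A> X ?\<Gamma> ?Q u) \<beta> =
      ?\<Gamma> u (Z \<beta>) + (\<Sum>\<alpha>\<in>UNIV. Z \<alpha> u * dyn_cov_frame \<A> X ?\<Gamma> \<alpha> \<beta> u)" if u: "u \<in> carrier_of (TQ \<A>)" for u \<beta>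
  proof -
    have "dyn_cov \<A> X ?\<Gamma> ?Q u =
        (\<lambda>f. \<Sum>\<beta>\<in>UNIV. (?\<Gamma> u (Z \<beta>) + (\<Sum>\<alpha>\<in>UNIV. Z \<alpha> u * dyn_cov_frame \<A> X ?\<Gamma> \<alpha> \<beta> u)) * X \<beta> (fst u) f)"
    proof
      fix f
      have "(\<Sum>\<alpha>\<in>UNIV. Z \<alpha> u * (\<Sum>\<beta>\<in>UNIV. dyn_cov_frame \<A> X ?\<Gamma> \<alpha> \<beta> u * X \<beta> (fst u) f)) =
          (\<Sum>\<beta>\<in>UNIV. (\<Sum>\<alpha>\<in>UNIV. Z \<alpha> u * dyn_cov_frame \<A> X ?\<Gamma> \<alpha> \<beta> u) * X \<beta> (fst u) f)"
        unfolding sum_distrib_left sum_distrib_right by (subst sum.swap) (simp add: mult.assoc)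
      then show "dyn_cov \<A> X ?\<Gamma> ?Q u f =
          (\<Sum>\<beta>\<in>UNIV. (?\<Gamma> u (Z \<beta>) + (\<Sum>\<alpha>\<in>UNIV. Z \<alpha> u * dyn_cov_frame \<A> X ?\<Gamma> \<alpha> \<beta> u)) * X \<beta> (fst u) f)"
        unfolding dyn_cov_def Z_def[symmetric] by (simp add: sum.distrib distrib_right)
    qed
    then show ?thesis
      by (simp add: frame_coeff_combination[OF carrier_TQ_fst[OF u]])
  qed
  have smooth_frame: "smooth_near (TQ \<A>) u (dyn_cov_frame \<A> X ?\<Gamma> \<alpha> \<beta>)" if u: "u \<in> carrier_of (TQ \<A>)" for \<alpha> \<beta> u
  proof -
    have "smooth_near (TQ \<A>) u (sode_coeff \<A> X ?\<Gamma> \<beta>)"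
      by (rule T.smooth_near_cong_carrier[OF hat.smooth_near_spray_coeff[OF u, of \<beta>]])
        (simp add: sode_coeff_second_order_field)
    note V = T.vector_field_smooth[OF vector_field_vlift[OF frame_field] this]
    note R = smooth_near_TQ_base[OF u smooth_near_struct_fun[OF carrier_TQ_fst[OF u]]]
    show ?thesis
      unfolding dyn_cov_frame_def[abs_def]
      by (intro T.smooth_near_cmult T.smooth_near_add T.smooth_near_sum T.smooth_near_mult V R u smooth_near_qvel)
  qed
  have smooth_K: "smooth_fun (TQ \<A>) (K \<beta>)" for \<beta>
    unfolding smooth_fun_def
  proof
    fix u assume u: "u \<in> carrier_of (TQ \<A>)"
    show "smooth_near (TQ \<A>) u (K \<beta>)"
    proof (rule T.smooth_near_cong_carrier)
      show "smooth_near (TQ \<A>) u (\<lambda>w. ?F \<beta> w - (?\<Gamma> w (Z \<beta>) + (\<Sum>\<alpha>\<in>UNIV. Z \<alpha> w * dyn_cov_frame \<A> X ?\<Gamma> \<alpha> \<beta> w)))"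
        by (intro T.smooth_near_diff T.smooth_near_add T.smooth_near_sum T.smooth_near_mult
            hat.smooth_near_spray_coeff T.vector_field_smooth[OF \<Gamma>] smooth_Z smooth_frame u)
    qed (simp add: K_def coeff)
  qed
  \<comment> \<open>On the constraint manifold \<open>v\<^sup>i = 0\<close> and \<open>\<Gamma>(v\<^sup>i) = F\<^sup>i\<close>, so only the derivatives of the \<open>v\<^sup>i\<close> survive.\<close>
  have K: "K \<beta> u = tangential_coeff \<A> g gh X S \<beta> u" if uC: "u \<in> constraint_set \<A> X S" for \<beta> u
  proof -
    note u = constraint_setD(1)[OF uC] and v0 = constraint_setD(2)[OF uC]
    note \<Gamma>u = second_order_field_tangent[OF u, of ?F]
    note v = smooth_near_qvel[OF u]
    have "Z \<alpha> u = 0" for \<alpha>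
      by (simp add: Z[OF u] v0)
    moreover have "?\<Gamma> u (Z \<beta>) = (\<Sum>i\<in>-S. ?F i u * hat_coeff g gh X S i \<beta> (fst u))"
    proof -
      have "?\<Gamma> u (Z \<beta>) = ?\<Gamma> u (\<lambda>w. \<Sum>i\<in>-S. qvel X i w * hat_coeff g gh X S i \<beta> (fst w))"
        by (rule T.tangent_vector_cong_carrier[OF \<Gamma>u Z])
      also have "\<dots> = (\<Sum>i\<in>-S. ?\<Gamma> u (\<lambda>w. qvel X i w * hat_coeff g gh X S i \<beta> (fst w)))"
        by (intro T.tangent_vector_sum[OF \<Gamma>u] T.smooth_near_mult v hc[OF u])
      also have "\<dots> = (\<Sum>i\<in>-S. ?F i u * hat_coeff g gh X S i \<beta> (fst u))"
        by (intro sum.cong[OF refl])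
          (simp add: T.tangent_vector_mult[OF \<Gamma>u v hc[OF u]] v0 second_order_field_qvel[OF u])
      finally show ?thesis .
    qed
    ultimately show ?thesis
      by (simp add: K_def coeff[OF u] tangential_coeff_def)
  qed
  have "(\<lambda>u h. geodesic_spray \<A> X gh u h
        - vlift_along \<A> X (dyn_cov \<A> X (geodesic_spray \<A> X gh) ?Q) u h) = second_order_field \<A> X K"
    unfolding hat.geodesic_spray_eq
    by (intro ext) (simp add: vlift_along_def second_order_field_def K_def left_diff_distrib sum.distrib sum_subtractf)
  then show ?thesis
    using sode_extension_iff[OF smooth_K K] by simp
qed

end

section \<open>The equivalence theorem\<close>

lemma smooth_manifold_imp_smooth_atlas:
  assumes "smooth_manifold \<A>"
  shows "smooth_atlas \<A>"
proof
  have homeo: "open U \<and> open (\<phi> ` U) \<and> homeomorphism U (\<phi> ` U) \<phi> (inv_into U \<phi>)" if "(U, \<phi>) \<in> \<A>" for U \<phi>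
    using assms that unfolding smooth_manifold_def by blast
  fix U \<phi> assume c: "(U, \<phi>) \<in> \<A>"
  show "inj_on \<phi> U"
    using homeo[OF c] by (metis homeomorphism_def inj_on_inverseI)
  show "open (\<phi> ` U)"
    using homeo[OF c] by blast
  fix V \<psi> assume d: "(V, \<psi>) \<in> \<A>"
  have "openin (top_of_set U) (U \<inter> V)"
    using homeo[OF d] by (simp add: openin_open_Int)
  then have "openin (top_of_set (\<phi> ` U)) (\<phi> ` (U \<inter> V))"
    using homeo[OF c] homeomorphism_imp_open_map by blast
  then show "open (\<phi> ` (U \<inter> V))"
    using homeo[OF c] openin_open_trans by blast
  show "smooth_on (\<phi> ` (U \<inter> V)) (\<psi> \<circ> inv_into U \<phi>)"
    using assms c d unfolding smooth_manifold_def by blast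
qed

lemma adapted_frame_modified_metric:
  fixes \<A> :: "('q::{t2_space, second_countable_topology}, real ^ 'n::finite) atlas"
  assumes manifold: "smooth_manifold \<A>"
    and metric_g: "riemannian_metric \<A> g"
    and metric_gh: "riemannian_metric \<A> gh"
    and frame: "adapted_frame \<A> g D X S"
    and modification: "metric_modification D g gh"
  shows "modified_metric \<A> X g gh S D"
proof -
  interpret smooth_atlas \<A>
    by (rule smooth_manifold_imp_smooth_atlas[OF manifold])
  interpret tangent_bundle \<A> ..
  have field: "vector_field \<A> (X \<alpha>)" for \<alpha>
    using frame by (simp add: adapted_frame_def)
  have D: "D q = {v. \<exists>c. v = (\<lambda>f. \<Sum>a\<in>S. c a * X a q f)}"
    and N: "orth_compl \<A> g D q = {v. \<exists>c. v = (\<lambda>f. \<Sum>i\<in>-S. c i * X i q f)}" if "q \<in> carrier_of \<A>" for q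
    using frame that unfolding adapted_frame_def by blast+
  interpret framed_manifold \<A> X
  proof
    show "\<exists>!c. v = (\<lambda>f. \<Sum>\<alpha>\<in>UNIV. c \<alpha> * X \<alpha> q f)" if "v \<in> tangent_space \<A> q" for v q
      using frame that tangent_space_carrier[OF that] unfolding adapted_frame_def by blast
  qed (rule field)
  interpret riemannian_frame \<A> X g
    by unfold_locales (rule metric_g)
  interpret hat: riemannian_frame \<A> X gh
    by unfold_locales (rule metric_gh)
  have single: "X a q = (\<lambda>f. \<Sum>b\<in>I. (if b = a then 1 else 0) * X b q f)" if "a \<in> I" for a q and I :: "'n set"
    using that by (simp add: if_distrib[of "\<lambda>x. x * _"] cong: if_cong)
  have XD: "X a q \<in> D q" if "q \<in> carrier_of \<A>" "a \<in> S" for a q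
    unfolding D[OF that(1)] by (intro CollectI exI) (rule single[OF that(2)])
  have XN: "X i q \<in> orth_compl \<A> g D q" if "q \<in> carrier_of \<A>" "i \<notin> S" for i q
    unfolding N[OF that(1)] by (intro CollectI exI) (rule single, simp add: that)
  show ?thesis
  proof
    fix q assume q: "q \<in> carrier_of \<A>"
    show "gram g X a i q = 0" if "a \<in> S" "i \<notin> S" for a i
      using XN[OF q that(2)] XD[OF q that(1)] gram_sym[OF q, of a i] by (simp add: gram_def orth_compl_def)
    show "gram gh X a b q = gram g X a b q" if "a \<in> S" "b \<in> S" for a b
      using modification XD[OF q that(1)] XD[OF q that(2)] unfolding gram_def metric_modification_def by blast
    show "D q = {v. \<exists>c. v = (\<lambda>f. \<Sum>a\<in>S. c a * X a q f)}"
      by (rule D[OF q])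
  qed
qed

theorem proposition6:
  fixes \<A> :: "('q::{t2_space, second_countable_topology}, real ^ 'n::finite) atlas"
    and D :: "'q \<Rightarrow> 'q tvec set"
    and g gh :: "'q \<Rightarrow> 'q tvec \<Rightarrow> 'q tvec \<Rightarrow> real"
    and X :: "'n \<Rightarrow> 'q \<Rightarrow> 'q tvec"
    and S :: "'n set"
  assumes manifold: "smooth_manifold \<A>"
    and metric_g: "riemannian_metric \<A> g"
    and metric_gh: "riemannian_metric \<A> gh"
    and frame: "adapted_frame \<A> g D X S"
    and modification: "metric_modification D g gh"
  shows
    "(condition_A \<A> X S gh \<longleftrightarrow>
        sode_extension \<A> X S (nonholonomic_field \<A> X S D (kinetic g))
          (phat \<A> g gh X S (geodesic_spray \<A> X gh))) \<and>
     (condition_A \<A> X S gh \<longleftrightarrow>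
        sode_extension \<A> X S (nonholonomic_field \<A> X S D (kinetic g))
          (\<lambda>u h. geodesic_spray \<A> X gh u h
                 - vlift_along \<A> X (dyn_cov \<A> X (geodesic_spray \<A> X gh)
                                     (Qhat \<A> gh D (canonical_along X))) u h)) \<and>
     (condition_A \<A> X S gh \<longleftrightarrow>
        (\<forall>Y\<in>sections_of \<A> D. \<forall>u\<in>constraint_set \<A> X S.
           nonholonomic_field \<A> X S D (kinetic g) u (\<lambda>w. vlift \<A> Y w (kinetic gh))
           - clift \<A> Y u (kinetic gh) = 0))"
proof -
  interpret modified_metric \<A> X g gh S D
    by (rule adapted_frame_modified_metric[OF assms])
  have "sode_extension \<A> X S (nonholonomic_field \<A> X S D (kinetic g)) (phat \<A> g gh X S (geodesic_spray \<A> X gh))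
      \<longleftrightarrow> condition_A \<A> X S gh"
    unfolding phat_spray
    by (rule sode_extension_iff) (simp_all add: smooth_fun_def smooth_near_tangential_coeff)
  then show ?thesis
    using sode_extension_spray_dyn_cov nonholonomic_solves_hat_iff unfolding euler_lagrange_def by blast
qed

end
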